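(* (i) $R_{\rm gc}(3,\mathbb{S}^2)=\arccos\frac{1}{\sqrt3}$, and a family of $3$ great circles is $3$-extremal in $\mathbb{S}^2$ if and only if it consists of mutually orthogonal great circles. (ii) $R_{\rm gc}(4,\mathbb{S}^2)=\frac{\pi}{4}$, and a family of $4$ great circles is $4$-extremal in $\mathbb{S}^2$ if and only if the double normals of the great circles (i.e. the $8$ points $\pm\mathbf{n}_i$, where $\mathbf{n}_i$ is a unit normal vector of the plane of the $i$-th great circle) form the vertices of a cube inscribed in $\mathbb{S}^2$. (iii) $\arccos\left(\frac{1}{\tan\left(\left(1+\frac{2}{n^2-n+2}\right)\frac{\pi}{4}\right)}\right)\le R_{\rm gc}(n,\mathbb{S}^2)$ holds for $n>3$. (iv) $R_{\rm gc}(n,\mathbb{S}^2)\le\arcsin\left(\frac{8}{\sqrt3\,\sqrt[3]{n}}\right)$ holds for $n>3$.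
   Context: $\mathbb{S}^2$ is the unit sphere centered at the origin in Euclidean $3$-space. A great circle is the intersection of $\mathbb{S}^2$ with a plane through the origin. The (closed) spherical cap of center $\mathbf{x}\in\mathbb{S}^2$ and angular radius $r\in(0,\frac{\pi}{2}]$ is $\{\mathbf{y}\in\mathbb{S}^2:\langle\mathbf{y},\mathbf{x}\rangle\ge\cos r\}$. Finitely many great circles generate a tiling of $\mathbb{S}^2$ whose $2$-dimensional cells are the closures of the connected components of the complement of their union. For $n>1$, $R_{\rm gc}(n,\mathbb{S}^2)$ denotes the smallest $R>0$ such that there exists an arrangement of $n$ great circles in $\mathbb{S}^2$ with the property that each $2$-dimensional cell of the tiling generated by them can be covered by a spherical cap of radius $R$. An arrangement of $n$ great circles is called $n$-extremal if each $2$-dimensional cell of the tiling generated by them can be covered by a spherical cap of radius $R_{\rm gc}(n,\mathbb{S}^2)$.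
   Formalization: In (iv) the argument 8/(√3·∛n) exceeds 1 for 4 ≤ n ≤ 98, where arcsin is undefined; the formal statement uses arcsin(min(1, 8/(√3·∛n))), which is identical for n ≥ 99 and reads R_gc(n) ≤ π/2 for smaller n. *)

theory Defs
  imports "HOL-Analysis.Analysis"
begin

abbreviation S2 :: "(real^3) set" where
  "S2 \<equiv> sphere 0 1"

definition great_circle :: "(real^3) set \<Rightarrow> bool" where
  "great_circle C \<longleftrightarrow> (\<exists>P. subspace P \<and> dim P = 2 \<and> C = S2 \<inter> P)"

text \<open>Only used for centers in \<^term>\<open>S2\<close> and radii in \<open>(0, \<pi>/2]\<close>.\<close>

definition spherical_cap :: "real^3 \<Rightarrow> real \<Rightarrow> (real^3) set" where
  "spherical_cap x r = {y \<in> S2. y \<bullet> x \<ge> cos r}"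

definition arrangement :: "nat \<Rightarrow> (real^3) set set \<Rightarrow> bool" where
  "arrangement n F \<longleftrightarrow> finite F \<and> card F = n \<and> (\<forall>C\<in>F. great_circle C)"

definition cells :: "(real^3) set set \<Rightarrow> (real^3) set set" where
  "cells F = closure ` components (S2 - \<Union>F)"

definition cells_covered :: "(real^3) set set \<Rightarrow> real \<Rightarrow> bool" where
  "cells_covered F R \<longleftrightarrow> R \<in> {0<..pi/2} \<and> (\<forall>A\<in>cells F. \<exists>x\<in>S2. A \<subseteq> spherical_cap x R)"

text \<open>Since \<^const>\<open>Least\<close> is unspecified when there is no least element, every
  nontrivial claim about the following value relies on the minimum being attained.\<close>

definition R_gc :: "nat \<Rightarrow> real" where
  "R_gc n = (LEAST R. \<exists>F. arrangement n F \<and> cells_covered F R)"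

definition extremal :: "nat \<Rightarrow> (real^3) set set \<Rightarrow> bool" where
  "extremal n F \<longleftrightarrow> arrangement n F \<and> cells_covered F (R_gc n)"

text \<open>The plane of a great circle \<open>C\<close> is \<open>span C\<close>, so this set consists of two antipodal
  points.\<close>

definition unit_normals :: "(real^3) set \<Rightarrow> (real^3) set" where
  "unit_normals C = {u. norm u = 1 \<and> (\<forall>x\<in>span C. orthogonal u x)}"

definition orthogonal_circles :: "(real^3) set \<Rightarrow> (real^3) set \<Rightarrow> bool" where
  "orthogonal_circles C D \<longleftrightarrow> (\<forall>u\<in>unit_normals C. \<forall>v\<in>unit_normals D. orthogonal u v)"

definition double_normals :: "(real^3) set set \<Rightarrow> (real^3) set" where
  "double_normals F = (\<Union>C\<in>F. unit_normals C)"

text \<open>A cube is given by one vertex \<open>p\<close> and the three edge vectors \<open>a\<close>, \<open>b\<close>, \<open>c\<close> at \<open>p\<close>.\<close>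

definition cube_vertices :: "(real^3) set \<Rightarrow> bool" where
  "cube_vertices V \<longleftrightarrow> (\<exists>p a b c. a \<noteq> 0 \<and> norm b = norm a \<and> norm c = norm a \<and>
     orthogonal a b \<and> orthogonal a c \<and> orthogonal b c \<and>
     V = {p + i *\<^sub>R a + j *\<^sub>R b + k *\<^sub>R c | i j k. i \<in> {0, 1} \<and> j \<in> {0, 1} \<and> k \<in> {0, 1}})"

definition inscribed_cube_vertices :: "(real^3) set \<Rightarrow> bool" where
  "inscribed_cube_vertices V \<longleftrightarrow> cube_vertices V \<and> V \<subseteq> S2"

end

theory Submission
  imports Defs
begin

text \<open>
  A cell is the set of unit vectors with a prescribed strict sign pattern against the normals, so
  everything is stated for sets of normals and the cosine \<open>h\<close> of the covering radius.

  Three circles: if \<open>u, v, w\<close> are the vertex directions, the cell with signs \<open>i, j, k\<close> forces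
  \<open>\<bar>i u + j v + k w\<bar> \<ge> 3 h\<close>; averaging the squares over the signs gives \<open>9 h\<^sup>2 \<le> 3\<close>.

  Four circles: after rescaling, the normals sum to zero and the vertices are the edge directions of
  a tetrahedron. Two vertices in a common cap of radius at most \<open>\<pi>/4\<close> have nonnegative inner
  product; applied to the diagonals of the quadrangular cells this yields opposite signs for the
  products of opposite edge directions. Hence all of them vanish, the caps have radius
  exactly \<open>\<pi>/4\<close>, and their centers form an orthonormal frame which determines the normals.

  Lower bound: join the center of the cap of each cell to the sides of that cell. The resulting
  pyramids cover the unit ball up to a null set, there are at most \<open>4 n (n - 1)\<close> of them because a
  circle is cut into at most \<open>2 (n - 1)\<close> arcs, and each has volume at most \<open>(1 - h) / (3 h)\<close>. This
  is slightly stronger than the claimed bound and avoids Euler's formula and spherical areas.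

  Upper bound: the planes \<open>x\<^sub>a = t x\<^sub>b\<close> with \<open>t\<close> in an equidistant grid of \<open>[-1, 1]\<close> cut
  the surface of a cube into small squares.
\<close>

section \<open>Cells as sign patterns\<close>

text \<open>Nothing can be said about \<open>R_gc\<close> before the minimum is known to be
  attained. Compactness applies to \<open>n\<close>-tuples of unit normals, but a limit tuple may
  contain equal or opposite normals and so describe fewer than \<open>n\<close> circles. This is
  repaired by adding arbitrary great circles, which only refines the cells. A limit radius 0, which
  the definition excludes, is ruled out by the volume bound for finite \<open>n\<close>. Cones
  instead of subsets of the sphere make all conditions homogeneous, so normals may be rescaled at
  will. The strict signs persist under small perturbations of the normals, as the limit argument
  requires; vertices of cells are reached by a separate closure argument. With
  \<open>m = n (n - 1)\<close> the volume estimate says that \<open>h\<close> is at most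
  \<open>m / (m + pi)\<close>. That this implies the bound with the tangent comes down, to leading
  order, to \<open>pi < 4\<close>. The grid has radius of order \<open>1 / n\<close>, far below the
  inverse cube root that is claimed, so crude counting of its planes is enough.\<close>

text \<open>The elements of \<open>A\<close> are normals of the planes, not necessarily of length one; \<open>h\<close> is the cosine
  of the radius of the caps.\<close>

definition coverable :: "(real^3) set \<Rightarrow> real \<Rightarrow> bool" where
  "coverable A h \<longleftrightarrow> (\<forall>x. (\<forall>a\<in>A. a \<bullet> x \<noteq> 0) \<longrightarrow>
     (\<exists>c. norm c = 1 \<and> (\<forall>y. (\<forall>a\<in>A. 0 < (a \<bullet> x) * (a \<bullet> y)) \<longrightarrow> h * norm y \<le> c \<bullet> y)))"

text \<open>If \<open>y\<close> lies in the closed cone of the cell of \<open>x\<close>, then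
  \<open>y + e *\<^sub>R x\<close> lies in the open one for every \<open>e > 0\<close>; let
  \<open>e\<close> tend to 0. This makes it possible to test a cap at the vertices of a
  cell.\<close>

lemma coverableE:
  assumes "coverable A h" "\<And>a. a \<in> A \<Longrightarrow> a \<bullet> x \<noteq> 0"
  obtains c where "norm c = 1"
    "\<And>y. (\<And>a. a \<in> A \<Longrightarrow> 0 \<le> (a \<bullet> x) * (a \<bullet> y)) \<Longrightarrow> h * norm y \<le> c \<bullet> y"
proof -
  obtain c where c: "norm c = 1"
    and strict: "\<And>y. (\<forall>a\<in>A. 0 < (a \<bullet> x) * (a \<bullet> y)) \<Longrightarrow> h * norm y \<le> c \<bullet> y"
    using assms unfolding coverable_def by blast
  have "h * norm y \<le> c \<bullet> y" if y: "\<And>a. a \<in> A \<Longrightarrow> 0 \<le> (a \<bullet> x) * (a \<bullet> y)" for y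
  proof -
    have "h * norm (y + e *\<^sub>R x) \<le> c \<bullet> (y + e *\<^sub>R x)" if "e > 0" for e
    proof (rule strict, rule ballI)
      fix a assume a: "a \<in> A"
      have "0 < e * ((a \<bullet> x) * (a \<bullet> x))"
        using assms(2)[OF a] \<open>e > 0\<close> by (auto simp: zero_less_mult_iff)
      then show "0 < (a \<bullet> x) * (a \<bullet> (y + e *\<^sub>R x))"
        using y[OF a] by (simp add: inner_add_right algebra_simps)
    qed
    then have ev: "eventually (\<lambda>e. h * norm (y + e *\<^sub>R x) \<le> c \<bullet> (y + e *\<^sub>R x)) (at_right 0)"
      by (rule eventually_mono[OF eventually_at_right_less])
    have "((\<lambda>e. h * norm (y + e *\<^sub>R x)) \<longlongrightarrow> h * norm (y + 0 *\<^sub>R x)) (at_right 0)"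
         "((\<lambda>e. c \<bullet> (y + e *\<^sub>R x)) \<longlongrightarrow> c \<bullet> (y + 0 *\<^sub>R x)) (at_right 0)"
      by (intro tendsto_intros)+
    from tendsto_le[OF _ this(2,1) ev] show ?thesis by simp
  qed
  with c that show ?thesis by blast
qed

text \<open>Signs with respect to \<open>B\<close> determine those with respect to \<open>A\<close>
  up to fixed factors, so every cell of \<open>B\<close> lies in a cell of \<open>A\<close>. Since
  \<open>B\<close> may have further elements, this covers rescaling, change of sign and the addition
  of circles.\<close>

lemma coverable_rescale:
  assumes "coverable A h" "\<And>a. a \<in> A \<Longrightarrow> \<exists>r. r \<noteq> 0 \<and> r *\<^sub>R a \<in> B"
  shows "coverable B h"
  unfolding coverable_def
proof (intro allI impI)
  fix x assume x: "\<forall>b\<in>B. b \<bullet> x \<noteq> 0"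
  have "\<forall>a\<in>A. a \<bullet> x \<noteq> 0" 
    using x assms(2) by fastforce
  then obtain c where c: "norm c = 1"
    and strict: "\<And>y. (\<forall>a\<in>A. 0 < (a \<bullet> x) * (a \<bullet> y)) \<Longrightarrow> h * norm y \<le> c \<bullet> y"
    using assms(1) unfolding coverable_def by blast
  have "h * norm y \<le> c \<bullet> y" if y: "\<forall>b\<in>B. 0 < (b \<bullet> x) * (b \<bullet> y)" for y
  proof (rule strict, rule ballI)
    fix a assume "a \<in> A"
    then obtain r where r: "r \<noteq> 0" "r *\<^sub>R a \<in> B" using assms(2) by blast
    have "0 < (r * r) * ((a \<bullet> x) * (a \<bullet> y))"
      using bspec[OF y r(2)] by (simp add: mult.assoc mult.left_commute)
    then show "0 < (a \<bullet> x) * (a \<bullet> y)"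
      by (metis not_square_less_zero zero_less_mult_iff)
  qed
  with c show "\<exists>c. norm c = 1 \<and> (\<forall>y. (\<forall>b\<in>B. 0 < (b \<bullet> x) * (b \<bullet> y)) \<longrightarrow> h * norm y \<le> c \<bullet> y)"
    by blast
qed

lemma coverable_antimono:
  assumes "coverable A h" "h' \<le> h"
  shows "coverable A h'"
proof -
  have "h' * norm y \<le> h * norm y" for y :: "real^3"
    using assms(2) by (simp add: mult_right_mono)
  then show ?thesis
    using assms(1) unfolding coverable_def by (meson order_trans)
qed

text \<open>A cap of radius \<open>pi / 2\<close> is a hemisphere, and one circle already confines
  each cell to one of its two hemispheres.\<close>

lemma coverable_0:
  assumes "a \<in> A"
  shows "coverable A 0"
  unfolding coverable_def
proof (intro allI impI)
  fix x assume x: "\<forall>a\<in>A. a \<bullet> x \<noteq> 0"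
  define c where "c = (sgn (a \<bullet> x) / norm a) *\<^sub>R a"
  have "a \<bullet> x \<noteq> 0" "a \<noteq> 0" using x assms by auto
  then have "norm c = 1" by (simp add: c_def abs_sgn_eq)
  moreover have "0 * norm y \<le> c \<bullet> y" if "\<forall>a\<in>A. 0 < (a \<bullet> x) * (a \<bullet> y)" for y
  proof -
    have "0 < (a \<bullet> x) * (a \<bullet> y)" using that assms by blast
    then show ?thesis
      by (auto simp: c_def zero_less_mult_iff sgn_if intro: divide_nonpos_nonneg)
  qed
  ultimately show "\<exists>c. norm c = 1 \<and> (\<forall>y. (\<forall>a\<in>A. 0 < (a \<bullet> x) * (a \<bullet> y)) \<longrightarrow> 0 * norm y \<le> c \<bullet> y)"
    by blast
qed

section \<open>Great circles described by normals, and their cells\<close>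

definition perp_circle :: "real^3 \<Rightarrow> (real^3) set" where
  "perp_circle a = {x \<in> S2. a \<bullet> x = 0}"

lemma great_circle_iff: "great_circle C \<longleftrightarrow> (\<exists>a. norm a = 1 \<and> C = perp_circle a)"
proof
  assume "great_circle C"
  then obtain P where P: "subspace P" "dim P = 2" "C = S2 \<inter> P"
    by (auto simp: great_circle_def)
  obtain a where a: "a \<noteq> 0" "span P = {x. a \<bullet> x = 0}"
    using lowdim_eq_hyperplane[of P] P(2) by auto
  have "P = {x. a \<bullet> x = 0}" using a(2) P(1) by (simp add: span_eq_iff[THEN iffD2])
  then have "C = perp_circle (a /\<^sub>R norm a)"
    using P(3) a(1) by (auto simp: perp_circle_def)
  then show "\<exists>a. norm a = 1 \<and> C = perp_circle a"
    using a(1) by (intro exI[of _ "a /\<^sub>R norm a"]) simp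
next
  assume "\<exists>a. norm a = 1 \<and> C = perp_circle a"
  then obtain a where a: "norm a = 1" "C = perp_circle a" by blast
  then have "a \<noteq> 0" by auto
  then have "dim {x. a \<bullet> x = 0} = 2" by (simp add: dim_hyperplane)
  then show "great_circle C" unfolding great_circle_def
    using a by (intro exI[of _ "{x. a \<bullet> x = 0}"]) (auto simp: perp_circle_def subspace_hyperplane)
qed

lemma span_perp_circle: "span (perp_circle a) = {x. a \<bullet> x = 0}"
proof
  show "span (perp_circle a) \<subseteq> {x. a \<bullet> x = 0}"
    by (rule span_minimal) (auto simp: perp_circle_def subspace_hyperplane)
  show "{x. a \<bullet> x = 0} \<subseteq> span (perp_circle a)"
  proof
    fix x assume x: "x \<in> {x. a \<bullet> x = 0}"
    show "x \<in> span (perp_circle a)"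
    proof (cases "x = 0")
      case False
      then have "x /\<^sub>R norm x \<in> perp_circle a" using x by (auto simp: perp_circle_def)
      then have "norm x *\<^sub>R (x /\<^sub>R norm x) \<in> span (perp_circle a)"
        by (intro span_scale span_base)
      then show ?thesis using False by simp
    qed (simp add: span_zero)
  qed
qed

lemma unit_normals_perp_circle:
  assumes "norm a = 1"
  shows "unit_normals (perp_circle a) = {a, - a}"
proof -
  have aa: "a \<bullet> a = 1" using assms by (simp add: dot_square_norm)
  have "u = a \<or> u = - a" if u: "norm u = 1" "\<forall>x. a \<bullet> x = 0 \<longrightarrow> u \<bullet> x = 0" for u
  proof -
    define w where "w = u - (a \<bullet> u) *\<^sub>R a"
    have "a \<bullet> w = 0" using aa by (simp add: w_def inner_diff_right)
    moreover from this have "u \<bullet> w = 0" using u(2) by blast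
    moreover have "w \<bullet> w = u \<bullet> w - (a \<bullet> u) * (a \<bullet> w)"
      by (subst (1) w_def) (simp only: inner_diff_left inner_scaleR_left)
    ultimately have "w = 0" by simp
    then have eq: "u = (a \<bullet> u) *\<^sub>R a" by (simp add: w_def)
    then have "\<bar>a \<bullet> u\<bar> = 1" using u(1) assms by (metis mult.right_neutral norm_scaleR)
    then have "a \<bullet> u = 1 \<or> a \<bullet> u = -1" by linarith
    then show ?thesis using eq by (metis scaleR_minus1_left scaleR_one)
  qed
  then show ?thesis using assms
    by (auto simp: unit_normals_def span_perp_circle orthogonal_def)
qed

lemma perp_circle_eq_iff:
  assumes "norm a = 1" "norm b = 1"
  shows "perp_circle a = perp_circle b \<longleftrightarrow> a = b \<or> a = - b"
proof
  assume "perp_circle a = perp_circle b"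
  then have "{a, - a} = {b, - b}" using unit_normals_perp_circle assms by metis
  then show "a = b \<or> a = - b" by blast
qed (auto simp: perp_circle_def)

text \<open>The cone over the sign cell is convex, hence connected, and radial projection maps it
  onto the sign cell. Conversely, by the intermediate value theorem a connected set that avoids the
  circles cannot change the sign of any \<open>a \<bullet> y\<close>.\<close>

lemma component_sign_cell:
  assumes "finite A" "A \<noteq> {}" "norm x = 1" "\<And>a. a \<in> A \<Longrightarrow> a \<bullet> x \<noteq> 0"
  shows "connected_component_set (S2 - \<Union>(perp_circle ` A)) x
    = {y \<in> S2. \<forall>a\<in>A. 0 < (a \<bullet> x) * (a \<bullet> y)}" (is "connected_component_set ?G x = ?Q")
proof
  let ?K = "{y. \<forall>a\<in>A. 0 < (a \<bullet> x) * (a \<bullet> y)}"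
  have "convex (\<Inter>a\<in>A. {y. 0 < ((a \<bullet> x) *\<^sub>R a) \<bullet> y})"
    by (rule convex_INT) (rule convex_halfspace_gt)
  moreover have "(\<Inter>a\<in>A. {y. 0 < ((a \<bullet> x) *\<^sub>R a) \<bullet> y}) = ?K" by auto
  ultimately have "convex ?K" by (simp only:)
  have "0 \<notin> ?K" using assms(2) by auto
  then have "continuous_on ?K (\<lambda>y. y /\<^sub>R norm y)"
    by (intro continuous_intros) auto
  then have "connected ((\<lambda>y. y /\<^sub>R norm y) ` ?K)"
    using \<open>convex ?K\<close> convex_connected connected_continuous_image by blast
  moreover have "(\<lambda>y. y /\<^sub>R norm y) ` ?K = ?Q"
  proof
    show "(\<lambda>y. y /\<^sub>R norm y) ` ?K \<subseteq> ?Q"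
    proof
      fix z assume "z \<in> (\<lambda>y. y /\<^sub>R norm y) ` ?K"
      then obtain y where y: "y \<in> ?K" "z = y /\<^sub>R norm y" by blast
      then have "y \<noteq> 0" using \<open>0 \<notin> ?K\<close> by blast
      then have "norm z = 1" "0 < inverse (norm y)" using y(2) by simp_all
      moreover have "(a \<bullet> x) * (a \<bullet> z) = inverse (norm y) * ((a \<bullet> x) * (a \<bullet> y))" for a
        using y(2) by simp
      ultimately show "z \<in> ?Q" using y(1) mult_pos_pos[of "inverse (norm y)"]
        by (simp only: mem_Collect_eq mem_sphere_0) blast
    qed
    show "?Q \<subseteq> (\<lambda>y. y /\<^sub>R norm y) ` ?K"
    proof
      fix y assume "y \<in> ?Q"
      then have "y \<in> ?K" "norm y = 1" by auto
      moreover from \<open>norm y = 1\<close> have "y = y /\<^sub>R norm y" by (simp only: inverse_1 scaleR_one)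
      ultimately show "y \<in> (\<lambda>y. y /\<^sub>R norm y) ` ?K" by (rule_tac rev_image_eqI)
    qed
  qed
  ultimately have "connected ?Q" by simp
  moreover have "x \<in> ?Q" using assms by (auto simp: zero_less_mult_iff linorder_neq_iff)
  moreover have "?Q \<subseteq> ?G" by (auto simp: perp_circle_def)
  ultimately show "?Q \<subseteq> connected_component_set ?G x"
    by (rule_tac connected_component_maximal)
  show "connected_component_set ?G x \<subseteq> ?Q"
  proof
    fix y assume y: "y \<in> connected_component_set ?G x"
    have C: "connected (connected_component_set ?G x)" "connected_component_set ?G x \<subseteq> ?G"
      by (simp_all add: connected_component_subset)
    have "x \<in> ?G" using \<open>x \<in> ?Q\<close> \<open>?Q \<subseteq> ?G\<close> by blast
    then have xx: "x \<in> connected_component_set ?G x" by simp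
    have "0 < (a \<bullet> x) * (a \<bullet> y)" if a: "a \<in> A" for a
    proof (rule ccontr)
      assume "\<not> 0 < (a \<bullet> x) * (a \<bullet> y)"
      then have "(a \<bullet> x \<le> 0 \<and> 0 \<le> a \<bullet> y) \<or> (a \<bullet> y \<le> 0 \<and> 0 \<le> a \<bullet> x)"
        by (auto simp: zero_less_mult_iff not_less)
      then obtain z where "z \<in> connected_component_set ?G x" "a \<bullet> z = 0"
        using connected_ivt_hyperplane[OF C(1) xx y] connected_ivt_hyperplane[OF C(1) y xx] by blast
      then show False using C(2) a by (auto simp: perp_circle_def)
    qed
    then show "y \<in> ?Q" using y C(2) by auto
  qed
qed

text \<open>Caps are closed, so taking closures of the components makes no difference. Dividing by
  the norm passes between cones and subsets of the sphere.\<close>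

lemma cells_covered_iff_coverable:
  assumes "finite A" "A \<noteq> {}"
  shows "cells_covered (perp_circle ` A) R \<longleftrightarrow> R \<in> {0<..pi/2} \<and> coverable A (cos R)"
proof -
  let ?G = "S2 - \<Union>(perp_circle ` A)"
  let ?Q = "\<lambda>x. {y \<in> S2. \<forall>a\<in>A. 0 < (a \<bullet> x) * (a \<bullet> y)}"
  have G: "x \<in> ?G \<longleftrightarrow> norm x = 1 \<and> (\<forall>a\<in>A. a \<bullet> x \<noteq> 0)" for x
    by (auto simp: perp_circle_def)
  have comp: "components ?G = ?Q ` ?G"
    unfolding components_def
  proof (rule image_cong[OF refl])
    fix x assume "x \<in> ?G"
    then show "connected_component_set ?G x = ?Q x"
      by (intro component_sign_cell[OF assms]) (simp_all only: G, blast)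
  qed
  have "closed (spherical_cap c R)" for c
  proof -
    have "spherical_cap c R = S2 \<inter> {y. c \<bullet> y \<ge> cos R}"
      by (auto simp: spherical_cap_def inner_commute)
    then show ?thesis by (simp add: closed_Int closed_halfspace_ge)
  qed
  then have clos: "closure S \<subseteq> spherical_cap c R \<longleftrightarrow> S \<subseteq> spherical_cap c R" for S c
    by (meson closure_minimal closure_subset order_trans)
  have *: "(\<forall>B\<in>cells (perp_circle ` A). \<exists>c\<in>S2. B \<subseteq> spherical_cap c R) \<longleftrightarrow>
    (\<forall>x\<in>?G. \<exists>c\<in>S2. ?Q x \<subseteq> spherical_cap c R)"
    unfolding cells_def comp by (simp add: clos)
  also have "\<dots> \<longleftrightarrow> coverable A (cos R)"
  proof
    assume L: "\<forall>x\<in>?G. \<exists>c\<in>S2. ?Q x \<subseteq> spherical_cap c R"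
    show "coverable A (cos R)" unfolding coverable_def
    proof (intro allI impI)
      fix x assume x: "\<forall>a\<in>A. a \<bullet> x \<noteq> 0"
      then have "x \<noteq> 0" using assms(2) by auto
      have "x /\<^sub>R norm x \<in> ?G" using x \<open>x \<noteq> 0\<close> by (subst G) simp
      then obtain c where c: "c \<in> S2" "?Q (x /\<^sub>R norm x) \<subseteq> spherical_cap c R" using L by blast
      have "cos R * norm y \<le> c \<bullet> y" if y: "\<forall>a\<in>A. 0 < (a \<bullet> x) * (a \<bullet> y)" for y
      proof -
        have "y \<noteq> 0" using y assms(2) by auto
        then have "y /\<^sub>R norm y \<in> ?Q (x /\<^sub>R norm x)"
          using y \<open>x \<noteq> 0\<close> \<open>y \<noteq> 0\<close> by (auto simp: zero_less_mult_iff mult_less_0_iff)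
        then have "y /\<^sub>R norm y \<in> spherical_cap c R" by (rule subsetD[OF c(2)])
        then have "cos R \<le> (y /\<^sub>R norm y) \<bullet> c" by (simp only: spherical_cap_def mem_Collect_eq)
        then show ?thesis using \<open>y \<noteq> 0\<close> by (simp add: field_simps inner_commute)
      qed
      then show "\<exists>c. norm c = 1 \<and> (\<forall>y. (\<forall>a\<in>A. 0 < (a \<bullet> x) * (a \<bullet> y)) \<longrightarrow> cos R * norm y \<le> c \<bullet> y)"
        using c(1) by auto
    qed
  next
    assume "coverable A (cos R)"
    then show "\<forall>x\<in>?G. \<exists>c\<in>S2. ?Q x \<subseteq> spherical_cap c R"
      unfolding coverable_def spherical_cap_def
    proof (intro ballI)
      fix x assume *: "\<forall>x. (\<forall>a\<in>A. a \<bullet> x \<noteq> 0) \<longrightarrow> (\<exists>c. norm c = 1 \<and>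
        (\<forall>y. (\<forall>a\<in>A. 0 < (a \<bullet> x) * (a \<bullet> y)) \<longrightarrow> cos R * norm y \<le> c \<bullet> y))" and "x \<in> ?G"
      then have "\<forall>a\<in>A. a \<bullet> x \<noteq> 0" using G by blast
      then obtain c where c: "norm c = 1"
        "\<And>y. (\<forall>a\<in>A. 0 < (a \<bullet> x) * (a \<bullet> y)) \<Longrightarrow> cos R * norm y \<le> c \<bullet> y"
        using * by blast
      have "?Q x \<subseteq> {y \<in> S2. cos R \<le> y \<bullet> c}"
        using c(2) by (force simp: inner_commute)
      then show "\<exists>c\<in>S2. ?Q x \<subseteq> {y \<in> S2. cos R \<le> y \<bullet> c}" using c(1) by auto
    qed
  qed
  finally show ?thesis unfolding cells_covered_def by simp
qed

section \<open>Three great circles\<close>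

lemma common_perp:
  fixes a b :: "real^3"
  obtains q where "norm q = 1" "a \<bullet> q = 0" "b \<bullet> q = 0"
proof -
  have "card {a, b} \<le> 2" by (cases "a = b") auto
  then have "dim {a, b} < 3" using dim_le_card[of "{a, b}" "{a, b}"] by (simp add: span_base subset_iff)
  then obtain q where q: "q \<noteq> 0" "\<And>y. y \<in> span {a, b} \<Longrightarrow> orthogonal q y"
    using orthogonal_to_subspace_exists[of "{a, b}"] by auto
  show ?thesis
  proof (rule that[of "q /\<^sub>R norm q"])
    have "orthogonal q a" "orthogonal q b" by (auto intro: q(2) span_base)
    then show "a \<bullet> (q /\<^sub>R norm q) = 0" "b \<bullet> (q /\<^sub>R norm q) = 0"
      by (simp_all add: orthogonal_def inner_commute)
  qed (use q(1) in simp)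
qed

text \<open>Up to positive factors this is the dual basis of three independent normals:
  \<open>v\<close> is the vertex where the circles of \<open>b\<close> and \<open>c\<close> meet, on
  the positive side of \<open>a\<close>.\<close>

lemma dual_vector:
  fixes a b c :: "real^3"
  assumes "\<not> (\<exists>q. norm q = 1 \<and> a \<bullet> q = 0 \<and> b \<bullet> q = 0 \<and> c \<bullet> q = 0)"
  obtains v where "norm v = 1" "0 < a \<bullet> v" "b \<bullet> v = 0" "c \<bullet> v = 0"
proof -
  obtain q where q: "norm q = 1" "b \<bullet> q = 0" "c \<bullet> q = 0" using common_perp by blast
  then have "a \<bullet> q \<noteq> 0" using assms by blast
  then show ?thesis using that[of q] that[of "-q"] q by (cases "a \<bullet> q > 0") auto
qed

lemma orthonormal_expand:
  fixes a b c x :: "real^3"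
  assumes "norm a = 1" "norm b = 1" "norm c = 1" "a \<bullet> b = 0" "a \<bullet> c = 0" "b \<bullet> c = 0"
  shows "x = (x \<bullet> a) *\<^sub>R a + (x \<bullet> b) *\<^sub>R b + (x \<bullet> c) *\<^sub>R c"
proof -
  have ne: "a \<noteq> b" "a \<noteq> c" "b \<noteq> c" using assms by auto
  have orth: "pairwise orthogonal {a, b, c}"
    using assms by (auto simp: pairwise_def orthogonal_def inner_commute)
  have "0 \<notin> {a, b, c}" using assms by auto
  then have "independent {a, b, c}" using orth pairwise_orthogonal_independent by blast
  then have "dim {a, b, c} = 3" using ne by (simp add: dim_eq_card_independent)
  then have "x \<in> span {a, b, c}" using dim_eq_full[of "{a, b, c}"] by simp
  then have "(\<Sum>e\<in>{a, b, c}. (x \<bullet> e) *\<^sub>R e) = x"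
    using orth assms by (intro orthonormal_basis_expand) auto
  then show ?thesis using ne by (simp add: add.assoc)
qed

lemma orthonormal_inner:
  fixes a b c x y :: "real^3"
  assumes "norm a = 1" "norm b = 1" "norm c = 1" "a \<bullet> b = 0" "a \<bullet> c = 0" "b \<bullet> c = 0"
  shows "x \<bullet> y = (x \<bullet> a) * (y \<bullet> a) + (x \<bullet> b) * (y \<bullet> b) + (x \<bullet> c) * (y \<bullet> c)"
  by (subst orthonormal_expand[OF assms, of x]) (simp add: inner_add_left inner_add_right inner_commute)

text \<open>The induction moves \<open>x\<close> a little along a direction \<open>v\<close> that
  leaves the new hyperplane, keeping the earlier products nonzero. The subspace \<open>V\<close>
  allows the point to be chosen within one of the planes.\<close>

lemma generic_vector:
  fixes A :: "'a::euclidean_space set"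
  assumes "finite A" "subspace V" "\<And>a. a \<in> A \<Longrightarrow> \<exists>v\<in>V. a \<bullet> v \<noteq> 0"
  obtains x where "x \<in> V" "\<forall>a\<in>A. a \<bullet> x \<noteq> 0"
proof -
  have "\<exists>x\<in>V. \<forall>a\<in>A. a \<bullet> x \<noteq> 0"
    using assms(1,3)
  proof (induction A)
    case empty
    then show ?case using subspace_0[OF assms(2)] by blast
  next
    case (insert b A)
    then obtain x v where xv: "x \<in> V" "\<forall>a\<in>A. a \<bullet> x \<noteq> 0" "v \<in> V" "b \<bullet> v \<noteq> 0" by blast
    have "eventually (\<lambda>e. \<forall>a\<in>A. a \<bullet> (x + e *\<^sub>R v) \<noteq> 0) (at_right 0)"
    proof (rule eventually_ball_finite[OF insert.hyps(1)], rule ballI)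
      fix a assume "a \<in> A"
      have "((\<lambda>e. a \<bullet> (x + e *\<^sub>R v)) \<longlongrightarrow> a \<bullet> (x + 0 *\<^sub>R v)) (at_right 0)"
        by (intro tendsto_intros)
      moreover have "a \<bullet> (x + 0 *\<^sub>R v) \<noteq> 0" using xv(2) \<open>a \<in> A\<close> by simp
      ultimately show "eventually (\<lambda>e. a \<bullet> (x + e *\<^sub>R v) \<noteq> 0) (at_right 0)"
        by (rule tendsto_imp_eventually_ne)
    qed
    then obtain d where d: "0 < d" "\<And>e. 0 < e \<Longrightarrow> e < d \<Longrightarrow> \<forall>a\<in>A. a \<bullet> (x + e *\<^sub>R v) \<noteq> 0"
      unfolding eventually_at_right_field by blast
    \<comment> \<open>A nonconstant affine function of the step length has at most one zero, so one
      of two admissible steps avoids the new hyperplane.\<close>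
    have "b \<bullet> (x + (d/2) *\<^sub>R v) \<noteq> 0 \<or> b \<bullet> (x + (d/3) *\<^sub>R v) \<noteq> 0"
    proof (rule ccontr)
      assume "\<not> ?thesis"
      then have "b \<bullet> x + d * (b \<bullet> v) / 2 = 0" "b \<bullet> x + d * (b \<bullet> v) / 3 = 0"
        by (simp_all add: inner_add_right)
      then have "d * (b \<bullet> v) = 0" by linarith
      then show False using xv(4) d(1) by simp
    qed
    moreover have "0 < d/2" "d/2 < d" "0 < d/3" "d/3 < d" using d(1) by simp_all
    ultimately obtain e where e: "0 < e" "e < d" "b \<bullet> (x + e *\<^sub>R v) \<noteq> 0" by blast
    then have "x + e *\<^sub>R v \<in> V" "\<forall>a\<in>insert b A. a \<bullet> (x + e *\<^sub>R v) \<noteq> 0"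
      using d(2) xv assms(2) by (auto simp: subspace_add subspace_scale)
    then show ?case by blast
  qed
  then show ?thesis using that by blast
qed

text \<open>If all planes contain the line of \<open>q\<close>, then \<open>q\<close> and
  \<open>- q\<close> both lie in every closed cell, and their two cap inequalities add up to
  \<open>2 * h \<le> 0\<close>.\<close>

lemma coverable_degenerate:
  assumes "coverable A h" "finite A" "0 \<notin> A" "norm q = 1" "\<And>a. a \<in> A \<Longrightarrow> a \<bullet> q = 0"
  shows "h \<le> 0"
proof -
  obtain x where "\<forall>a\<in>A. a \<bullet> x \<noteq> 0"
    using generic_vector[OF assms(2) subspace_UNIV, of] assms(3) by (metis UNIV_I inner_eq_zero_iff)
  then obtain c where "\<And>y. (\<And>a. a \<in> A \<Longrightarrow> 0 \<le> (a \<bullet> x) * (a \<bullet> y)) \<Longrightarrow> h * norm y \<le> c \<bullet> y"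
    using coverableE[OF assms(1)] by metis
  from this[of q] this[of "- q"] show ?thesis using assms(4,5) by simp
qed

lemma coverable_3:
  fixes a b c :: "real^3"
  assumes cov: "coverable {a, b, c} h" and nz: "a \<noteq> 0" "b \<noteq> 0" "c \<noteq> 0"
  shows "h \<le> 1 / sqrt 3" 
    and "h = 1 / sqrt 3 \<Longrightarrow> a \<bullet> b = 0 \<and> a \<bullet> c = 0 \<and> b \<bullet> c = 0"
proof -
  have "h \<le> 1 / sqrt 3 \<and> (h = 1 / sqrt 3 \<longrightarrow> a \<bullet> b = 0 \<and> a \<bullet> c = 0 \<and> b \<bullet> c = 0)"
  proof (cases "h \<le> 0")
    case True
    have "(0::real) < 1 / sqrt 3" by simp
    with True show ?thesis by linarith
  next
    case False
    then have nq: "\<not> (\<exists>q. norm q = 1 \<and> a \<bullet> q = 0 \<and> b \<bullet> q = 0 \<and> c \<bullet> q = 0)"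
      using coverable_degenerate[OF cov] nz by fastforce
    obtain u where u: "norm u = 1" "0 < a \<bullet> u" "b \<bullet> u = 0" "c \<bullet> u = 0"
      using nq dual_vector by blast
    obtain v where v: "norm v = 1" "0 < b \<bullet> v" "a \<bullet> v = 0" "c \<bullet> v = 0"
      using nq dual_vector[of b a c] by blast
    obtain w where w: "norm w = 1" "0 < c \<bullet> w" "a \<bullet> w = 0" "b \<bullet> w = 0"
      using nq dual_vector[of c a b] by blast
    have unit: "u \<bullet> u = 1" "v \<bullet> v = 1" "w \<bullet> w = 1"
      using u(1) v(1) w(1) by (simp_all add: dot_square_norm)
    have key: "(3 * h)\<^sup>2 \<le> 3 + 2 * (i * j * (u \<bullet> v) + i * k * (u \<bullet> w) + j * k * (v \<bullet> w))"
      if s: "i \<in> {1, -1}" "j \<in> {1, -1}" "k \<in> {1, -1}" for i j k :: real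
    proof -
      let ?x = "i *\<^sub>R u + j *\<^sub>R v + k *\<^sub>R w"
      have sq: "i * i = 1" "j * j = 1" "k * k = 1" using s by auto
      have ax: "a \<bullet> ?x = i * (a \<bullet> u)" "b \<bullet> ?x = j * (b \<bullet> v)" "c \<bullet> ?x = k * (c \<bullet> w)"
        using u v w by (simp_all add: inner_add_right)
      obtain d where d: "norm d = 1"
        "\<And>y. (\<And>e. e \<in> {a, b, c} \<Longrightarrow> 0 \<le> (e \<bullet> ?x) * (e \<bullet> y)) \<Longrightarrow> h * norm y \<le> d \<bullet> y"
      proof (rule coverableE[OF cov, of ?x])
        show "e \<bullet> ?x \<noteq> 0" if "e \<in> {a, b, c}" for e
          using that ax u v w s by auto
      qed blast
      have nn: "0 \<le> i * p * (i * p)" "0 \<le> j * p * (j * p)" "0 \<le> k * p * (k * p)" for p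
        by simp_all
      have "h * norm (i *\<^sub>R u) \<le> d \<bullet> (i *\<^sub>R u)" "h * norm (j *\<^sub>R v) \<le> d \<bullet> (j *\<^sub>R v)"
           "h * norm (k *\<^sub>R w) \<le> d \<bullet> (k *\<^sub>R w)"
        by (rule d(2); use ax nn u v w in auto)+
      moreover have "\<bar>i\<bar> = 1" "\<bar>j\<bar> = 1" "\<bar>k\<bar> = 1" using s by auto
      ultimately have "3 * h \<le> d \<bullet> ?x"
        using u(1) v(1) w(1) by (simp add: inner_add_right)
      also have "\<dots> \<le> norm ?x" using norm_cauchy_schwarz[of d ?x] d(1) by simp
      finally have "(3 * h)\<^sup>2 \<le> (norm ?x)\<^sup>2" using False by (intro power_mono) auto
      also have "(norm ?x)\<^sup>2 = i * i * (u \<bullet> u) + j * j * (v \<bullet> v) + k * k * (w \<bullet> w) +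
          2 * (i * j * (u \<bullet> v) + i * k * (u \<bullet> w) + j * k * (v \<bullet> w))"
        unfolding power2_norm_eq_inner by (simp add: inner_add_left inner_add_right inner_commute algebra_simps)
      finally show ?thesis using sq unit by simp
    qed
    \<comment> \<open>Opposite sign triples give the same inequality, so four remain; the mixed
      terms cancel in their sum.\<close>
    note k4 = key[of 1 1 1, simplified] key[of 1 1 "-1", simplified] key[of 1 "-1" 1, simplified]
      key[of "-1" 1 1, simplified]
    have "h\<^sup>2 \<le> (1 / sqrt 3)\<^sup>2" using k4 by (simp add: power_mult_distrib power_divide)
    then have 1: "h \<le> 1 / sqrt 3" by (rule power2_le_imp_le) simp
    have 2: "a \<bullet> b = 0 \<and> a \<bullet> c = 0 \<and> b \<bullet> c = 0" if "h = 1 / sqrt 3"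
    proof -
      have "(3 * h)\<^sup>2 = 3" using that by (simp add: power_mult_distrib power_divide)
      \<comment> \<open>For the extremal \<open>h\<close> the four signed sums of inner products are
        nonnegative with total zero, hence all zero. The vertices then form an orthonormal frame in
        which each normal has a single nonzero coordinate.\<close>
      then have "u \<bullet> v = 0" "u \<bullet> w = 0" "v \<bullet> w = 0" using k4[simplified] by (simp_all add: power_mult_distrib)
      note I = orthonormal_inner[OF u(1) v(1) w(1) this]
      show ?thesis using I[of a b] I[of a c] I[of b c] u v w by simp
    qed
    from 1 2 show ?thesis by blast
  qed
  then show "h \<le> 1 / sqrt 3" 
    and "h = 1 / sqrt 3 \<Longrightarrow> a \<bullet> b = 0 \<and> a \<bullet> c = 0 \<and> b \<bullet> c = 0" by blast+
qed

text \<open>The cells are octants, with \<open>d\<close> the center of the octant of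
  \<open>x\<close>. The cap inequality becomes the bound of the Euclidean norm by the sum of the
  absolute values of the coordinates.\<close>

lemma coverable_orthonormal:
  fixes a b c :: "real^3"
  assumes on: "norm a = 1" "norm b = 1" "norm c = 1" "a \<bullet> b = 0" "a \<bullet> c = 0" "b \<bullet> c = 0"
  shows "coverable {a, b, c} (1 / sqrt 3)"
  unfolding coverable_def
proof (intro allI impI)
  fix x assume x: "\<forall>e\<in>{a, b, c}. e \<bullet> x \<noteq> 0"
  define d where "d = (1 / sqrt 3) *\<^sub>R (sgn (a \<bullet> x) *\<^sub>R a + sgn (b \<bullet> x) *\<^sub>R b + sgn (c \<bullet> x) *\<^sub>R c)"
  have unit: "a \<bullet> a = 1" "b \<bullet> b = 1" "c \<bullet> c = 1" using on by (simp_all add: dot_square_norm)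
  have "d \<bullet> a = sgn (a \<bullet> x) / sqrt 3" "d \<bullet> b = sgn (b \<bullet> x) / sqrt 3" "d \<bullet> c = sgn (c \<bullet> x) / sqrt 3"
    using on unit by (simp_all add: d_def inner_add_left inner_add_right inner_commute)
  moreover have "sgn (e \<bullet> x) * sgn (e \<bullet> x) = 1" if "e \<in> {a, b, c}" for e
    using x that by (auto simp: sgn_if)
  moreover have "(r / sqrt 3) * (r / sqrt 3) = r * r / 3" for r by simp
  ultimately have "d \<bullet> d = 1" by (subst orthonormal_inner[OF on]) simp
  then have "norm d = 1" by (simp add: norm_eq_1)
  moreover have "1 / sqrt 3 * norm y \<le> d \<bullet> y" if y: "\<forall>e\<in>{a, b, c}. 0 < (e \<bullet> x) * (e \<bullet> y)" for y
  proof -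
    have abs: "sgn (e \<bullet> x) * (e \<bullet> y) = \<bar>e \<bullet> y\<bar>" if "e \<in> {a, b, c}" for e
      using y that by (auto simp: sgn_if zero_less_mult_iff)
    have "d \<bullet> y = (1 / sqrt 3) * (\<bar>a \<bullet> y\<bar> + \<bar>b \<bullet> y\<bar> + \<bar>c \<bullet> y\<bar>)"
      by (simp add: d_def inner_add_left abs)
    moreover have "norm y \<le> \<bar>a \<bullet> y\<bar> + \<bar>b \<bullet> y\<bar> + \<bar>c \<bullet> y\<bar>"
    proof (rule power2_le_imp_le)
      have "(norm y)\<^sup>2 = \<bar>a \<bullet> y\<bar>\<^sup>2 + \<bar>b \<bullet> y\<bar>\<^sup>2 + \<bar>c \<bullet> y\<bar>\<^sup>2"
        unfolding power2_norm_eq_inner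
        by (subst orthonormal_inner[OF on]) (simp add: power2_eq_square inner_commute)
      also have "\<dots> \<le> (\<bar>a \<bullet> y\<bar> + \<bar>b \<bullet> y\<bar> + \<bar>c \<bullet> y\<bar>)\<^sup>2"
        by (simp add: power2_eq_square algebra_simps)
      finally show "(norm y)\<^sup>2 \<le> (\<bar>a \<bullet> y\<bar> + \<bar>b \<bullet> y\<bar> + \<bar>c \<bullet> y\<bar>)\<^sup>2" .
    qed simp
    ultimately show ?thesis by (simp add: divide_right_mono)
  qed
  ultimately show "\<exists>d. norm d = 1 \<and> (\<forall>y. (\<forall>e\<in>{a, b, c}. 0 < (e \<bullet> x) * (e \<bullet> y)) \<longrightarrow> 1 / sqrt 3 * norm y \<le> d \<bullet> y)"
    by blast
qed

section \<open>Four great circles\<close>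

text \<open>Expanding the squared norm of \<open>w = c - (p + q) / sqrt 2\<close> and using
  \<open>1 / sqrt 2 \<le> h\<close> shows that it is at most \<open>p \<bullet> q\<close>. So
  \<open>p \<bullet> q\<close> is nonnegative, and if it is zero then \<open>w = 0\<close>.\<close>

lemma cap_orthogonal_pair:
  fixes c p q :: "'a::real_inner"
  assumes unit: "norm c = 1" "norm p = 1" "norm q = 1"
    and h: "1 / sqrt 2 \<le> h" "h \<le> c \<bullet> p" "h \<le> c \<bullet> q"
  shows "0 \<le> p \<bullet> q" and "p \<bullet> q = 0 \<Longrightarrow> h = 1 / sqrt 2 \<and> c = (1 / sqrt 2) *\<^sub>R (p + q)"
proof -
  define r where "r = 1 / sqrt 2"
  define w where "w = c - r *\<^sub>R (p + q)"
  have u: "c \<bullet> c = 1" "p \<bullet> p = 1" "q \<bullet> q = 1" using unit by (simp_all add: dot_square_norm)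
  have r: "0 < r" "r * r = 1 / 2" "r \<le> h" using h(1) by (simp_all add: r_def)
  have "w \<bullet> w = c \<bullet> c + (r * r) * (p \<bullet> p + q \<bullet> q + 2 * (p \<bullet> q)) - 2 * (r * (c \<bullet> p + c \<bullet> q))"
    unfolding w_def by (simp add: inner_diff_left inner_diff_right inner_add_left inner_add_right inner_commute algebra_simps)
  then have ww: "w \<bullet> w = 2 + p \<bullet> q - 2 * (r * (c \<bullet> p + c \<bullet> q))" by (simp add: u r)
  have rh: "r * r \<le> r * h" using r by (simp add: mult_left_mono)
  have "r * (h + h) \<le> r * (c \<bullet> p + c \<bullet> q)"
    by (rule mult_left_mono) (use h r in auto)
  then have ww': "w \<bullet> w \<le> 2 + p \<bullet> q - 4 * (r * h)" using ww by (simp add: algebra_simps)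
  have "0 \<le> w \<bullet> w" by simp
  then show "0 \<le> p \<bullet> q" using ww' rh r(2) by linarith
  assume "p \<bullet> q = 0"
  then have "w \<bullet> w = 0" "r * h = r * r" using ww' \<open>0 \<le> w \<bullet> w\<close> rh r(2) by linarith+
  then show "h = 1 / sqrt 2 \<and> c = (1 / sqrt 2) *\<^sub>R (p + q)"
    using r(1) by (simp add: w_def flip: r_def)
qed

text \<open>Three circles pass through \<open>q\<close>. The fourth one cuts a lune between them
  into two cells with apexes \<open>q\<close> and \<open>- q\<close> and a common edge on the circle
  of \<open>d\<close>. Both caps together force every point \<open>v\<close> of that edge to be
  orthogonal to \<open>q\<close>, and then the cap at \<open>q\<close> is centered at the midpoint
  of \<open>q\<close> and \<open>v\<close>. Two different points \<open>v\<close> give a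
  contradiction.\<close>

lemma coverable_4_degenerate:
  fixes a b c d q :: "real^3"
  assumes cov: "coverable {a, b, c, d} h" and nz: "a \<noteq> 0" "b \<noteq> 0" "c \<noteq> 0" "d \<noteq> 0"
    and q: "norm q = 1" "a \<bullet> q = 0" "b \<bullet> q = 0" "c \<bullet> q = 0"
  shows "h < 1 / sqrt 2"
proof (rule ccontr)
  assume "\<not> h < 1 / sqrt 2"
  then have h: "1 / sqrt 2 \<le> h" by simp
  moreover have "0 < 1 / sqrt 2" by simp
  ultimately have "0 < h" by linarith
  then have dq: "d \<bullet> q \<noteq> 0"
    using coverable_degenerate[OF cov] nz q by fastforce
  let ?V = "{x. d \<bullet> x = 0}"
  \<comment> \<open>A normal \<open>e\<close> that vanishes on the plane of \<open>d\<close> would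
    be parallel to \<open>d\<close>, contrary to \<open>e \<bullet> q = 0\<close> and
    \<open>d \<bullet> q \<noteq> 0\<close>.\<close>
  have ex: "\<exists>v\<in>?V. e \<bullet> v \<noteq> 0" if e: "e \<in> {a, b, c}" for e
  proof (rule ccontr)
    assume "\<not> ?thesis"
    then have all: "e \<bullet> v = 0" if "d \<bullet> v = 0" for v using that by blast
    have "d \<bullet> ((d \<bullet> d) *\<^sub>R q - (d \<bullet> q) *\<^sub>R d) = 0" by (simp add: inner_diff_right)
    from all[OF this] have "e \<bullet> d = 0" using e q dq by (auto simp: inner_diff_right)
    then have "e \<bullet> e = 0" by (intro all) (simp add: inner_commute)
    then show False using e nz by auto
  qed
  obtain w where w: "d \<bullet> w = 0" "\<forall>e\<in>{a, b, c}. e \<bullet> w \<noteq> 0"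
    by (rule generic_vector[of "{a, b, c}", OF _ subspace_hyperplane[of d] ex]) simp_all
  have "w \<noteq> 0" using w(2) by auto
  define z where "z = cross3 d w"
  have z: "d \<bullet> z = 0" "w \<bullet> z = 0" by (simp_all add: z_def dot_cross_self)
  have "(norm z)\<^sup>2 = (norm d)\<^sup>2 * (norm w)\<^sup>2" using w(1) by (simp add: z_def norm_cross)
  then have "z \<noteq> 0" using nz(4) \<open>w \<noteq> 0\<close> by auto
  have "eventually (\<lambda>r. \<forall>e\<in>{a, b, c}. 0 < (e \<bullet> w) * (e \<bullet> (w + r *\<^sub>R z))) (at_right 0)"
  proof (rule eventually_ball_finite, simp, rule ballI)
    fix e assume "e \<in> {a, b, c}"
    have "((\<lambda>r. (e \<bullet> w) * (e \<bullet> (w + r *\<^sub>R z))) \<longlongrightarrow> (e \<bullet> w) * (e \<bullet> (w + 0 *\<^sub>R z))) (at_right 0)"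
      by (intro tendsto_intros)
    moreover have "0 < (e \<bullet> w) * (e \<bullet> (w + 0 *\<^sub>R z))" 
      using w(2) \<open>e \<in> {a, b, c}\<close> by (auto simp: zero_less_mult_iff linorder_neq_iff)
    ultimately show "eventually (\<lambda>r. 0 < (e \<bullet> w) * (e \<bullet> (w + r *\<^sub>R z))) (at_right 0)"
      by (rule order_tendstoD(1))
  qed
  then obtain r' where r': "0 < r'" "\<And>r. 0 < r \<Longrightarrow> r < r' \<Longrightarrow> \<forall>e\<in>{a, b, c}. 0 < (e \<bullet> w) * (e \<bullet> (w + r *\<^sub>R z))"
    unfolding eventually_at_right_field by blast
  \<comment> \<open>The point \<open>w + r *\<^sub>R z\<close> is a second point of the edge, close
    enough to \<open>w\<close> to have the same signs on \<open>a\<close>, \<open>b\<close>,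
    \<open>c\<close>.\<close>
  define r where "r = r' / 2"
  have r: "0 < r" "\<forall>e\<in>{a, b, c}. 0 < (e \<bullet> w) * (e \<bullet> (w + r *\<^sub>R z))"
    using r'(1) r'(2)[of r] by (simp_all add: r_def)
  have gen: "e \<bullet> (w + s *\<^sub>R q) \<noteq> 0" if "e \<in> {a, b, c, d}" "s \<noteq> 0" for e s
    using that w q dq by (auto simp: inner_add_right)
  have cell: "0 \<le> (e \<bullet> (w + s *\<^sub>R q)) * (e \<bullet> (t *\<^sub>R v))"
    if "e \<in> {a, b, c, d}" "0 < t" "v = s *\<^sub>R q \<or> v = w \<or> v = w + r *\<^sub>R z" for e s t v
  proof -
    have "0 \<le> (e \<bullet> (w + s *\<^sub>R q)) * (e \<bullet> v)"
      using that(1,3) w q r(2) z(1) by (auto simp: inner_add_right intro: less_imp_le)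
    then show ?thesis using that(2) by (simp add: mult.left_commute)
  qed
  obtain f where f: "norm f = 1" 
    "\<And>y. (\<And>e. e \<in> {a, b, c, d} \<Longrightarrow> 0 \<le> (e \<bullet> (w + 1 *\<^sub>R q)) * (e \<bullet> y)) \<Longrightarrow> h * norm y \<le> f \<bullet> y"
    using coverableE[OF cov, of "w + 1 *\<^sub>R q"] gen[of _ 1] by (metis zero_neq_one)
  obtain g where g: "norm g = 1" 
    "\<And>y. (\<And>e. e \<in> {a, b, c, d} \<Longrightarrow> 0 \<le> (e \<bullet> (w + (-1) *\<^sub>R q)) * (e \<bullet> y)) \<Longrightarrow> h * norm y \<le> g \<bullet> y"
    using coverableE[OF cov, of "w + (-1) *\<^sub>R q"] gen[of _ "-1"] by (metis zero_neq_neg_one)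
  have fq: "h \<le> f \<bullet> q" using f(2)[of q] cell[of _ 1 q 1] q(1) by simp
  have gq: "h \<le> g \<bullet> (- q)" using g(2)[of "- q"] cell[of _ 1 "- q" "-1"] q(1) by simp
  have center: "f = (1 / sqrt 2) *\<^sub>R (q + v /\<^sub>R norm v)" if v: "v = w \<or> v = w + r *\<^sub>R z" "v \<noteq> 0" for v
  proof -
    let ?v = "inverse (norm v) *\<^sub>R v"
    have u: "norm ?v = 1" "0 < inverse (norm v)" using v(2) by simp_all
    have "h \<le> f \<bullet> ?v" using f(2)[of ?v] cell[OF _ u(2), of _ v 1] v(1) u(1) by auto
    moreover have "h \<le> g \<bullet> ?v" using g(2)[of ?v] cell[OF _ u(2), of _ v "-1"] v(1) u(1) by auto
    ultimately have "0 \<le> q \<bullet> ?v" "0 \<le> (- q) \<bullet> ?v"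
      using cap_orthogonal_pair(1)[OF f(1) q(1) u(1) h fq] cap_orthogonal_pair(1)[OF g(1) _ u(1) h gq] q(1) by simp_all
    then have "q \<bullet> ?v = 0" by simp
    then show ?thesis using cap_orthogonal_pair(2)[OF f(1) q(1) u(1) h fq \<open>h \<le> f \<bullet> ?v\<close>] by simp
  qed
  have "w + r *\<^sub>R z \<noteq> 0" using r(2) by auto
  then have "(1 / sqrt 2) *\<^sub>R (q + w /\<^sub>R norm w) = (1 / sqrt 2) *\<^sub>R (q + (w + r *\<^sub>R z) /\<^sub>R norm (w + r *\<^sub>R z))"
    using center[of w] center[of "w + r *\<^sub>R z"] \<open>w \<noteq> 0\<close> by metis
  then have "w /\<^sub>R norm w = (w + r *\<^sub>R z) /\<^sub>R norm (w + r *\<^sub>R z)" by simp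
  then have "(w /\<^sub>R norm w) \<bullet> z = ((w + r *\<^sub>R z) /\<^sub>R norm (w + r *\<^sub>R z)) \<bullet> z" by simp
  then show False using z(2) r(1) \<open>z \<noteq> 0\<close> \<open>w + r *\<^sub>R z \<noteq> 0\<close> by (simp add: inner_add_left)
qed

lemma coverable_4_sum_zero:
  fixes a b c d :: "real^3"
  assumes cov: "coverable {a, b, c, d} h" and h: "1 / sqrt 2 \<le> h" and sum: "a + b + c + d = 0"
    and nd: "\<not> (\<exists>q. norm q = 1 \<and> a \<bullet> q = 0 \<and> b \<bullet> q = 0 \<and> c \<bullet> q = 0)"
  shows "h = 1 / sqrt 2 \<and> (\<exists>A B C r s t w. norm A = 1 \<and> norm B = 1 \<and> norm C = 1 \<and>
     A \<bullet> B = 0 \<and> A \<bullet> C = 0 \<and> B \<bullet> C = 0 \<and>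
     a = r *\<^sub>R (A + B + C) \<and> b = s *\<^sub>R (A - B - C) \<and> c = t *\<^sub>R (B - A - C) \<and> d = w *\<^sub>R (C - A - B))"
proof -
  have last: "d \<bullet> v = - (a \<bullet> v) - (b \<bullet> v) - (c \<bullet> v)" for v
  proof -
    have "(a + b + c + d) \<bullet> v = 0" using sum by simp
    then show ?thesis by (simp add: inner_add_left)
  qed
  have nd': "\<not> (\<exists>q. norm q = 1 \<and> a \<bullet> q = 0 \<and> c \<bullet> q = 0 \<and> d \<bullet> q = 0)"
    "\<not> (\<exists>q. norm q = 1 \<and> a \<bullet> q = 0 \<and> b \<bullet> q = 0 \<and> d \<bullet> q = 0)"
    "\<not> (\<exists>q. norm q = 1 \<and> b \<bullet> q = 0 \<and> a \<bullet> q = 0 \<and> d \<bullet> q = 0)"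
    "\<not> (\<exists>q. norm q = 1 \<and> b \<bullet> q = 0 \<and> a \<bullet> q = 0 \<and> c \<bullet> q = 0)"
    "\<not> (\<exists>q. norm q = 1 \<and> c \<bullet> q = 0 \<and> a \<bullet> q = 0 \<and> b \<bullet> q = 0)"
    using nd last by (simp_all, smt+)
  \<comment> \<open>Number the normals \<open>a\<close>, \<open>b\<close>, \<open>c\<close>,
    \<open>d\<close> from 1 to 4. Then \<open>pij\<close> is the vertex on the two remaining circles
    that is positive on normal \<open>i\<close>; since the normals sum to zero, it is negative on
    normal \<open>j\<close>.\<close>
  obtain p12 where p12: "norm p12 = 1" "0 < a \<bullet> p12" "c \<bullet> p12 = 0" "d \<bullet> p12 = 0" using dual_vector[OF nd'(1)] .
  obtain p13 where p13: "norm p13 = 1" "0 < a \<bullet> p13" "b \<bullet> p13 = 0" "d \<bullet> p13 = 0" using dual_vector[OF nd'(2)] .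
  obtain p14 where p14: "norm p14 = 1" "0 < a \<bullet> p14" "b \<bullet> p14 = 0" "c \<bullet> p14 = 0" using dual_vector[OF nd] .
  obtain p23 where p23: "norm p23 = 1" "0 < b \<bullet> p23" "a \<bullet> p23 = 0" "d \<bullet> p23 = 0" using dual_vector[OF nd'(3)] .
  obtain p24 where p24: "norm p24 = 1" "0 < b \<bullet> p24" "a \<bullet> p24 = 0" "c \<bullet> p24 = 0" using dual_vector[OF nd'(4)] .
  obtain p34 where p34: "norm p34 = 1" "0 < c \<bullet> p34" "a \<bullet> p34 = 0" "b \<bullet> p34 = 0" using dual_vector[OF nd'(5)] .
  have opp: "b \<bullet> p12 = - (a \<bullet> p12)" "c \<bullet> p13 = - (a \<bullet> p13)" "d \<bullet> p14 = - (a \<bullet> p14)"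
    "c \<bullet> p23 = - (b \<bullet> p23)" "d \<bullet> p24 = - (b \<bullet> p24)" "d \<bullet> p34 = - (c \<bullet> p34)"
    using last[of p12] last[of p13] last[of p14] last[of p23] last[of p24] last[of p34]
      p12 p13 p14 p23 p24 p34 by simp_all
  note dots = p12 p13 p14 p23 p24 p34 opp
  obtain f where f: "norm f = 1" "h \<le> f \<bullet> p13" "h \<le> f \<bullet> p14" "h \<le> f \<bullet> p23" "h \<le> f \<bullet> p24"
  proof -
    \<comment> \<open>The sum of its four vertices is a point inside the quadrangular cell; the next
      two cells are treated in the same way.\<close>
    let ?x = "p13 + p14 + p23 + p24"
    have "0 < a \<bullet> ?x" "0 < b \<bullet> ?x" "c \<bullet> ?x < 0" "d \<bullet> ?x < 0"
      using dots by (simp_all add: inner_add_right)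
    then obtain f where f: "norm f = 1"
      "\<And>y. (\<And>e. e \<in> {a, b, c, d} \<Longrightarrow> 0 \<le> (e \<bullet> ?x) * (e \<bullet> y)) \<Longrightarrow> h * norm y \<le> f \<bullet> y"
      using coverableE[OF cov, of ?x] by (metis empty_iff insert_iff less_irrefl)
    have "h * norm y \<le> f \<bullet> y" if "0 \<le> a \<bullet> y" "0 \<le> b \<bullet> y" "c \<bullet> y \<le> 0" "d \<bullet> y \<le> 0" for y
      using that \<open>0 < a \<bullet> ?x\<close> \<open>0 < b \<bullet> ?x\<close> \<open>c \<bullet> ?x < 0\<close> \<open>d \<bullet> ?x < 0\<close>
      by (intro f(2)) (auto intro: mult_nonneg_nonneg mult_nonpos_nonpos)
    from this[of p13] this[of p14] this[of p23] this[of p24] show ?thesis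
      using that[OF f(1)] dots by simp
  qed
  obtain g where g: "norm g = 1" "h \<le> g \<bullet> p12" "h \<le> g \<bullet> p14" "h \<le> g \<bullet> (- p23)" "h \<le> g \<bullet> p34"
  proof -
    let ?x = "p12 + p14 - p23 + p34"
    have "0 < a \<bullet> ?x" "b \<bullet> ?x < 0" "0 < c \<bullet> ?x" "d \<bullet> ?x < 0"
      using dots by (simp_all add: inner_add_right inner_diff_right)
    then obtain f where f: "norm f = 1"
      "\<And>y. (\<And>e. e \<in> {a, b, c, d} \<Longrightarrow> 0 \<le> (e \<bullet> ?x) * (e \<bullet> y)) \<Longrightarrow> h * norm y \<le> f \<bullet> y"
      using coverableE[OF cov, of ?x] by (metis empty_iff insert_iff less_irrefl)
    have "h * norm y \<le> f \<bullet> y" if "0 \<le> a \<bullet> y" "b \<bullet> y \<le> 0" "0 \<le> c \<bullet> y" "d \<bullet> y \<le> 0" for y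
      using that \<open>0 < a \<bullet> ?x\<close> \<open>b \<bullet> ?x < 0\<close> \<open>0 < c \<bullet> ?x\<close> \<open>d \<bullet> ?x < 0\<close>
      by (intro f(2)) (auto intro: mult_nonneg_nonneg mult_nonpos_nonpos)
    from this[of p12] this[of p14] this[of "- p23"] this[of p34] show ?thesis
      using that[OF f(1)] dots by simp
  qed
  obtain k where k: "norm k = 1" "h \<le> k \<bullet> p12" "h \<le> k \<bullet> p13" "h \<le> k \<bullet> (- p24)" "h \<le> k \<bullet> (- p34)"
  proof -
    let ?x = "p12 + p13 - p24 - p34"
    have "0 < a \<bullet> ?x" "b \<bullet> ?x < 0" "c \<bullet> ?x < 0" "0 < d \<bullet> ?x"
      using dots by (simp_all add: inner_add_right inner_diff_right)
    then obtain f where f: "norm f = 1"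
      "\<And>y. (\<And>e. e \<in> {a, b, c, d} \<Longrightarrow> 0 \<le> (e \<bullet> ?x) * (e \<bullet> y)) \<Longrightarrow> h * norm y \<le> f \<bullet> y"
      using coverableE[OF cov, of ?x] by (metis empty_iff insert_iff less_irrefl)
    have "h * norm y \<le> f \<bullet> y" if "0 \<le> a \<bullet> y" "b \<bullet> y \<le> 0" "c \<bullet> y \<le> 0" "0 \<le> d \<bullet> y" for y
      using that \<open>0 < a \<bullet> ?x\<close> \<open>b \<bullet> ?x < 0\<close> \<open>c \<bullet> ?x < 0\<close> \<open>0 < d \<bullet> ?x\<close>
      by (intro f(2)) (auto intro: mult_nonneg_nonneg mult_nonpos_nonpos)
    from this[of p12] this[of p13] this[of "- p24"] this[of "- p34"] show ?thesis
      using that[OF f(1)] dots by simp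
  qed
  have neg: "norm (- p23) = 1" "norm (- p24) = 1" "norm (- p34) = 1" using dots by simp_all
  \<comment> \<open>Every pair of opposite edge directions is a diagonal of two of the three
    quadrangles, in one of them with one vector negated. For example \<open>F1\<close> and
    \<open>K2\<close> both concern \<open>p13\<close> and \<open>p24\<close>.\<close>
  note F1 = cap_orthogonal_pair[OF f(1) p13(1) p24(1) h f(2,5)]
  note F2 = cap_orthogonal_pair[OF f(1) p14(1) p23(1) h f(3,4)]
  note G1 = cap_orthogonal_pair[OF g(1) p12(1) p34(1) h g(2,5)]
  note G2 = cap_orthogonal_pair[OF g(1) p14(1) neg(1) h g(3,4)]
  note K1 = cap_orthogonal_pair[OF k(1) p12(1) neg(3) h k(2,5)]
  note K2 = cap_orthogonal_pair[OF k(1) p13(1) neg(2) h k(3,4)]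
  have orth: "p13 \<bullet> p24 = 0" "p14 \<bullet> p23 = 0" "p12 \<bullet> p34 = 0"
    using F1(1) F2(1) G1(1) G2(1) K1(1) K2(1) by simp_all
  have unit: "p12 \<bullet> p12 = 1" "p13 \<bullet> p13 = 1" "p14 \<bullet> p14 = 1" "p23 \<bullet> p23 = 1" "p24 \<bullet> p24 = 1" "p34 \<bullet> p34 = 1"
    using dots by (simp_all add: dot_square_norm)
  have hh: "h = 1 / sqrt 2" using F1(2) orth by simp
  have f': "f = (1 / sqrt 2) *\<^sub>R (p13 + p24)" "f = (1 / sqrt 2) *\<^sub>R (p14 + p23)"
    and g': "g = (1 / sqrt 2) *\<^sub>R (p12 + p34)" "g = (1 / sqrt 2) *\<^sub>R (p14 - p23)"
    and k': "k = (1 / sqrt 2) *\<^sub>R (p12 - p34)" "k = (1 / sqrt 2) *\<^sub>R (p13 - p24)"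
    using F1(2) F2(2) G1(2) G2(2) K1(2) K2(2) orth by simp_all
  have "f \<bullet> g = 0" unfolding f'(2) g'(2) using orth unit
    by (simp add: inner_add_left inner_add_right inner_diff_left inner_diff_right inner_commute)
  moreover have "f \<bullet> k = 0" unfolding f'(1) k'(2) using orth unit
    by (simp add: inner_add_left inner_add_right inner_diff_left inner_diff_right inner_commute)
  moreover have "g \<bullet> k = 0" unfolding g'(1) k'(1) using orth unit
    by (simp add: inner_add_left inner_add_right inner_diff_left inner_diff_right inner_commute)
  moreover note fgk = f(1) g(1) k(1) calculation
  note E = orthonormal_expand[OF fgk]
  \<comment> \<open>Each center is now expressed by either of its two diagonals. Computing its
    product with a normal in both ways shows that the three coordinates of the normal agree up to
    sign.\<close>
  have "a \<bullet> f = a \<bullet> p13 / sqrt 2" "a \<bullet> f = a \<bullet> p14 / sqrt 2" "a \<bullet> g = a \<bullet> p14 / sqrt 2" "a \<bullet> k = a \<bullet> p13 / sqrt 2"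
    by (subst f'(1) f'(2) g'(2) k'(2), simp add: dots inner_add_right inner_diff_right)+
  then have "a \<bullet> g = a \<bullet> f" "a \<bullet> k = a \<bullet> f" by simp_all
  then have "a = (a \<bullet> f) *\<^sub>R (f + g + k)" using E[of a] by (simp add: scaleR_add_right)
  moreover
  have "b \<bullet> f = b \<bullet> p24 / sqrt 2" "b \<bullet> f = b \<bullet> p23 / sqrt 2" "b \<bullet> g = - (b \<bullet> p23) / sqrt 2" "b \<bullet> k = - (b \<bullet> p24) / sqrt 2"
    by (subst f'(1) f'(2) g'(2) k'(2), simp add: dots inner_add_right inner_diff_right)+
  then have "b \<bullet> g = - (b \<bullet> f)" "b \<bullet> k = - (b \<bullet> f)" by simp_all
  then have "b = (b \<bullet> f) *\<^sub>R (f - g - k)" using E[of b] by (simp add: scaleR_diff_right)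
  moreover
  have "c \<bullet> f = - (a \<bullet> p13) / sqrt 2" "c \<bullet> f = - (b \<bullet> p23) / sqrt 2" "c \<bullet> g = b \<bullet> p23 / sqrt 2" "c \<bullet> k = - (a \<bullet> p13) / sqrt 2"
    by (subst f'(1) f'(2) g'(2) k'(2), simp add: dots inner_add_right inner_diff_right)+
  then have "c \<bullet> f = - (c \<bullet> g)" "c \<bullet> k = - (c \<bullet> g)" by simp_all
  then have "c = (c \<bullet> g) *\<^sub>R (g - f - k)" using E[of c] by (simp add: scaleR_diff_right)
  moreover
  have "d \<bullet> f = - (b \<bullet> p24) / sqrt 2" "d \<bullet> f = - (a \<bullet> p14) / sqrt 2" "d \<bullet> g = - (a \<bullet> p14) / sqrt 2" "d \<bullet> k = b \<bullet> p24 / sqrt 2"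
    by (subst f'(1) f'(2) g'(2) k'(2), simp add: dots inner_add_right inner_diff_right)+
  then have "d \<bullet> f = - (d \<bullet> k)" "d \<bullet> g = - (d \<bullet> k)" by simp_all
  then have "(d \<bullet> k) *\<^sub>R (k - f - g) = (d \<bullet> f) *\<^sub>R f + (d \<bullet> g) *\<^sub>R g + (d \<bullet> k) *\<^sub>R k"
    by (simp add: algebra_simps)
  then have "d = (d \<bullet> k) *\<^sub>R (k - f - g)" using E[of d] by simp
  ultimately show ?thesis using hh fgk by blast
qed

lemma triple_product_eq_0:
  fixes a b c :: "real^3"
  assumes "a \<bullet> cross3 b c = 0"
  obtains q where "norm q = 1" "a \<bullet> q = 0" "b \<bullet> q = 0" "c \<bullet> q = 0"
proof -
  have "det (vector [a, b, c] :: real^3^3) = 0" using assms by (simp add: dot_cross_det)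
  then have "rank (vector [a, b, c] :: real^3^3) \<noteq> CARD(3)" by (simp add: det_eq_0_rank)
  then obtain x where x: "x \<noteq> 0" "(vector [a, b, c] :: real^3^3) *v x = 0"
    using matrix_nonfull_linear_equations_eq by blast
  have "(vector [a, b, c] :: real^3^3) $ i \<bullet> x = 0" for i
    using x(2) by (metis matrix_vector_mul_component zero_index)
  from this[of 1] this[of 2] this[of 3] have "a \<bullet> x = 0" "b \<bullet> x = 0" "c \<bullet> x = 0" by simp_all
  then show ?thesis using x(1) by (intro that[of "x /\<^sub>R norm x"]) simp_all
qed

text \<open>This is Cramer's rule: each coefficient is, up to sign, the determinant of the other
  three vectors. All are nonzero if no three of the vectors are dependent, so they can serve as the
  rescaling factors.\<close>

lemma triple_product_relation:
  fixes a b c d :: "real^3"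
  shows "(b \<bullet> cross3 c d) *\<^sub>R a + (- (a \<bullet> cross3 c d)) *\<^sub>R b + (a \<bullet> cross3 b d) *\<^sub>R c
    + (- (a \<bullet> cross3 b c)) *\<^sub>R d = 0"
  by (simp add: vec_eq_iff forall_3 cross3_def inner_vec_def sum_3 algebra_simps)

lemma coverable_4:
  fixes a b c d :: "real^3"
  assumes cov: "coverable {a, b, c, d} h" and nz: "a \<noteq> 0" "b \<noteq> 0" "c \<noteq> 0" "d \<noteq> 0"
    and h: "1 / sqrt 2 \<le> h"
  shows "h = 1 / sqrt 2 \<and> (\<exists>A B C r s t w. norm A = 1 \<and> norm B = 1 \<and> norm C = 1 \<and>
     A \<bullet> B = 0 \<and> A \<bullet> C = 0 \<and> B \<bullet> C = 0 \<and>
     a = r *\<^sub>R (A + B + C) \<and> b = s *\<^sub>R (A - B - C) \<and> c = t *\<^sub>R (B - A - C) \<and> d = w *\<^sub>R (C - A - B))"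
proof -
  have deg: False if "norm q = 1" 
    "a \<bullet> q = 0 \<and> b \<bullet> q = 0 \<and> c \<bullet> q = 0 \<or> a \<bullet> q = 0 \<and> b \<bullet> q = 0 \<and> d \<bullet> q = 0 \<or>
     a \<bullet> q = 0 \<and> c \<bullet> q = 0 \<and> d \<bullet> q = 0 \<or> b \<bullet> q = 0 \<and> c \<bullet> q = 0 \<and> d \<bullet> q = 0" for q
  proof -
    have perm: "{a, b, d, c} = {a, b, c, d}" "{a, c, d, b} = {a, b, c, d}" "{b, c, d, a} = {a, b, c, d}" by auto
    have cov': "coverable {a, b, d, c} h" "coverable {a, c, d, b} h" "coverable {b, c, d, a} h"
      unfolding perm by (rule cov)+
    show False
      using that(2) coverable_4_degenerate[OF cov nz that(1)]
        coverable_4_degenerate[OF cov'(1) nz(1,2,4,3) that(1)]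
        coverable_4_degenerate[OF cov'(2) nz(1,3,4,2) that(1)]
        coverable_4_degenerate[OF cov'(3) nz(2,3,4,1) that(1)] h
      by (auto simp del: not_less simp: not_less[symmetric])
  qed
  define r0 s0 t0 w0 where "r0 = b \<bullet> cross3 c d" "s0 = - (a \<bullet> cross3 c d)" "t0 = a \<bullet> cross3 b d" "w0 = - (a \<bullet> cross3 b c)"
  note defs = this
  have nz0: "r0 \<noteq> 0" "s0 \<noteq> 0" "t0 \<noteq> 0" "w0 \<noteq> 0"
    unfolding defs using deg by (metis triple_product_eq_0 neg_equal_0_iff_equal)+
  have cov0: "coverable {r0 *\<^sub>R a, s0 *\<^sub>R b, t0 *\<^sub>R c, w0 *\<^sub>R d} h"
    by (rule coverable_rescale[OF cov]) (use nz0 in blast)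
  have sum0: "r0 *\<^sub>R a + s0 *\<^sub>R b + t0 *\<^sub>R c + w0 *\<^sub>R d = 0"
    unfolding defs by (rule triple_product_relation)
  have nd: "\<not> (\<exists>q. norm q = 1 \<and> (r0 *\<^sub>R a) \<bullet> q = 0 \<and> (s0 *\<^sub>R b) \<bullet> q = 0 \<and> (t0 *\<^sub>R c) \<bullet> q = 0)"
    using deg nz0 by auto
  obtain A B C r s t w where hh: "h = 1 / sqrt 2" and
    on: "norm A = 1" "norm B = 1" "norm C = 1" "A \<bullet> B = 0" "A \<bullet> C = 0" "B \<bullet> C = 0" and
    eqs: "r0 *\<^sub>R a = r *\<^sub>R (A + B + C)" "s0 *\<^sub>R b = s *\<^sub>R (A - B - C)"
      "t0 *\<^sub>R c = t *\<^sub>R (B - A - C)" "w0 *\<^sub>R d = w *\<^sub>R (C - A - B)"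
    using coverable_4_sum_zero[OF cov0 h sum0 nd] by blast
  have div: "x = (r / r0) *\<^sub>R y" if "r0 *\<^sub>R x = r *\<^sub>R y" "r0 \<noteq> 0" for r0 r and x y :: "real^3"
  proof -
    have "x = (1 / r0) *\<^sub>R (r0 *\<^sub>R x)" using that(2) by simp
    then show ?thesis unfolding that(1) by simp
  qed
  show ?thesis using hh on div[OF eqs(1) nz0(1)] div[OF eqs(2) nz0(2)] div[OF eqs(3) nz0(3)] div[OF eqs(4) nz0(4)]
    by blast
qed

section \<open>The tetrahedral arrangement attains \<open>pi / 4\<close>\<close>

text \<open>With one sign against three, \<open>P\<close> is the sum of the positive numbers
  \<open>Q\<close>, \<open>R\<close>, \<open>S\<close>, so \<open>P\<^sup>2\<close> dominates the
  other squares in the identity \<open>tight\<close>. There is slack: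
  \<open>4 * (norm y)\<^sup>2 \<le> 2 * P\<^sup>2\<close> is available and only the factor 3 is
  used, so triangular cells even fit into smaller caps.\<close>

lemma tetrahedral_triangle_cap:
  fixes p q r s x :: "real^3"
  assumes sum: "p + q + r + s = 0" and p: "norm p = sqrt 3"
    and tight: "\<And>y. (p \<bullet> y)\<^sup>2 + (q \<bullet> y)\<^sup>2 + (r \<bullet> y)\<^sup>2 + (s \<bullet> y)\<^sup>2 = 4 * (norm y)\<^sup>2"
    and x: "(p \<bullet> x) * (q \<bullet> x) < 0" "(p \<bullet> x) * (r \<bullet> x) < 0" "(p \<bullet> x) * (s \<bullet> x) < 0"
  shows "\<exists>c. norm c = 1 \<and> (\<forall>y. (\<forall>e\<in>{p, q, r, s}. 0 < (e \<bullet> x) * (e \<bullet> y)) \<longrightarrow> 1 / sqrt 2 * norm y \<le> c \<bullet> y)"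
proof -
  define \<sigma> where "\<sigma> = sgn (p \<bullet> x)"
  define c where "c = (\<sigma> / sqrt 3) *\<^sub>R p"
  have "p \<bullet> x \<noteq> 0" using x by auto
  then have "\<bar>\<sigma>\<bar> = 1" by (simp add: \<sigma>_def abs_sgn_eq)
  then have "norm c = 1" by (simp add: c_def p)
  moreover have "1 / sqrt 2 * norm y \<le> c \<bullet> y" if y: "\<forall>e\<in>{p, q, r, s}. 0 < (e \<bullet> x) * (e \<bullet> y)" for y
  proof -
    define P Q R S where "P = \<sigma> * (p \<bullet> y)" "Q = - \<sigma> * (q \<bullet> y)" "R = - \<sigma> * (r \<bullet> y)" "S = - \<sigma> * (s \<bullet> y)"
    note defs = this
    have pos: "0 < P" "0 < Q" "0 < R" "0 < S"
      using x y unfolding defs \<sigma>_def by (auto simp: sgn_if zero_less_mult_iff mult_less_0_iff)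
    have "(p + q + r + s) \<bullet> y = 0" using sum by simp
    then have "\<sigma> * (p \<bullet> y + q \<bullet> y + r \<bullet> y + s \<bullet> y) = 0" by (simp add: inner_add_left)
    then have PQRS: "P = Q + R + S" unfolding defs by (simp add: algebra_simps)
    have "\<sigma> * \<sigma> = 1" using \<open>\<bar>\<sigma>\<bar> = 1\<close> by (metis abs_mult_self_eq mult.right_neutral)
    then have s2: "\<sigma>\<^sup>2 = 1" by (simp add: power2_eq_square)
    have "P\<^sup>2 + Q\<^sup>2 + R\<^sup>2 + S\<^sup>2 = 4 * (norm y)\<^sup>2"
      unfolding tight[symmetric] defs by (simp add: power_mult_distrib s2)
    moreover have "Q\<^sup>2 + R\<^sup>2 + S\<^sup>2 \<le> P\<^sup>2"
      unfolding PQRS using pos by (simp add: power2_eq_square algebra_simps)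
    moreover have "0 \<le> P\<^sup>2" by simp
    ultimately have "3 * (norm y)\<^sup>2 \<le> 2 * P\<^sup>2" by linarith
    then have "(1 / sqrt 2 * norm y)\<^sup>2 \<le> (P / sqrt 3)\<^sup>2"
      by (simp add: power_mult_distrib power_divide field_simps)
    then have "1 / sqrt 2 * norm y \<le> P / sqrt 3"
      by (rule power2_le_imp_le) (use pos in simp)
    then show ?thesis by (simp add: c_def defs)
  qed
  ultimately show ?thesis by blast
qed

text \<open>With two signs against two, \<open>P + Q = R + S\<close>. The estimate is sharp when one
  of \<open>P\<close>, \<open>Q\<close> and one of \<open>R\<close>, \<open>S\<close> vanish, that
  is at the vertices, so the quadrangles determine the radius.\<close>

lemma tetrahedral_square_cap:
  fixes p q r s x :: "real^3"
  assumes sum: "p + q + r + s = 0" and pq: "norm (p + q) = 2"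
    and tight: "\<And>y. (p \<bullet> y)\<^sup>2 + (q \<bullet> y)\<^sup>2 + (r \<bullet> y)\<^sup>2 + (s \<bullet> y)\<^sup>2 = 4 * (norm y)\<^sup>2"
    and x: "0 < (p \<bullet> x) * (q \<bullet> x)" "(p \<bullet> x) * (r \<bullet> x) < 0" "(p \<bullet> x) * (s \<bullet> x) < 0"
  shows "\<exists>c. norm c = 1 \<and> (\<forall>y. (\<forall>e\<in>{p, q, r, s}. 0 < (e \<bullet> x) * (e \<bullet> y)) \<longrightarrow> 1 / sqrt 2 * norm y \<le> c \<bullet> y)"
proof -
  define \<sigma> where "\<sigma> = sgn (p \<bullet> x)"
  define c where "c = (\<sigma> / 2) *\<^sub>R (p + q)"
  have "p \<bullet> x \<noteq> 0" using x by auto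
  then have "\<bar>\<sigma>\<bar> = 1" by (simp add: \<sigma>_def abs_sgn_eq)
  then have "norm c = 1" by (simp add: c_def pq)
  moreover have "1 / sqrt 2 * norm y \<le> c \<bullet> y" if y: "\<forall>e\<in>{p, q, r, s}. 0 < (e \<bullet> x) * (e \<bullet> y)" for y
  proof -
    define P Q R S where "P = \<sigma> * (p \<bullet> y)" "Q = \<sigma> * (q \<bullet> y)" "R = - \<sigma> * (r \<bullet> y)" "S = - \<sigma> * (s \<bullet> y)"
    note defs = this
    have pos: "0 < P" "0 < Q" "0 < R" "0 < S"
      using x y unfolding defs \<sigma>_def by (auto simp: sgn_if zero_less_mult_iff mult_less_0_iff)
    have "(p + q + r + s) \<bullet> y = 0" using sum by simp
    then have "\<sigma> * (p \<bullet> y + q \<bullet> y + r \<bullet> y + s \<bullet> y) = 0" by (simp add: inner_add_left)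
    then have PQRS: "P + Q = R + S" unfolding defs by (simp add: algebra_simps)
    have "\<sigma> * \<sigma> = 1" using \<open>\<bar>\<sigma>\<bar> = 1\<close> by (metis abs_mult_self_eq mult.right_neutral)
    then have s2: "\<sigma>\<^sup>2 = 1" by (simp add: power2_eq_square)
    have "P\<^sup>2 + Q\<^sup>2 + R\<^sup>2 + S\<^sup>2 = 4 * (norm y)\<^sup>2"
      unfolding tight[symmetric] defs by (simp add: power_mult_distrib s2)
    moreover have "P\<^sup>2 + Q\<^sup>2 \<le> (P + Q)\<^sup>2" "R\<^sup>2 + S\<^sup>2 \<le> (R + S)\<^sup>2"
      using pos by (simp_all add: power2_eq_square algebra_simps)
    ultimately have "2 * (norm y)\<^sup>2 \<le> (P + Q)\<^sup>2" unfolding PQRS[symmetric] by linarith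
    then have "(1 / sqrt 2 * norm y)\<^sup>2 \<le> ((P + Q) / 2)\<^sup>2"
      by (simp add: power_mult_distrib power_divide field_simps)
    then have "1 / sqrt 2 * norm y \<le> (P + Q) / 2"
      by (rule power2_le_imp_le) (use pos in simp)
    then show ?thesis by (simp add: c_def defs inner_add_left distrib_left add_divide_distrib)
  qed
  ultimately show ?thesis by blast
qed

lemma orthonormal_frame_norm:
  fixes A B C :: "real^3"
  assumes on: "norm A = 1" "norm B = 1" "norm C = 1" "A \<bullet> B = 0" "A \<bullet> C = 0" "B \<bullet> C = 0"
  shows "norm (A + B + C) = sqrt 3" "norm (A - B - C) = sqrt 3" "norm (B - A - C) = sqrt 3" "norm (C - A - B) = sqrt 3"
proof -
  have "A \<bullet> A = 1" "B \<bullet> B = 1" "C \<bullet> C = 1" using on by (simp_all add: dot_square_norm)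
  then show "norm (A + B + C) = sqrt 3" "norm (A - B - C) = sqrt 3" "norm (B - A - C) = sqrt 3" "norm (C - A - B) = sqrt 3"
    using on by (simp_all add: norm_eq_sqrt_inner inner_add_left inner_add_right inner_diff_left inner_diff_right inner_commute)
qed

text \<open>The four normals are alternate vertices of a cube with edges along \<open>A\<close>,
  \<open>B\<close>, \<open>C\<close>, hence the vertices of a regular tetrahedron centered at the
  origin. This explains the zero sum and the identity \<open>tight\<close>.\<close>

lemma coverable_tetrahedral:
  fixes A B C :: "real^3"
  assumes on: "norm A = 1" "norm B = 1" "norm C = 1" "A \<bullet> B = 0" "A \<bullet> C = 0" "B \<bullet> C = 0"
  shows "coverable {A + B + C, A - B - C, B - A - C, C - A - B} (1 / sqrt 2)"
proof -
  define a b c d where "a = A + B + C" "b = A - B - C" "c = B - A - C" "d = C - A - B"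
  note defs = this
  have n3: "norm v = sqrt 3" if "v \<in> {a, b, c, d}" for v
    using that orthonormal_frame_norm[OF on] unfolding defs by blast
  have sum: "a + b + c + d = 0" by (simp add: defs)
  have tight: "(a \<bullet> y)\<^sup>2 + (b \<bullet> y)\<^sup>2 + (c \<bullet> y)\<^sup>2 + (d \<bullet> y)\<^sup>2 = 4 * (norm y)\<^sup>2" for y
  proof -
    have "(norm y)\<^sup>2 = (A \<bullet> y)\<^sup>2 + (B \<bullet> y)\<^sup>2 + (C \<bullet> y)\<^sup>2"
      unfolding power2_norm_eq_inner
      by (subst orthonormal_inner[OF on]) (simp add: power2_eq_square inner_commute)
    then show ?thesis
      by (simp add: defs inner_add_left inner_diff_left power2_eq_square algebra_simps)
  qed
  have pair: "norm (a + b) = 2" "norm (a + c) = 2" "norm (a + d) = 2"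
  proof -
    have "a + b = A + A" "a + c = B + B" "a + d = C + C" by (simp_all add: defs)
    then show "norm (a + b) = 2" "norm (a + c) = 2" "norm (a + d) = 2"
      unfolding scaleR_2[symmetric] using on by simp_all
  qed
  have perm: "{b, a, c, d} = {a, b, c, d}" "{c, a, b, d} = {a, b, c, d}" "{d, a, b, c} = {a, b, c, d}"
    "{a, c, b, d} = {a, b, c, d}" "{a, d, b, c} = {a, b, c, d}" by auto
  have "\<exists>e. norm e = 1 \<and> (\<forall>y. (\<forall>v\<in>{a, b, c, d}. 0 < (v \<bullet> x) * (v \<bullet> y)) \<longrightarrow> 1 / sqrt 2 * norm y \<le> e \<bullet> y)"
    if x: "\<forall>v\<in>{a, b, c, d}. v \<bullet> x \<noteq> 0" for x
  proof -
    have "(a + b + c + d) \<bullet> x = 0" using sum by simp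
    then have sx: "a \<bullet> x + b \<bullet> x + c \<bullet> x + d \<bullet> x = 0" by (simp add: inner_add_left)
    have tri: "\<exists>e. norm e = 1 \<and> (\<forall>y. (\<forall>v\<in>{a, b, c, d}. 0 < (v \<bullet> x) * (v \<bullet> y)) \<longrightarrow> 1 / sqrt 2 * norm y \<le> e \<bullet> y)"
      if "{p, q, r, s} = {a, b, c, d}" "p + q + r + s = 0"
        "\<And>y. (p \<bullet> y)\<^sup>2 + (q \<bullet> y)\<^sup>2 + (r \<bullet> y)\<^sup>2 + (s \<bullet> y)\<^sup>2 = 4 * (norm y)\<^sup>2"
        "(p \<bullet> x) * (q \<bullet> x) < 0" "(p \<bullet> x) * (r \<bullet> x) < 0" "(p \<bullet> x) * (s \<bullet> x) < 0" for p q r s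
    proof -
      have "p \<in> {a, b, c, d}" unfolding that(1)[symmetric] by simp
      from tetrahedral_triangle_cap[OF that(2) n3[OF this] that(3-6)] show ?thesis unfolding that(1) .
    qed
    have sq: "\<exists>e. norm e = 1 \<and> (\<forall>y. (\<forall>v\<in>{a, b, c, d}. 0 < (v \<bullet> x) * (v \<bullet> y)) \<longrightarrow> 1 / sqrt 2 * norm y \<le> e \<bullet> y)"
      if "{p, q, r, s} = {a, b, c, d}" "p + q + r + s = 0" "norm (p + q) = 2"
        "\<And>y. (p \<bullet> y)\<^sup>2 + (q \<bullet> y)\<^sup>2 + (r \<bullet> y)\<^sup>2 + (s \<bullet> y)\<^sup>2 = 4 * (norm y)\<^sup>2"
        "0 < (p \<bullet> x) * (q \<bullet> x)" "(p \<bullet> x) * (r \<bullet> x) < 0" "(p \<bullet> x) * (s \<bullet> x) < 0" for p q r s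
      using tetrahedral_square_cap[OF that(2-7)] unfolding that(1) .
    \<comment> \<open>The four products with \<open>x\<close> sum to zero and so cannot all have the
      same sign: either one sign stands alone or they split into two pairs.\<close>
    consider "(a \<bullet> x) * (b \<bullet> x) < 0 \<and> (a \<bullet> x) * (c \<bullet> x) < 0 \<and> (a \<bullet> x) * (d \<bullet> x) < 0"
      | "(b \<bullet> x) * (a \<bullet> x) < 0 \<and> (b \<bullet> x) * (c \<bullet> x) < 0 \<and> (b \<bullet> x) * (d \<bullet> x) < 0"
      | "(c \<bullet> x) * (a \<bullet> x) < 0 \<and> (c \<bullet> x) * (b \<bullet> x) < 0 \<and> (c \<bullet> x) * (d \<bullet> x) < 0"
      | "(d \<bullet> x) * (a \<bullet> x) < 0 \<and> (d \<bullet> x) * (b \<bullet> x) < 0 \<and> (d \<bullet> x) * (c \<bullet> x) < 0"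
      | "0 < (a \<bullet> x) * (b \<bullet> x) \<and> (a \<bullet> x) * (c \<bullet> x) < 0 \<and> (a \<bullet> x) * (d \<bullet> x) < 0"
      | "0 < (a \<bullet> x) * (c \<bullet> x) \<and> (a \<bullet> x) * (b \<bullet> x) < 0 \<and> (a \<bullet> x) * (d \<bullet> x) < 0"
      | "0 < (a \<bullet> x) * (d \<bullet> x) \<and> (a \<bullet> x) * (b \<bullet> x) < 0 \<and> (a \<bullet> x) * (c \<bullet> x) < 0"
    proof -
      have "a \<bullet> x < 0 \<or> 0 < a \<bullet> x" "b \<bullet> x < 0 \<or> 0 < b \<bullet> x" "c \<bullet> x < 0 \<or> 0 < c \<bullet> x" "d \<bullet> x < 0 \<or> 0 < d \<bullet> x"
        using x by (auto simp: linorder_neq_iff)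
      moreover have "\<not> (0 < a \<bullet> x \<and> 0 < b \<bullet> x \<and> 0 < c \<bullet> x \<and> 0 < d \<bullet> x)"
        "\<not> (a \<bullet> x < 0 \<and> b \<bullet> x < 0 \<and> c \<bullet> x < 0 \<and> d \<bullet> x < 0)"
        using sx by auto
      ultimately show ?thesis
        using that unfolding mult_less_0_iff zero_less_mult_iff by blast
    qed
    then show ?thesis
    proof cases
      case 1 then show ?thesis by (intro tri[OF refl sum tight]) simp_all
    next
      case 2 then show ?thesis using sum tight by (intro tri[OF perm(1)]) (simp_all add: ac_simps)
    next
      case 3 then show ?thesis using sum tight by (intro tri[OF perm(2)]) (simp_all add: ac_simps)
    next
      case 4 then show ?thesis using sum tight by (intro tri[OF perm(3)]) (simp_all add: ac_simps)
    next
      case 5 then show ?thesis by (intro sq[OF refl sum pair(1) tight]) simp_all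
    next
      case 6 then show ?thesis using sum tight pair by (intro sq[OF perm(4)]) (simp_all add: ac_simps)
    next
      case 7 then show ?thesis using sum tight pair by (intro sq[OF perm(5)]) (simp_all add: ac_simps)
    qed
  qed
  then show ?thesis unfolding coverable_def defs[symmetric] by blast
qed

section \<open>The volume bound\<close>

lemma tetrahedron_volume:
  fixes p q r :: "real^3"
  obtains M where "M \<in> lmeasurable" "measure lebesgue M = \<bar>p \<bullet> cross3 q r\<bar> / 6"
    "\<And>\<alpha> \<beta> \<gamma>. 0 \<le> \<alpha> \<Longrightarrow> 0 \<le> \<beta> \<Longrightarrow> 0 \<le> \<gamma> \<Longrightarrow> \<alpha> + \<beta> + \<gamma> \<le> 1 \<Longrightarrow>
      \<alpha> *\<^sub>R p + \<beta> *\<^sub>R q + \<gamma> *\<^sub>R r \<in> M"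
proof -
  define A :: "real^3^3" where "A = transpose (vector [p, q, r])"
  define S :: "(real^3) set" where "S = convex hull (insert 0 Basis)"
  have col: "A *v x = x $ 1 *\<^sub>R p + x $ 2 *\<^sub>R q + x $ 3 *\<^sub>R r" for x
    by (simp add: A_def vec_eq_iff matrix_vector_mult_def transpose_def sum_3 mult.commute)
  have "compact S" unfolding S_def
    by (rule finite_imp_compact_convex_hull) simp
  then have S: "S \<in> lmeasurable" by (rule lmeasurable_compact)
  have "measure lebesgue S = measure lborel S"
    using \<open>compact S\<close> by (intro measure_completion) (simp add: borel_compact)
  also have "\<dots> = 1 / 6" unfolding S_def content_std_simplex by (simp add: fact_numeral)
  finally have mS: "measure lebesgue S = 1 / 6" .
  show ?thesis
  proof (rule that)
    show "(*v) A ` S \<in> lmeasurable" 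
      by (rule measurable_linear_image[OF matrix_vector_mul_linear S])
    have "det A = p \<bullet> cross3 q r" by (simp add: A_def dot_cross_det)
    then show "measure lebesgue ((*v) A ` S) = \<bar>p \<bullet> cross3 q r\<bar> / 6"
      by (simp add: measure_linear_image[OF matrix_vector_mul_linear S] mS)
    fix \<alpha> \<beta> \<gamma> :: real
    assume *: "0 \<le> \<alpha>" "0 \<le> \<beta>" "0 \<le> \<gamma>" "\<alpha> + \<beta> + \<gamma> \<le> 1"
    let ?x = "vector [\<alpha>, \<beta>, \<gamma>] :: real^3"
    have "0 \<le> ?x $ i" for i using * by (cases i rule: exhaust_3[THEN disjE]) auto
    moreover have "(\<Sum>i\<in>UNIV. ?x $ i) \<le> 1" using * by (simp add: sum_3)
    ultimately have "?x \<in> S"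
      unfolding S_def std_simplex by (auto simp: Basis_vec_def sum.UNION_disjoint cart_eq_inner_axis[symmetric] axis_eq_axis)
    then show "\<alpha> *\<^sub>R p + \<beta> *\<^sub>R q + \<gamma> *\<^sub>R r \<in> (*v) A ` S"
      by (rule rev_image_eqI) (simp add: col)
  qed
qed

text \<open>With \<open>m\<close> the direction of the projection of \<open>c\<close> to the plane \<open>u\<^sup>\<bottom>\<close>, the points in question
  lie below the plane \<open>{y. m \<bullet> y = 1}\<close>, hence in a tetrahedron with one vertex at the origin.\<close>

lemma facet_pyramid_volume:
  fixes c u :: "real^3"
  assumes c: "norm c = 1" and u: "norm u = 1" and h: "0 < h" "h \<le> 1"
  obtains M where "M \<in> lmeasurable" "measure lebesgue M \<le> (1 - h) / (3 * h)"
    "\<And>z t. u \<bullet> z = 0 \<Longrightarrow> h * norm z \<le> c \<bullet> z \<Longrightarrow> 0 \<le> t \<Longrightarrow> norm (z + t *\<^sub>R c) \<le> 1 \<Longrightarrow> z + t *\<^sub>R c \<in> M"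
proof -
  define D where "D = c \<bullet> u"
  define m' where "m' = c - D *\<^sub>R u"
  define C where "C = norm m'"
  have uu: "u \<bullet> u = 1" "c \<bullet> c = 1" using u c by (simp_all add: dot_square_norm)
  have um': "u \<bullet> m' = 0" using uu by (simp add: m'_def D_def inner_diff_right inner_commute)
  have CD: "C\<^sup>2 = 1 - D\<^sup>2"
    unfolding C_def power2_norm_eq_inner m'_def using uu
    by (simp add: inner_diff_left inner_diff_right D_def inner_commute power2_eq_square)
  have cz: "c \<bullet> z = m' \<bullet> z" if "u \<bullet> z = 0" for z
    using that by (simp add: m'_def inner_diff_left)
  show ?thesis
  proof (cases "C < h")
    \<comment> \<open>\<open>C\<close> is the cosine of the angle between \<open>c\<close> and the
      plane of \<open>u\<close>. If it is below \<open>h\<close>, only \<open>z = 0\<close> meets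
      the cap condition and the points lie on the line of \<open>c\<close>.\<close>
    case True
    show ?thesis
    proof (rule that[of "span {c}"])
      have "dim (span {c}) \<le> card {c}" using dim_le_card[of "span {c}" "{c}"] by simp
      then have "negligible (span {c})" by (intro negligible_lowdim) (simp add: dim_span)
      then show "span {c} \<in> lmeasurable" by (rule negligible_imp_measurable)
      have "measure lebesgue (span {c}) = 0"
        by (rule negligible_imp_measure0) fact
      then show "measure lebesgue (span {c}) \<le> (1 - h) / (3 * h)"
        using h by (simp only:) simp
      fix z t assume z: "u \<bullet> z = 0" "h * norm z \<le> c \<bullet> z"
      have "h * norm z \<le> C * norm z"
        using z(2) norm_cauchy_schwarz[of m' z] cz[OF z(1)] by (simp add: C_def)
      then have "z = 0" using True by (auto simp: mult_le_cancel_right)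
      then show "z + t *\<^sub>R c \<in> span {c}" by (simp add: span_base span_scale)
    qed
  next
    case False
    then have hC: "h \<le> C" "0 < C" using h by simp_all
    define m where "m = m' /\<^sub>R C"
    define k where "k = cross3 u m"
    \<comment> \<open>In the plane of \<open>u\<close> the condition
      \<open>h * norm z \<le> c \<bullet> z\<close> describes the sector with
      \<open>\<bar>Y\<bar> \<le> L * X\<close> in the coordinates \<open>X\<close> along
      \<open>m\<close> and \<open>Y\<close> along \<open>k\<close>. At \<open>X = 1\<close> it has
      half-width \<open>L\<close>; the ray of \<open>c\<close> meets the plane
      \<open>m \<bullet> y = 1\<close> in \<open>c /\<^sub>R C\<close>.\<close>
    define L where "L = sqrt (C\<^sup>2 - h\<^sup>2) / h"
    have m: "norm m = 1" "u \<bullet> m = 0" using hC um' by (simp_all add: m_def flip: C_def)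
    have mm: "m \<bullet> m = 1" using m by (simp add: dot_square_norm)
    have k: "m \<bullet> k = 0" "u \<bullet> k = 0" "k \<bullet> m = 0" "k \<bullet> u = 0" by (simp_all add: k_def dot_cross_self)
    have "(norm k)\<^sup>2 = 1" unfolding k_def norm_cross using m u by simp
    then have nk: "norm k = 1" by (simp add: power2_eq_1_iff) (metis abs_norm_cancel abs_numeral(1) norm_ge_zero abs_of_nonneg le_minus_one_simps(3))
    have cmu: "c = C *\<^sub>R m + D *\<^sub>R u" using hC by (simp add: m_def m'_def)
    have "h\<^sup>2 \<le> C\<^sup>2" using hC h by (intro power_mono) auto
    then have L: "0 \<le> L" "L\<^sup>2 * h\<^sup>2 = C\<^sup>2 - h\<^sup>2" using h by (simp_all add: L_def power_divide)
    obtain M where M: "M \<in> lmeasurable"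
      "measure lebesgue M = \<bar>(c /\<^sub>R C) \<bullet> cross3 (m + L *\<^sub>R k) (m - L *\<^sub>R k)\<bar> / 6"
      "\<And>\<alpha> \<beta> \<gamma>. 0 \<le> \<alpha> \<Longrightarrow> 0 \<le> \<beta> \<Longrightarrow> 0 \<le> \<gamma> \<Longrightarrow> \<alpha> + \<beta> + \<gamma> \<le> 1 \<Longrightarrow>
        \<alpha> *\<^sub>R (c /\<^sub>R C) + \<beta> *\<^sub>R (m + L *\<^sub>R k) + \<gamma> *\<^sub>R (m - L *\<^sub>R k) \<in> M"
      using tetrahedron_volume[of "c /\<^sub>R C" "m + L *\<^sub>R k" "m - L *\<^sub>R k"] by blast
    show ?thesis
    proof (rule that[OF M(1)])
      have "cross3 m k = u" using mm m(2) by (simp add: k_def Lagrange inner_commute)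
      moreover have "cross3 k m = - cross3 m k" by (rule cross_skew)
      ultimately have "cross3 (m + L *\<^sub>R k) (m - L *\<^sub>R k) = - (2 * L) *\<^sub>R u"
        by (simp add: cross_add_left Cross3.right_diff_distrib cross_mult_left cross_mult_right scaleR_2 flip: scaleR_scaleR)
      then have "measure lebesgue M = \<bar>L * D\<bar> / (3 * C)"
        using hC M(2) by (simp add: D_def abs_mult field_simps)
      also have "\<dots> \<le> (1 - h) / (3 * h)"
      proof -
        have "(\<bar>L * D\<bar> * h)\<^sup>2 = (L\<^sup>2 * h\<^sup>2) * D\<^sup>2" by (simp add: power_mult_distrib)
        also have "\<dots> = (C\<^sup>2 - h\<^sup>2) * (1 - C\<^sup>2)" using CD L(2) by simp
        \<comment> \<open>Completing the square shows which inclination is worst: the subtracted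
          square vanishes for \<open>C\<^sup>2 = h\<close>.\<close>
        also have "\<dots> = ((1 - h) * C)\<^sup>2 - (C\<^sup>2 - h)\<^sup>2" by (simp add: power2_eq_square algebra_simps)
        also have "\<dots> \<le> ((1 - h) * C)\<^sup>2" by simp
        finally have "\<bar>L * D\<bar> * h \<le> (1 - h) * C" by (rule power2_le_imp_le) (use h hC in simp)
        then show ?thesis using h hC by (simp add: field_simps)
      qed
      finally show "measure lebesgue M \<le> (1 - h) / (3 * h)" .
      fix z t assume z: "u \<bullet> z = 0" "h * norm z \<le> c \<bullet> z" and t: "0 \<le> t" "norm (z + t *\<^sub>R c) \<le> 1"
      define X Y where "X = z \<bullet> m" "Y = z \<bullet> k"
      note defs = this
      have z_eq: "z = X *\<^sub>R m + Y *\<^sub>R k"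
        using orthonormal_expand[OF m(1) nk u, of z] m k z(1) by (simp add: defs inner_commute)
      have z2: "(norm z)\<^sup>2 = X\<^sup>2 + Y\<^sup>2"
        unfolding power2_norm_eq_inner using orthonormal_inner[OF m(1) nk u, of z z] m k z(1)
        by (simp add: defs inner_commute power2_eq_square)
      have czX: "c \<bullet> z = C * X" unfolding cmu using z(1) by (simp add: inner_add_left inner_add_right defs inner_commute)
      have hz: "0 \<le> h * norm z" using h by simp
      then have "0 \<le> C * X" using z(2) czX by linarith
      then have X0: "0 \<le> X" using hC by (simp add: zero_le_mult_iff)
      have "(h * norm z)\<^sup>2 \<le> (C * X)\<^sup>2" using z(2) czX hz by (intro power_mono) auto
      then have "h\<^sup>2 * X\<^sup>2 + h\<^sup>2 * Y\<^sup>2 \<le> C\<^sup>2 * X\<^sup>2" by (simp add: power_mult_distrib z2 algebra_simps)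
      moreover have "h\<^sup>2 * (L * X)\<^sup>2 = C\<^sup>2 * X\<^sup>2 - h\<^sup>2 * X\<^sup>2"
      proof -
        have "h\<^sup>2 * (L * X)\<^sup>2 = (L\<^sup>2 * h\<^sup>2) * X\<^sup>2" by (simp add: power_mult_distrib)
        then show ?thesis unfolding L(2) by (simp add: algebra_simps)
      qed
      ultimately have "h\<^sup>2 * Y\<^sup>2 \<le> h\<^sup>2 * (L * X)\<^sup>2" by linarith
      then have "\<bar>Y\<bar>\<^sup>2 \<le> (L * X)\<^sup>2" using h by simp
      then have YL: "\<bar>Y\<bar> \<le> L * X" by (rule power2_le_imp_le) (use L X0 in simp)
      \<comment> \<open>These are the coordinates of \<open>z\<close> with respect to
        \<open>m + L *\<^sub>R k\<close> and \<open>m - L *\<^sub>R k\<close>. For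
        \<open>L = 0\<close> the bound \<open>YL\<close> forces \<open>Y = 0\<close>, so the default
        value of division by zero is the right one.\<close>
      define \<beta> \<gamma> where "\<beta> = (X + Y / L) / 2" "\<gamma> = (X - Y / L) / 2"
      note bg = this
      have "\<bar>Y / L\<bar> \<le> X"
        using YL L(1) X0 by (cases "L = 0") (simp_all add: abs_divide divide_le_eq mult.commute)
      then have "Y / L \<le> X" "- (Y / L) \<le> X" unfolding abs_le_iff by blast+
      then have "0 \<le> \<beta>" "0 \<le> \<gamma>" unfolding bg by simp_all
      have sum: "\<beta> + \<gamma> = X" unfolding bg by (simp flip: add_divide_distrib)
      have "\<beta> - \<gamma> = Y / L" unfolding bg by (simp flip: diff_divide_distrib)
      then have diff: "(\<beta> - \<gamma>) * L = Y" using YL by (cases "L = 0") simp_all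
      \<comment> \<open>The plane \<open>m \<bullet> y = 1\<close> is tangent to the unit ball, so
        the tetrahedron that it cuts off contains the part of the ball in question.\<close>
      have "t * C + X = m \<bullet> (z + t *\<^sub>R c)"
        unfolding cmu using mm m(2) by (simp add: inner_add_right defs inner_commute)
      also have "\<dots> \<le> norm m * norm (z + t *\<^sub>R c)" by (rule norm_cauchy_schwarz)
      finally have "t * C + \<beta> + \<gamma> \<le> 1" using t(2) m(1) sum by simp
      then have "(t * C) *\<^sub>R (c /\<^sub>R C) + \<beta> *\<^sub>R (m + L *\<^sub>R k) + \<gamma> *\<^sub>R (m - L *\<^sub>R k) \<in> M"
        using M(3) t(1) hC \<open>0 \<le> \<beta>\<close> \<open>0 \<le> \<gamma>\<close> by simp
      also have "(t * C) *\<^sub>R (c /\<^sub>R C) + \<beta> *\<^sub>R (m + L *\<^sub>R k) + \<gamma> *\<^sub>R (m - L *\<^sub>R k)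
        = (\<beta> + \<gamma>) *\<^sub>R m + ((\<beta> - \<gamma>) * L) *\<^sub>R k + t *\<^sub>R c"
        using hC by (simp add: algebra_simps)
      finally show "z + t *\<^sub>R c \<in> M" unfolding sum diff z_eq[symmetric] .
    qed
  qed
qed

section \<open>Counting the arcs of one circle\<close>

definition positive_part :: "(real^3) set \<Rightarrow> real^3 \<Rightarrow> (real^3) set" where
  "positive_part J z = {a \<in> J. 0 < a \<bullet> z}"

text \<open>These sets label the open arcs into which the circles of \<open>J\<close> cut the circle
  of \<open>u\<close>.\<close>

definition plane_patterns :: "real^3 \<Rightarrow> (real^3) set \<Rightarrow> (real^3) set set" where
  "plane_patterns u J = positive_part J ` {z. u \<bullet> z = 0 \<and> (\<forall>a\<in>J. a \<bullet> z \<noteq> 0)}"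

text \<open>Removing \<open>b\<close> is injective except that it identifies \<open>T\<close> with
  \<open>insert b T\<close> when both occur, and such \<open>T\<close> are counted by
  \<open>D\<close>. This is the deletion-restriction count for arrangements.\<close>

lemma card_le_card_image_diff_singleton:
  assumes "finite B" "finite D" "\<And>T. T \<in> A \<Longrightarrow> T - {b} \<in> B"
    and "\<And>T. b \<notin> T \<Longrightarrow> T \<in> A \<Longrightarrow> insert b T \<in> A \<Longrightarrow> T \<in> D"
  shows "card A \<le> card B + card D"
proof -
  define A0 A1 A2 where "A0 = {T \<in> A. b \<notin> T}" "A1 = {T \<in> A. b \<in> T}" "A2 = (\<lambda>T. T - {b}) ` A1"
  note defs = this
  have inj: "inj_on (\<lambda>T. T - {b}) A1" by (auto simp: defs inj_on_def)
  have sub: "A0 \<union> A2 \<subseteq> B" using assms(3) by (fastforce simp: defs)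
  then have fin: "finite A0" "finite A2" using assms(1) by (auto intro: finite_subset)
  have "A0 \<inter> A2 \<subseteq> D"
  proof
    fix T assume "T \<in> A0 \<inter> A2"
    then obtain T' where T: "b \<notin> T" "T \<in> A" "T' \<in> A" "b \<in> T'" "T = T' - {b}" by (auto simp: defs)
    from T(4,5) have "insert b T = T'" by blast
    with T(3) have "insert b T \<in> A" by simp
    with T(1,2) show "T \<in> D" by (rule assms(4))
  qed
  have "finite A1" using fin(2) inj by (simp add: defs(3) finite_image_iff)
  have "A = A0 \<union> A1" by (auto simp: defs)
  moreover have "A0 \<inter> A1 = {}" by (auto simp: defs)
  ultimately have "card A = card A0 + card A1" using fin(1) \<open>finite A1\<close> by (simp add: card_Un_disjoint)
  also have "card A1 = card A2" using inj by (simp add: defs(3) card_image)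
  also have "card A0 + card A2 = card (A0 \<union> A2) + card (A0 \<inter> A2)" using fin by (rule card_Un_Int)
  also have "\<dots> \<le> card B + card D"
    using sub \<open>A0 \<inter> A2 \<subseteq> D\<close> assms(1,2) by (intro add_mono card_mono)
  finally show ?thesis .
qed

text \<open>A new line through the origin splits only the (at most two) patterns that occur on it.\<close>

lemma card_plane_patterns:
  assumes "finite J" "J \<noteq> {}" "\<And>a. a \<in> J \<Longrightarrow> cross3 u a \<noteq> 0"
  shows "card (plane_patterns u J) \<le> 2 * card J"
  using assms
proof (induction J rule: finite_ne_induct)
  case (singleton b)
  have "plane_patterns u {b} \<subseteq> {{}, {b}}" by (auto simp: plane_patterns_def positive_part_def)
  then have "card (plane_patterns u {b}) \<le> card {{}, {b}}" by (intro card_mono) auto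
  also have "\<dots> \<le> 2" by simp
  finally show ?case by simp
next
  case (insert b J)
  define w where "w = cross3 u b"
  have "w \<noteq> 0" using insert.prems by (simp add: w_def)
  have "card (plane_patterns u (insert b J)) \<le> card (plane_patterns u J) + card {positive_part J w, positive_part J (- w)}"
  proof (rule card_le_card_image_diff_singleton)
    have "plane_patterns u J \<subseteq> Pow J" by (auto simp: plane_patterns_def positive_part_def)
    then show "finite (plane_patterns u J)" using insert.hyps(1) finite_subset by blast
  next
    fix T assume "T \<in> plane_patterns u (insert b J)"
    then obtain z where z: "u \<bullet> z = 0" "\<forall>a\<in>insert b J. a \<bullet> z \<noteq> 0" "T = positive_part (insert b J) z"
      by (auto simp: plane_patterns_def)
    have "T - {b} = positive_part J z" using z(3) insert.hyps(3) by (auto simp: positive_part_def)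
    then show "T - {b} \<in> plane_patterns u J" using z(1,2) by (auto simp: plane_patterns_def)
  next
    fix T assume T: "b \<notin> T" "T \<in> plane_patterns u (insert b J)" "insert b T \<in> plane_patterns u (insert b J)"
    obtain x where x: "u \<bullet> x = 0" "\<forall>a\<in>insert b J. a \<bullet> x \<noteq> 0" "T = positive_part (insert b J) x"
      using T(2) by (auto simp: plane_patterns_def)
    obtain y where y: "u \<bullet> y = 0" "\<forall>a\<in>insert b J. a \<bullet> y \<noteq> 0" "insert b T = positive_part (insert b J) y"
      using T(3) by (auto simp: plane_patterns_def)
    have bx: "b \<bullet> x < 0" using T(1) x(2,3) by (auto simp: positive_part_def linorder_neq_iff)
    have byp: "0 < b \<bullet> y" using y(3) by (auto simp: positive_part_def)
    have TJ: "a \<in> T \<longleftrightarrow> 0 < a \<bullet> x" "a \<in> T \<longleftrightarrow> 0 < a \<bullet> y" if "a \<in> J" for a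
      using that x(3) y(3) insert.hyps(3) by (auto simp: positive_part_def)
    have "T \<subseteq> J" using x(3) T(1) by (auto simp: positive_part_def)
    \<comment> \<open>Only the sign of \<open>b\<close> differs between \<open>x\<close> and
      \<open>y\<close>. The positive combination on which \<open>b\<close> vanishes keeps all other
      signs.\<close>
    define z where "z = (b \<bullet> y) *\<^sub>R x + (- (b \<bullet> x)) *\<^sub>R y"
    have z: "u \<bullet> z = 0" "b \<bullet> z = 0" using x(1) y(1) by (simp_all add: z_def inner_add_right inner_diff_right)
    have az: "a \<bullet> z = (b \<bullet> y) * (a \<bullet> x) + (- (b \<bullet> x)) * (a \<bullet> y)" for a
      by (simp add: z_def inner_add_right inner_diff_right)
    have zpos: "0 < a \<bullet> z" if "a \<in> T" for a
    proof -
      have "0 < a \<bullet> x" "0 < a \<bullet> y" using that TJ \<open>T \<subseteq> J\<close> by auto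
      then show ?thesis unfolding az using bx byp by (intro add_pos_pos mult_pos_pos) auto
    qed
    have zneg: "a \<bullet> z < 0" if "a \<in> J" "a \<notin> T" for a
    proof -
      have "a \<bullet> x < 0" "a \<bullet> y < 0" using that TJ[OF that(1)] x(2) y(2) by (auto simp: linorder_neq_iff)
      then show ?thesis unfolding az using bx byp by (intro add_neg_neg mult_pos_neg) auto
    qed
    have Tz: "T = positive_part J z"
      using \<open>T \<subseteq> J\<close> zpos zneg unfolding positive_part_def by (auto dest: order.asym)
    obtain a where "a \<in> J" using insert.hyps(2) by blast
    then have "a \<bullet> z \<noteq> 0" using zpos[of a] zneg[of a] by (cases "a \<in> T") auto
    then have zne: "z \<noteq> 0" by auto
    \<comment> \<open>Both \<open>z\<close> and \<open>w\<close> are orthogonal to the independent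
      vectors \<open>u\<close> and \<open>b\<close>, hence they are parallel, and the pattern of
      \<open>z\<close> is that of \<open>w\<close> or \<open>- w\<close>.\<close>
    have "cross3 z w = 0" using z by (simp add: w_def Lagrange inner_commute)
    then have "cross3 w (cross3 z w) = 0" by simp
    then have zw: "(w \<bullet> w) *\<^sub>R z = (w \<bullet> z) *\<^sub>R w" by (simp add: Lagrange)
    have "0 < w \<bullet> w" using \<open>w \<noteq> 0\<close> by simp
    have eq: "(w \<bullet> w) * (a \<bullet> z) = (w \<bullet> z) * (a \<bullet> w)" for a
      using arg_cong[OF zw, of "\<lambda>v. a \<bullet> v"] by simp
    have "w \<bullet> z \<noteq> 0" using zw \<open>0 < w \<bullet> w\<close> zne by auto
    have pos: "0 < a \<bullet> z \<longleftrightarrow> 0 < (w \<bullet> z) * (a \<bullet> w)" for a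
      unfolding eq[symmetric] zero_less_mult_iff using order.asym \<open>0 < w \<bullet> w\<close> by blast
    show "T \<in> {positive_part J w, positive_part J (- w)}"
      using \<open>w \<bullet> z \<noteq> 0\<close> unfolding Tz positive_part_def pos by (cases "w \<bullet> z > 0") (auto simp: zero_less_mult_iff)
  qed simp
  also have "card {positive_part J w, positive_part J (- w)} \<le> 2" by (simp add: card_insert_if)
  also have "card (plane_patterns u J) \<le> 2 * card J" using insert by simp
  finally show ?case using insert.hyps by simp
qed

section \<open>Covering the ball by pyramids\<close>

lemma negligible_span_2: 
  fixes a b :: "real^3"
  shows "negligible (span {a, b})"
proof (rule negligible_lowdim)
  have "dim (span {a, b}) \<le> card {a, b}" using dim_le_card[of "span {a, b}" "{a, b}"] by simp
  also have "\<dots> \<le> 2" by (simp add: card_insert_if)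
  finally show "dim (span {a, b}) < DIM(real^3)" by simp
qed

lemma cross3_annihilates:
  fixes u a z :: "real^3"
  assumes "cross3 u a \<noteq> 0" "u \<bullet> z = 0" "a \<bullet> z = 0"
  shows "z \<in> span {cross3 u a}"
proof -
  define w where "w = cross3 u a"
  have "cross3 z w = 0" using assms by (simp add: w_def Lagrange inner_commute)
  then have "cross3 w (cross3 z w) = 0" by simp
  then have "(w \<bullet> w) *\<^sub>R z = (w \<bullet> z) *\<^sub>R w" by (simp add: Lagrange)
  moreover have "w \<bullet> w \<noteq> 0" using assms(1) by (simp add: w_def)
  ultimately have "z = ((w \<bullet> z) / (w \<bullet> w)) *\<^sub>R w"
    by (metis divide_inverse_commute left_inverse scaleR_one scaleR_scaleR)
  then show ?thesis unfolding w_def by (metis span_base span_scale singletonI)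
qed

lemma coverable_volume_bound:
  assumes fin: "finite A" and card: "card A = n" "2 \<le> n"
    and unit: "\<And>a. a \<in> A \<Longrightarrow> norm a = 1"
    and indep: "\<And>a b. a \<in> A \<Longrightarrow> b \<in> A \<Longrightarrow> a \<noteq> b \<Longrightarrow> cross3 a b \<noteq> 0"
    and cov: "coverable A h" and h: "0 < h"
  shows "pi / (real n * (real n - 1)) \<le> (1 - h) / h"
proof -
  have "A \<noteq> {}" using card by auto
  then obtain a0 where a0: "a0 \<in> A" by blast
  have "a \<noteq> 0" if "a \<in> A" for a using unit[OF that] by auto
  then obtain x0 where x0: "\<forall>a\<in>A. a \<bullet> x0 \<noteq> 0"
    using generic_vector[OF fin subspace_UNIV] by (metis UNIV_I inner_eq_zero_iff)
  have "x0 \<noteq> 0" using x0 a0 by auto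
  have h1: "h \<le> 1"
  proof -
    obtain c where c: "norm c = 1" "\<And>y. (\<And>a. a \<in> A \<Longrightarrow> 0 \<le> (a \<bullet> x0) * (a \<bullet> y)) \<Longrightarrow> h * norm y \<le> c \<bullet> y"
      using coverableE[OF cov, of x0] x0 by blast
    have "h * norm x0 \<le> c \<bullet> x0" by (rule c(2)) simp
    also have "\<dots> \<le> 1 * norm x0" using norm_cauchy_schwarz[of c x0] c(1) by simp
    finally show ?thesis using \<open>x0 \<noteq> 0\<close> by (simp add: mult_le_cancel_right)
  qed
  define K where "K = (1 - h) / (3 * h)"
  have "0 \<le> K" using h h1 by (simp add: K_def)
  define good where "good S c \<longleftrightarrow> norm c = 1 \<and>
    (\<forall>y. (\<forall>a\<in>A. if a \<in> S then 0 \<le> a \<bullet> y else a \<bullet> y \<le> 0) \<longrightarrow> h * norm y \<le> c \<bullet> y)" for S c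
  \<comment> \<open>The center depends on the sign pattern only, not on a point of the cell, so that
    finitely many pyramids suffice.\<close>
  define cen where "cen S = (SOME c. good S c)" for S
  have cen: "good (positive_part A x) (cen (positive_part A x))" if x: "\<forall>a\<in>A. a \<bullet> x \<noteq> 0" for x
  proof -
    obtain c where c: "norm c = 1" "\<And>y. (\<And>a. a \<in> A \<Longrightarrow> 0 \<le> (a \<bullet> x) * (a \<bullet> y)) \<Longrightarrow> h * norm y \<le> c \<bullet> y"
      using coverableE[OF cov, of x] x by blast
    have "h * norm y \<le> c \<bullet> y"
      if "\<forall>a\<in>A. if a \<in> positive_part A x then 0 \<le> a \<bullet> y else a \<bullet> y \<le> 0" for y
    proof (rule c(2))
      fix a assume a: "a \<in> A"
      show "0 \<le> (a \<bullet> x) * (a \<bullet> y)"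
      proof (cases "0 < a \<bullet> x")
        case True
        then have "0 \<le> a \<bullet> y" using bspec[OF that a] a by (simp add: positive_part_def)
        then show ?thesis using True by simp
      next
        case False
        then have "a \<bullet> y \<le> 0" using bspec[OF that a] a by (simp add: positive_part_def)
        then show ?thesis using False by (simp add: mult_nonpos_nonpos)
      qed
    qed
    then have "good (positive_part A x) c" using c(1) by (simp add: good_def)
    then show ?thesis unfolding cen_def by (rule someI)
  qed
  \<comment> \<open>The unit length of \<open>c\<close> and \<open>u\<close> is a premise inside the
    predicate, so a witness exists for all arguments and \<open>M\<close> can be chosen as a total
    function.\<close>
  define pyr where "pyr c u M \<longleftrightarrow> (norm c = 1 \<and> norm u = 1 \<longrightarrow> M \<in> lmeasurable \<and> measure lebesgue M \<le> K \<and>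
    (\<forall>z t. u \<bullet> z = 0 \<longrightarrow> h * norm z \<le> c \<bullet> z \<longrightarrow> 0 \<le> t \<longrightarrow> norm (z + t *\<^sub>R c) \<le> 1 \<longrightarrow> z + t *\<^sub>R c \<in> M))"
    for c u :: "real^3" and M
  have ex: "\<exists>M. pyr c u M" for c u
  proof (cases "norm c = 1 \<and> norm u = 1")
    case True
    then have "norm c = 1" "norm u = 1" by simp_all
    then show ?thesis
    proof (rule facet_pyramid_volume[OF _ _ h h1])
      fix M assume M: "M \<in> lmeasurable" "measure lebesgue M \<le> (1 - h) / (3 * h)"
        "\<And>z t. u \<bullet> z = 0 \<Longrightarrow> h * norm z \<le> c \<bullet> z \<Longrightarrow> 0 \<le> t \<Longrightarrow> norm (z + t *\<^sub>R c) \<le> 1 \<Longrightarrow> z + t *\<^sub>R c \<in> M"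
      then have "pyr c u M" by (simp add: pyr_def K_def)
      then show ?thesis by blast
    qed
  qed (auto simp: pyr_def)
  define M where "M c u = (SOME M. pyr c u M)" for c u
  have "pyr c u (M c u)" for c u unfolding M_def by (rule someI_ex[OF ex])
  then have M: "norm c = 1 \<and> norm u = 1 \<longrightarrow> M c u \<in> lmeasurable \<and> measure lebesgue (M c u) \<le> K \<and>
    (\<forall>z t. u \<bullet> z = 0 \<longrightarrow> h * norm z \<le> c \<bullet> z \<longrightarrow> 0 \<le> t \<longrightarrow> norm (z + t *\<^sub>R c) \<le> 1 \<longrightarrow> z + t *\<^sub>R c \<in> M c u)" for c u
    by (simp only: pyr_def)
  \<comment> \<open>A flag is a circle, one of its arcs, and the side on which the cell lies. With
    at most \<open>2 * (n - 1)\<close> arcs per circle this gives at most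
    \<open>4 * n * (n - 1)\<close> flags.\<close>
  define flags where "flags = (SIGMA u:A. plane_patterns u (A - {u}) \<times> (UNIV :: bool set))"
  \<comment> \<open>For a pattern not realized by a cell, \<open>cen\<close> may be arbitrary. The
    empty set keeps the volume estimate valid in that case.\<close>
  define piece where "piece = (\<lambda>(u, T, b). let S = (if b then insert u T else T) in
    if norm (cen S) = 1 then M (cen S) u else {})"
  have finp: "finite (plane_patterns u (A - {u}))" for u
  proof (rule finite_subset)
    show "plane_patterns u (A - {u}) \<subseteq> Pow A" by (auto simp: plane_patterns_def positive_part_def)
  qed (use fin in simp)
  have finf: "finite flags" unfolding flags_def using fin finp by (intro finite_SigmaI finite_cartesian_product) simp_all
  have "card flags = (\<Sum>u\<in>A. card (plane_patterns u (A - {u}) \<times> (UNIV :: bool set)))"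
    unfolding flags_def using fin finp by (intro card_SigmaI) auto
  also have "\<dots> \<le> (\<Sum>u\<in>A. 4 * (n - 1))"
  proof (rule sum_mono)
    fix u assume u: "u \<in> A"
    have cu: "card (A - {u}) = n - 1" using u fin card(1) by simp
    have "card (plane_patterns u (A - {u})) \<le> 2 * card (A - {u})"
    proof (rule card_plane_patterns)
      have "card (A - {u}) \<noteq> 0" using cu card(2) by linarith
      then show "A - {u} \<noteq> {}" using card.empty by metis
    qed (use u fin indep in auto)
    then show "card (plane_patterns u (A - {u}) \<times> (UNIV :: bool set)) \<le> 4 * (n - 1)"
      unfolding cu by (simp add: card_cartesian_product)
  qed
  also have "\<dots> = 4 * n * (n - 1)" by (simp add: card(1))
  finally have "real (card flags) \<le> real (4 * n * (n - 1))" by (rule of_nat_mono)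
  also have "\<dots> = 4 * real n * (real n - 1)" using card(2) by (simp add: of_nat_diff)
  finally have cf: "real (card flags) \<le> 4 * real n * (real n - 1)" .
  \<comment> \<open>Excluded are the points on the planes and those whose ray from the center leaves
    the cell through an edge. The latter lie in a plane spanned by a center and an edge direction
    \<open>cross3 u a\<close>.\<close>
  define Z where "Z = (\<Union>u\<in>A. {y. u \<bullet> y = 0}) \<union> (\<Union>(S, u, a)\<in>Pow A \<times> A \<times> A. span {cen S, cross3 u a})"
  have "negligible Z" unfolding Z_def
  proof (intro negligible_Un negligible_Union finite_imageI; (clarsimp)?)
    fix u assume "u \<in> A"
    then have "u \<noteq> 0" using unit[of u] by auto
    then show "negligible {y. u \<bullet> y = 0}" by (simp add: negligible_hyperplane)
  qed (use fin negligible_span_2 in auto)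
  have cover: "cball 0 1 \<subseteq> Z \<union> (\<Union>f\<in>flags. piece f)"
  proof
    fix y :: "real^3" assume y1: "y \<in> cball 0 1"
    show "y \<in> Z \<union> (\<Union>f\<in>flags. piece f)"
    proof (cases "y \<in> Z")
      case False
      then have gen: "\<forall>a\<in>A. a \<bullet> y \<noteq> 0" by (auto simp: Z_def)
      define S where "S = positive_part A y"
      define c where "c = cen S"
      have "S \<subseteq> A" by (auto simp: S_def positive_part_def)
      have c1: "norm c = 1" using cen[OF gen] by (simp add: good_def c_def S_def)
      have closed: "h * norm v \<le> c \<bullet> v" if v: "\<forall>a\<in>A. 0 \<le> (a \<bullet> y) * (a \<bullet> v)" for v
      proof -
        have "\<forall>a\<in>A. if a \<in> S then 0 \<le> a \<bullet> v else a \<bullet> v \<le> 0"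
        proof
          fix a assume a: "a \<in> A"
          then show "if a \<in> S then 0 \<le> a \<bullet> v else a \<bullet> v \<le> 0"
            using bspec[OF v a] bspec[OF gen a] by (auto simp: S_def positive_part_def zero_le_mult_iff)
        qed
        then show ?thesis using cen[OF gen] by (simp add: good_def c_def S_def)
      qed
      \<comment> \<open>Follow the ray from \<open>c\<close> through \<open>y\<close> until it leaves the cell, at a multiple of \<open>z\<close>.\<close>
      define B where "B = {a \<in> A. 0 < (a \<bullet> y) * (a \<bullet> c)}"
      \<comment> \<open>Otherwise \<open>y - t *\<^sub>R c\<close> would stay in the closed cell for
        all \<open>t \<ge> 0\<close>, although its product with \<open>c\<close> becomes
        negative.\<close>
      have "B \<noteq> {}"
      proof
        assume "B = {}"
        define t where "t = \<bar>c \<bullet> y\<bar> + 1"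
        have "h * norm (y - t *\<^sub>R c) \<le> c \<bullet> (y - t *\<^sub>R c)"
        proof (rule closed, rule ballI)
          fix a assume "a \<in> A"
          then have "(a \<bullet> y) * (a \<bullet> c) \<le> 0" using \<open>B = {}\<close> by (auto simp: B_def)
          moreover have "0 \<le> t" by (simp add: t_def)
          ultimately have "t * ((a \<bullet> y) * (a \<bullet> c)) \<le> 0" by (rule_tac mult_nonneg_nonpos)
          moreover have "0 \<le> (a \<bullet> y) * (a \<bullet> y)" by simp
          moreover have "(a \<bullet> y) * (a \<bullet> (y - t *\<^sub>R c)) = (a \<bullet> y) * (a \<bullet> y) - t * ((a \<bullet> y) * (a \<bullet> c))"
            by (simp add: inner_diff_right algebra_simps)
          ultimately show "0 \<le> (a \<bullet> y) * (a \<bullet> (y - t *\<^sub>R c))" by linarith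
        qed
        moreover have "c \<bullet> c = 1" using c1 by (simp add: dot_square_norm)
        ultimately have "h * norm (y - t *\<^sub>R c) \<le> c \<bullet> y - t" by (simp add: inner_diff_right)
        moreover have "0 \<le> h * norm (y - t *\<^sub>R c)" using h by simp
        ultimately show False by (simp add: t_def)
      qed
      have finB: "finite B" using fin by (simp add: B_def)
      \<comment> \<open>The smallest ratio belongs to the first plane that is reached from
        \<open>y\<close> in the direction \<open>- c\<close>; its normal is
        \<open>u\<close>.\<close>
      define t where "t = Min ((\<lambda>a. (a \<bullet> y) / (a \<bullet> c)) ` B)"
      have "t \<in> (\<lambda>a. (a \<bullet> y) / (a \<bullet> c)) ` B" unfolding t_def using finB \<open>B \<noteq> {}\<close> by (intro Min_in) auto
      then obtain u where u: "u \<in> B" "t = (u \<bullet> y) / (u \<bullet> c)" by blast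
      have tle: "t \<le> (a \<bullet> y) / (a \<bullet> c)" if "a \<in> B" for a
        unfolding t_def using finB that by (intro Min_le) auto
      have uA: "u \<in> A" and uc: "u \<bullet> c \<noteq> 0" using u(1) by (auto simp: B_def)
      have t0: "0 \<le> t" using u by (auto simp: B_def zero_less_mult_iff zero_le_divide_iff)
      define z where "z = y - t *\<^sub>R c"
      have yz: "y = z + t *\<^sub>R c" by (simp add: z_def)
      have uz: "u \<bullet> z = 0" using uc u(2) by (simp add: z_def inner_diff_right)
      have az: "0 \<le> (a \<bullet> y) * (a \<bullet> z)" if a: "a \<in> A" for a
      proof (cases "a \<in> B")
        case True
        then have p: "0 < (a \<bullet> y) * (a \<bullet> c)" by (simp add: B_def)
        then have "a \<bullet> c \<noteq> 0" by auto
        then have "(a \<bullet> y) * (a \<bullet> z) = ((a \<bullet> y) * (a \<bullet> c)) * ((a \<bullet> y) / (a \<bullet> c) - t)"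
          by (simp add: z_def inner_diff_right field_simps)
        moreover have "0 \<le> (a \<bullet> y) / (a \<bullet> c) - t" using tle[OF True] by simp
        ultimately show ?thesis using mult_nonneg_nonneg[OF less_imp_le[OF p]] by metis
      next
        case False
        then have "(a \<bullet> y) * (a \<bullet> c) \<le> 0" using a by (auto simp: B_def)
        then have "t * ((a \<bullet> y) * (a \<bullet> c)) \<le> 0" using t0 by (rule_tac mult_nonneg_nonpos)
        moreover have "0 \<le> (a \<bullet> y) * (a \<bullet> y)" by simp
        moreover have "(a \<bullet> y) * (a \<bullet> z) = (a \<bullet> y) * (a \<bullet> y) - t * ((a \<bullet> y) * (a \<bullet> c))"
          by (simp add: z_def inner_diff_right algebra_simps)
        ultimately show ?thesis by linarith
      qed
      have anz: "a \<bullet> z \<noteq> 0" if a: "a \<in> A - {u}" for a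
      proof
        assume "a \<bullet> z = 0"
        then have "z \<in> span {cross3 u a}" using cross3_annihilates indep uA uz a by auto
        then have "z \<in> span {c, cross3 u a}" by (rule subsetD[OF span_mono, rotated]) auto
        then have "y \<in> span {c, cross3 u a}" unfolding yz by (intro span_add span_scale) (auto intro: span_base)
        then have "y \<in> Z" unfolding Z_def c_def using \<open>S \<subseteq> A\<close> uA a by blast
        then show False using False by blast
      qed
      \<comment> \<open>Away from the plane of \<open>u\<close>, the exit point \<open>z\<close> has
        the signs of \<open>y\<close>. Thus the arc containing \<open>z\<close> and the side of
        \<open>y\<close> recover the whole pattern \<open>S\<close>.\<close>
      have pp: "positive_part (A - {u}) z = S - {u}"
      proof -
        have "0 < a \<bullet> z \<longleftrightarrow> 0 < a \<bullet> y" if "a \<in> A - {u}" for a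
          using az[of a] anz[OF that] gen that by (auto simp: zero_le_mult_iff)
        then show ?thesis by (auto simp: positive_part_def S_def)
      qed
      have "S - {u} \<in> plane_patterns u (A - {u})"
        unfolding plane_patterns_def pp[symmetric] using uz anz by blast
      then have flag: "(u, S - {u}, u \<in> S) \<in> flags" using uA by (simp add: flags_def)
      have Seq: "(if u \<in> S then insert u (S - {u}) else S - {u}) = S" by auto
      have "piece (u, S - {u}, u \<in> S) = M c u"
        unfolding piece_def Let_def using c1 by (simp add: Seq c_def insert_absorb)
      moreover have "y \<in> M c u"
      proof -
        have "h * norm z \<le> c \<bullet> z" using closed az by blast
        moreover have "norm (z + t *\<^sub>R c) \<le> 1" using y1 unfolding yz[symmetric] by simp
        ultimately have "z + t *\<^sub>R c \<in> M c u" using M[of c u] c1 unit[OF uA] uz t0 by blast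
        then show ?thesis unfolding yz[symmetric] .
      qed
      ultimately show ?thesis using flag by blast
    qed simp
  qed
  have piece: "piece f \<in> lmeasurable" "measure lebesgue (piece f) \<le> K" if f: "f \<in> flags" for f
  proof -
    obtain u T b where f': "f = (u, T, b)" by (cases f)
    then have "u \<in> A" using f by (auto simp: flags_def)
    then have "piece f \<in> lmeasurable \<and> measure lebesgue (piece f) \<le> K"
      using M[of "cen (if b then insert u T else T)" u] unit[of u] \<open>0 \<le> K\<close> unfolding f' piece_def Let_def by simp
    then show "piece f \<in> lmeasurable" "measure lebesgue (piece f) \<le> K" by blast+
  qed
  have Um: "(\<Union>f\<in>flags. piece f) \<in> lmeasurable" using finf piece by (intro fmeasurable.finite_UN) auto
  have Zm: "Z \<in> lmeasurable" "measure lebesgue Z = 0"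
    using \<open>negligible Z\<close> by (rule negligible_imp_measurable, rule negligible_imp_measure0)
  have "4 / 3 * pi = measure lebesgue (cball (0::real^3) 1)"
    by (simp add: content_cball unit_ball_vol_3)
  also have "\<dots> \<le> measure lebesgue (Z \<union> (\<Union>f\<in>flags. piece f))"
    using cover Um Zm by (intro measure_mono_fmeasurable fmeasurable.Un) auto
  also have "\<dots> \<le> measure lebesgue Z + measure lebesgue (\<Union>f\<in>flags. piece f)"
    using Um Zm by (intro measure_Un_le) auto
  also have "\<dots> \<le> (\<Sum>f\<in>flags. measure lebesgue (piece f))"
    unfolding Zm(2) using finf piece by (simp add: measure_UNION_le fmeasurableD)
  also have "\<dots> \<le> real (card flags) * K" using piece(2) by (rule sum_bounded_above)
  also have "\<dots> \<le> 4 * real n * (real n - 1) * K" using cf \<open>0 \<le> K\<close> by (rule mult_right_mono)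
  also have "\<dots> = 4 / 3 * (real n * (real n - 1) * ((1 - h) / h))" by (simp add: K_def)
  finally have "pi \<le> real n * (real n - 1) * ((1 - h) / h)" by (rule mult_left_le_imp_le) simp
  moreover have "0 < real n * (real n - 1)" using card(2) by simp
  ultimately show ?thesis by (simp add: divide_le_eq mult.commute)
qed

section \<open>The grid arrangement\<close>

text \<open>The argument of the tangent is \<open>pi / 4 + \<eta>\<close>, so the addition formula
  turns the bound into \<open>(1 - \<tau>) / (1 + \<tau>)\<close> with
  \<open>\<tau> = tan \<eta>\<close>. The second conclusion keeps the argument of
  \<open>arccos\<close> in its domain.\<close>

lemma volume_bound_imp_tan_bound:
  assumes n: "4 \<le> n" and h: "0 \<le> h" "0 < h \<Longrightarrow> pi / (real n * (real n - 1)) \<le> (1 - h) / h"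
  shows "h \<le> 1 / tan ((1 + 2 / ((real n)\<^sup>2 - real n + 2)) * (pi / 4))"
    and "1 / tan ((1 + 2 / ((real n)\<^sup>2 - real n + 2)) * (pi / 4)) \<le> 1"
proof -
  define N where "N = (real n)\<^sup>2 - real n + 2"
  define \<eta> where "\<eta> = pi / (2 * N)"
  define \<tau> where "\<tau> = tan \<eta>"
  have "4 * 3 \<le> real n * (real n - 1)" using n by (intro mult_mono) auto
  then have N: "14 \<le> N" by (simp add: N_def power2_eq_square algebra_simps)
  have pi: "pi < 16 / 5" "3 \<le> pi" using pi_approx by auto
  have \<eta>0: "0 < \<eta>" using N by (simp add: \<eta>_def)
  have "\<eta> \<le> pi / (2 * 14)" unfolding \<eta>_def using N by (intro divide_left_mono) auto
  then have \<eta>1: "\<eta> \<le> pi / 28" by simp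
  have "sin (\<eta> / 2) \<le> \<eta> / 2" using \<eta>0 by (intro sin_x_le_x) simp
  moreover have "0 \<le> sin (\<eta> / 2)" using \<eta>0 \<eta>1 pi by (intro sin_ge_zero) simp_all
  ultimately have "(sin (\<eta> / 2))\<^sup>2 \<le> (\<eta> / 2)\<^sup>2" by (rule power_mono)
  then have cos: "1 - \<eta>\<^sup>2 / 2 \<le> cos \<eta>" using cos_double_sin[of "\<eta> / 2"] by (simp add: power_divide)
  have "\<eta> \<le> 1 / 5" using \<eta>1 pi by simp
  then have "\<eta>\<^sup>2 \<le> (1 / 5)\<^sup>2" using \<eta>0 by (intro power_mono) auto
  then have c0: "0 < 1 - \<eta>\<^sup>2 / 2" "0 < cos \<eta>" using cos by (simp_all add: power2_eq_square)
  have "\<tau> \<le> \<eta> / cos \<eta>" unfolding \<tau>_def tan_def using c0 \<eta>0 by (intro divide_right_mono sin_x_le_x) auto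
  also have "\<dots> \<le> \<eta> / (1 - \<eta>\<^sup>2 / 2)" using c0 \<eta>0 cos by (intro divide_left_mono) auto
  finally have \<tau>le: "\<tau> * (1 - \<eta>\<^sup>2 / 2) \<le> \<eta>" using c0 by (simp add: pos_le_divide_eq)
  have "0 < \<tau>" unfolding \<tau>_def using \<eta>0 \<eta>1 pi by (intro tan_gt_zero) auto
  \<comment> \<open>The inequality \<open>main\<close> is equivalent to
    \<open>\<tau> * (pi - (4 - pi) * \<eta>) \<le> pi * \<eta>\<close>. As \<open>\<tau>\<close>
    exceeds \<open>\<eta>\<close> only to third order, the second-order gain
    \<open>4 - pi > 0\<close> absorbs the error for small \<open>\<eta>\<close>.\<close>
  have "pi * \<eta> \<le> 16 / 5 * (1 / 5)" using pi \<eta>0 \<open>\<eta> \<le> 1 / 5\<close> by (intro mult_mono) auto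
  then have "pi * \<eta> / 2 \<le> 4 - pi" using pi by simp
  then have "\<eta> * (pi * \<eta> / 2) \<le> \<eta> * (4 - pi)" using \<eta>0 by (intro mult_left_mono) auto
  then have "pi - (4 - pi) * \<eta> \<le> pi * (1 - \<eta>\<^sup>2 / 2)" by (simp add: power2_eq_square algebra_simps)
  then have "\<tau> * (pi - (4 - pi) * \<eta>) \<le> \<tau> * (pi * (1 - \<eta>\<^sup>2 / 2))"
    using \<open>0 < \<tau>\<close> by (intro mult_left_mono) auto
  also have "\<dots> = pi * (\<tau> * (1 - \<eta>\<^sup>2 / 2))" by simp
  also have "\<dots> \<le> pi * \<eta>" using \<tau>le by (intro mult_left_mono) auto
  finally have main: "\<tau> * (pi - 4 * \<eta>) \<le> pi * \<eta> * (1 - \<tau>)" by (simp add: algebra_simps)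
  have "(4 / 5) * \<tau> \<le> \<tau> * (1 - \<eta>\<^sup>2 / 2)"
    using \<open>0 < \<tau>\<close> \<open>\<eta>\<^sup>2 \<le> (1 / 5)\<^sup>2\<close> by (simp add: power2_eq_square)
  then have "(4 / 5) * \<tau> \<le> \<eta>" using \<tau>le by (rule order_trans)
  then have \<tau>1: "\<tau> < 1" using \<open>\<eta> \<le> 1 / 5\<close> by simp
  have cos4: "cos (pi / 4 + \<eta>) \<noteq> 0"
  proof -
    have "0 < cos (pi / 4 + \<eta>)" using \<eta>0 \<eta>1 pi by (intro cos_gt_zero) auto
    then show ?thesis by simp
  qed
  have "(1 + 2 / N) * (pi / 4) = pi / 4 + \<eta>" by (simp add: \<eta>_def algebra_simps)
  moreover have "tan (pi / 4 + \<eta>) = (1 + \<tau>) / (1 - \<tau>)"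
    using cos4 c0 by (subst tan_add) (simp_all add: tan_45 \<tau>_def cos_45)
  ultimately have "tan ((1 + 2 / N) * (pi / 4)) = (1 + \<tau>) / (1 - \<tau>)" by (simp only:)
  then have eq: "1 / tan ((1 + 2 / N) * (pi / 4)) = (1 - \<tau>) / (1 + \<tau>)" by (simp only:) simp
  have "h \<le> (1 - \<tau>) / (1 + \<tau>)"
  proof (cases "h = 0")
    case True
    then show ?thesis using \<tau>1 \<open>0 < \<tau>\<close> by simp
  next
    case False
    then have h0: "0 < h" using h(1) by simp
    have "real n * (real n - 1) = N - 2" by (simp add: N_def power2_eq_square algebra_simps)
    then have "pi / (N - 2) \<le> (1 - h) / h" using h(2)[OF h0] by simp
    moreover have "0 < N - 2" using N by simp
    ultimately have "pi * h \<le> (1 - h) * (N - 2)" using h0 by (simp add: field_simps)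
    moreover have N\<eta>: "(N - 2) * (2 * \<eta>) = pi - 4 * \<eta>" using N by (simp add: \<eta>_def field_simps)
    moreover have "0 \<le> 2 * \<eta>" using \<eta>0 by simp
    ultimately have "pi * h * (2 * \<eta>) \<le> (1 - h) * (N - 2) * (2 * \<eta>)"
      by (rule_tac mult_right_mono)
    then have "pi * h * (2 * \<eta>) \<le> (1 - h) * (pi - 4 * \<eta>)" by (simp only: mult.assoc N\<eta>)
    then have "\<tau> * (pi * h * (2 * \<eta>)) \<le> \<tau> * ((1 - h) * (pi - 4 * \<eta>))"
      using \<open>0 < \<tau>\<close> by (intro mult_left_mono) auto
    also have "\<dots> = (1 - h) * (\<tau> * (pi - 4 * \<eta>))" by simp
    also have "\<dots> \<le> (1 - h) * (pi * \<eta> * (1 - \<tau>))"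
    proof (rule mult_left_mono[OF main])
      have "0 \<le> pi / (N - 2)" using \<open>0 < N - 2\<close> by simp
      then have "0 \<le> (1 - h) / h" using \<open>pi / (N - 2) \<le> (1 - h) / h\<close> by linarith
      then show "0 \<le> 1 - h" using h0 by (simp add: zero_le_divide_iff)
    qed
    finally have "(pi * \<eta>) * (2 * \<tau> * h) \<le> (pi * \<eta>) * ((1 - h) * (1 - \<tau>))" by (simp add: algebra_simps)
    then have "2 * \<tau> * h \<le> (1 - h) * (1 - \<tau>)"
      using \<eta>0 by (simp add: mult_le_cancel_left)
    then show ?thesis using \<open>0 < \<tau>\<close> by (simp add: pos_le_divide_eq algebra_simps)
  qed
  then show "h \<le> 1 / tan ((1 + 2 / ((real n)\<^sup>2 - real n + 2)) * (pi / 4))"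
    unfolding eq[unfolded N_def] .
  show "1 / tan ((1 + 2 / ((real n)\<^sup>2 - real n + 2)) * (pi / 4)) \<le> 1"
    unfolding eq[unfolded N_def] using \<open>0 < \<tau>\<close> by (simp add: divide_le_eq)
qed

section \<open>Cells of the grid\<close>

text \<open>The Gram determinant of \<open>x\<close>, \<open>y\<close> equals that of
  \<open>x - y\<close>, \<open>y\<close>, which bounds the sine of the angle between
  \<open>x\<close> and \<open>y\<close> by their distance when both norms are at least 1.\<close>

lemma inner_ge_of_close:
  fixes x y :: "'a::real_inner"
  assumes x: "1 \<le> norm x" and y: "1 \<le> norm y" and d: "(norm (x - y))\<^sup>2 \<le> \<delta>" "\<delta> \<le> 1"
  shows "sqrt (1 - \<delta>) * (norm x * norm y) \<le> x \<bullet> y"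
proof -
  have x1: "1 \<le> (norm x)\<^sup>2" and y1: "1 \<le> (norm y)\<^sup>2" using x y by (simp_all add: one_le_power)
  have expand: "(norm (x - y))\<^sup>2 = (norm x)\<^sup>2 + (norm y)\<^sup>2 - 2 * (x \<bullet> y)"
    unfolding power2_norm_eq_inner by (simp add: inner_diff_left inner_diff_right inner_commute)
  have pos: "0 \<le> x \<bullet> y" using expand d x1 y1 by linarith
  have cs: "(norm (x - y))\<^sup>2 * (norm y)\<^sup>2 - ((x - y) \<bullet> y)\<^sup>2 = (norm x)\<^sup>2 * (norm y)\<^sup>2 - (x \<bullet> y)\<^sup>2"
    unfolding power2_norm_eq_inner
    by (simp add: inner_diff_left inner_diff_right inner_commute power2_eq_square algebra_simps)
  have "(norm x)\<^sup>2 * (norm y)\<^sup>2 - (x \<bullet> y)\<^sup>2 \<le> (norm (x - y))\<^sup>2 * (norm y)\<^sup>2"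
    unfolding cs[symmetric] by simp
  also have "\<dots> \<le> \<delta> * (norm y)\<^sup>2" using d(1) by (intro mult_right_mono) auto
  also have "\<dots> \<le> \<delta> * ((norm x)\<^sup>2 * (norm y)\<^sup>2)"
  proof (rule mult_left_mono)
    show "(norm y)\<^sup>2 \<le> (norm x)\<^sup>2 * (norm y)\<^sup>2"
      using mult_right_mono[OF x1, of "(norm y)\<^sup>2"] by simp
    show "0 \<le> \<delta>" using d(1) by (meson order_trans zero_le_power2)
  qed
  finally have "(1 - \<delta>) * ((norm x)\<^sup>2 * (norm y)\<^sup>2) \<le> (x \<bullet> y)\<^sup>2" by (simp add: algebra_simps)
  moreover have "(sqrt (1 - \<delta>) * (norm x * norm y))\<^sup>2 = (1 - \<delta>) * ((norm x)\<^sup>2 * (norm y)\<^sup>2)"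
    using d(2) by (simp add: power_mult_distrib)
  ultimately have "(sqrt (1 - \<delta>) * (norm x * norm y))\<^sup>2 \<le> (x \<bullet> y)\<^sup>2" by (simp only:)
  then show ?thesis using pos by (rule power2_le_imp_le)
qed

text \<open>The indices \<open>0\<close> and \<open>k\<close> give the planes through the origin and
  opposite edges of the cube, which separate its faces; the others rule the faces.\<close>

definition grid_normals :: "nat \<Rightarrow> (real^3) set" where
  "grid_normals k = (\<lambda>(a, b, j). axis a 1 - (2 * real j / real k - 1) *\<^sub>R axis b 1) ` {(a, b, j). a \<noteq> b \<and> j \<le> k}"

lemma grid_normals_finite_card: "finite (grid_normals k)" "card (grid_normals k) \<le> 9 * (k + 1)"
proof -
  let ?I = "{(a, b, j). a \<noteq> b \<and> j \<le> k} :: (3 \<times> 3 \<times> nat) set"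
  have sub: "?I \<subseteq> UNIV \<times> UNIV \<times> {..k}" by auto
  then have fin: "finite ?I" by (rule finite_subset) simp
  then show "finite (grid_normals k)" by (simp add: grid_normals_def)
  have "card (grid_normals k) \<le> card ?I" unfolding grid_normals_def using fin by (rule card_image_le)
  also have "\<dots> \<le> card ((UNIV :: 3 set) \<times> (UNIV :: 3 set) \<times> {..k})" using sub by (intro card_mono) simp_all
  finally show "card (grid_normals k) \<le> 9 * (k + 1)" by (simp add: card_cartesian_product)
qed

lemma grid_normalsI:
  assumes "a \<noteq> b" "j \<le> k"
  shows "axis a 1 - (2 * real j / real k - 1) *\<^sub>R axis b 1 \<in> grid_normals k"
  unfolding grid_normals_def using assms by (intro image_eqI[of _ _ "(a, b, j)"]) auto

lemma zero_notin_grid_normals: "0 \<notin> grid_normals k"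
proof
  assume "0 \<in> grid_normals k"
  then obtain a b j where "a \<noteq> b" and *: "0 = axis a 1 - (2 * real j / real k - 1) *\<^sub>R (axis b 1 :: real^3)"
    unfolding grid_normals_def image_iff by (auto simp del: right_minus_eq)
  from arg_cong[OF *, of "\<lambda>v. v $ a"] \<open>a \<noteq> b\<close> show False by (simp add: axis_def)
qed

text \<open>Any point \<open>x\<close> of the cell can serve as center. Scaled to the same face of
  the cube, all points of the cell lie in one grid square of side \<open>2 / k\<close>, so the sine
  of their angle with \<open>x\<close> is at most \<open>sqrt 12 / k\<close>.\<close>

lemma coverable_grid:
  assumes k: "0 < k" "12 / (real k)\<^sup>2 \<le> 1"
  shows "coverable (grid_normals k) (sqrt (1 - 12 / (real k)\<^sup>2))"
  unfolding coverable_def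
proof (intro allI impI)
  fix x assume x: "\<forall>e\<in>grid_normals k. e \<bullet> x \<noteq> 0"
  have dot: "(axis a 1 - t *\<^sub>R axis b 1) \<bullet> z = z $ a - t * z $ b" for a b t and z :: "real^3"
    by (simp add: inner_diff_left inner_axis')
  obtain b where b: "\<And>a. \<bar>x $ a\<bar> \<le> \<bar>x $ b\<bar>"
  proof -
    have "Max (range (\<lambda>a. \<bar>x $ a\<bar>)) \<in> range (\<lambda>a. \<bar>x $ a\<bar>)" by (intro Max_in) auto
    then obtain b where b: "Max (range (\<lambda>a. \<bar>x $ a\<bar>)) = \<bar>x $ b\<bar>" by blast
    show ?thesis
    proof (rule that)
      show "\<bar>x $ a\<bar> \<le> \<bar>x $ b\<bar>" for a unfolding b[symmetric] by (intro Max_ge) auto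
    qed
  qed
  have "x \<noteq> 0"
  proof
    assume "x = 0"
    moreover have "axis 1 1 - (2 * real 0 / real k - 1) *\<^sub>R axis 2 1 \<in> grid_normals k"
      by (rule grid_normalsI) auto
    ultimately show False using x by force
  qed
  then have xb: "x $ b \<noteq> 0" using b by (auto simp: vec_eq_iff)
  have "sqrt (1 - 12 / (real k)\<^sup>2) * norm y \<le> (x /\<^sub>R norm x) \<bullet> y"
    if y: "\<forall>e\<in>grid_normals k. 0 < (e \<bullet> x) * (e \<bullet> y)" for y
  proof -
    have sep: "0 < (x $ a - (2 * real j / real k - 1) * x $ b) * (y $ a - (2 * real j / real k - 1) * y $ b)"
      if "a \<noteq> b" "j \<le> k" for a j
      using bspec[OF y grid_normalsI[OF that]] by (simp add: dot)
    \<comment> \<open>The signs of \<open>x $ a0 + x $ b\<close> and \<open>x $ a0 - x $ b\<close>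
      reveal the sign of the larger coordinate \<open>x $ b\<close>, so \<open>y $ b\<close> has the
      same sign and \<open>y\<close> belongs to the same face.\<close>
    have "1 \<noteq> b \<or> 2 \<noteq> b" by auto
    then obtain a0 where a0: "a0 \<noteq> b" by blast
    have s0: "0 < (x $ a0 + x $ b) * (y $ a0 + y $ b)" using sep[OF a0, of 0] by simp
    have s1: "0 < (x $ a0 - x $ b) * (y $ a0 - y $ b)" using sep[OF a0, of k] k(1) by simp
    have xyb: "0 < x $ b * y $ b"
      using s0 s1 b[of a0] xb unfolding zero_less_mult_iff by (auto simp: abs_if split: if_splits)
    then have yb: "y $ b \<noteq> 0" by auto
    define X Y where "X = x /\<^sub>R x $ b" "Y = y /\<^sub>R y $ b"
    note XY = this
    have Xb: "X $ b = 1" "Y $ b = 1" using xb yb by (simp_all add: XY)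
    have close: "\<bar>X $ a - Y $ a\<bar> \<le> 2 / real k" for a
    proof (cases "a = b")
      case False
      have s: "0 < (X $ a - (2 * real j / real k - 1)) * (Y $ a - (2 * real j / real k - 1))" if "j \<le> k" for j
      proof -
        have "(x $ a - (2 * real j / real k - 1) * x $ b) * (y $ a - (2 * real j / real k - 1) * y $ b)
          = (x $ b * y $ b) * ((X $ a - (2 * real j / real k - 1)) * (Y $ a - (2 * real j / real k - 1)))"
          using xb yb by (simp add: XY field_simps)
        with sep[OF False that] have "0 < (x $ b * y $ b) * ((X $ a - (2 * real j / real k - 1)) * (Y $ a - (2 * real j / real k - 1)))"
          by (simp only:)
        then show ?thesis using xyb by (rule zero_less_mult_pos)
      qed
      have "\<bar>X $ a\<bar> \<le> 1" using b[of a] xb by (simp add: XY abs_mult field_simps)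
      then have Xa: "-1 \<le> X $ a" "X $ a \<le> 1" by simp_all
      \<comment> \<open>\<open>j\<close> is the grid interval containing \<open>X $ a\<close>. The
        last index cannot occur, since \<open>X $ a = 1\<close> would put \<open>x\<close> on a
        plane of the grid.\<close>
      define j where "j = nat \<lfloor>real k * (X $ a + 1) / 2\<rfloor>"
      have j0: "0 \<le> real k * (X $ a + 1) / 2" using Xa by simp
      then have jl: "real j \<le> real k * (X $ a + 1) / 2" "real k * (X $ a + 1) / 2 < real j + 1"
        unfolding j_def by linarith+
      have le: "2 * real j / real k - 1 \<le> X $ a" "X $ a < 2 * real (Suc j) / real k - 1"
        using jl k(1) by (simp_all add: field_simps)
      have "real k * (X $ a + 1) / 2 \<le> real k * 2 / 2" using Xa by (intro divide_right_mono mult_left_mono) auto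
      then have "j \<le> k" using jl(1) by simp
      have "j \<noteq> k"
      proof
        assume "j = k"
        then have "X $ a = 1" using le(1) Xa k(1) by simp
        then show False using s[of k] k(1) by simp
      qed
      then have "Suc j \<le> k" using \<open>j \<le> k\<close> by simp
      have "2 * real j / real k - 1 \<le> Y $ a" 
        using s[OF \<open>j \<le> k\<close>] le(1) by (auto simp: zero_less_mult_iff)
      moreover have "Y $ a \<le> 2 * real (Suc j) / real k - 1"
        using s[OF \<open>Suc j \<le> k\<close>] le(2) by (auto simp: zero_less_mult_iff)
      moreover have "2 * real (Suc j) / real k - 2 * real j / real k = 2 / real k"
        by (simp flip: diff_divide_distrib)
      ultimately show ?thesis using le by (simp only: abs_le_iff) linarith
    qed (simp add: Xb)
    have "(norm (X - Y))\<^sup>2 = (\<bar>X $ 1 - Y $ 1\<bar>)\<^sup>2 + (\<bar>X $ 2 - Y $ 2\<bar>)\<^sup>2 + (\<bar>X $ 3 - Y $ 3\<bar>)\<^sup>2"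
      unfolding power2_norm_eq_inner by (simp add: inner_vec_def sum_3 power2_eq_square)
    \<comment> \<open>The difference in coordinate \<open>b\<close> is zero, but bounding all three
      coordinates alike avoids a case distinction and leads to the constant
      \<open>12 = 3 * 2^2\<close>.\<close>
    also have "\<dots> \<le> (2 / real k)\<^sup>2 + (2 / real k)\<^sup>2 + (2 / real k)\<^sup>2"
      by (intro add_mono power_mono close) auto
    also have "\<dots> = 12 / (real k)\<^sup>2" by (simp add: power_divide)
    finally have d: "(norm (X - Y))\<^sup>2 \<le> 12 / (real k)\<^sup>2" .
    have "1 \<le> norm X" "1 \<le> norm Y"
      using component_le_norm_cart[of X b] component_le_norm_cart[of Y b] Xb by simp_all
    from inner_ge_of_close[OF this d k(2)]
    have "sqrt (1 - 12 / (real k)\<^sup>2) * (norm X * norm Y) \<le> X \<bullet> Y" .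
    then have "(x $ b * y $ b) * (sqrt (1 - 12 / (real k)\<^sup>2) * (norm X * norm Y)) \<le> (x $ b * y $ b) * (X \<bullet> Y)"
      using xyb by (intro mult_left_mono) auto
    moreover have neq: "norm x * norm y = (x $ b * y $ b) * (norm X * norm Y)"
    proof -
      have "norm x * norm y = \<bar>x $ b * y $ b\<bar> * (norm X * norm Y)" using xb yb by (simp add: XY abs_mult field_simps)
      then show ?thesis using xyb by simp
    qed
    moreover have "x \<bullet> y = (x $ b * y $ b) * (X \<bullet> Y)" using xb yb by (simp add: XY field_simps)
    moreover have "sqrt (1 - 12 / (real k)\<^sup>2) * (norm x * norm y)
        = (x $ b * y $ b) * (sqrt (1 - 12 / (real k)\<^sup>2) * (norm X * norm Y))"
      unfolding neq by (rule mult.left_commute)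
    ultimately have le: "sqrt (1 - 12 / (real k)\<^sup>2) * (norm x * norm y) \<le> x \<bullet> y" by linarith
    have "0 < norm x" using \<open>x \<noteq> 0\<close> by simp
    moreover have "(sqrt (1 - 12 / (real k)\<^sup>2) * norm y) * norm x \<le> x \<bullet> y"
      using le by (simp only: mult.assoc mult.commute[of "norm x"])
    ultimately have "sqrt (1 - 12 / (real k)\<^sup>2) * norm y \<le> (x \<bullet> y) / norm x"
      by (simp only: pos_le_divide_eq)
    then show ?thesis by (simp add: divide_inverse mult.commute)
  qed
  then show "\<exists>c. norm c = 1 \<and> (\<forall>y. (\<forall>e\<in>grid_normals k. 0 < (e \<bullet> x) * (e \<bullet> y)) \<longrightarrow>
      sqrt (1 - 12 / (real k)\<^sup>2) * norm y \<le> c \<bullet> y)"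
  proof (intro exI conjI allI impI)
    show "norm (x /\<^sub>R norm x) = 1" using \<open>x \<noteq> 0\<close> by simp
  qed
qed

section \<open>Attainment of the minimum\<close>

lemma tuple_subsequence:
  fixes u :: "nat \<Rightarrow> nat \<Rightarrow> 'a::euclidean_space"
  assumes "\<And>k i. i < n \<Longrightarrow> norm (u k i) = 1"
  shows "\<exists>r l. strict_mono (r :: nat \<Rightarrow> nat) \<and> (\<forall>i<n. norm (l i) = 1 \<and> (\<lambda>k. u (r k) i) \<longlonglongrightarrow> l i)"
  using assms
proof (induction n)
  case 0
  show ?case by (intro exI[of _ id]) (simp add: strict_mono_def)
next
  case (Suc n)
  then obtain r l where r: "strict_mono (r :: nat \<Rightarrow> nat)"
    and l: "\<And>i. i < n \<Longrightarrow> norm (l i) = 1 \<and> (\<lambda>k. u (r k) i) \<longlonglongrightarrow> l i"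
    by (metis less_SucI)
  have "seq_compact (sphere (0::'a) 1)" using compact_sphere compact_imp_seq_compact by blast
  then obtain m s where m: "m \<in> sphere 0 1" and s: "strict_mono (s :: nat \<Rightarrow> nat)"
    "((\<lambda>k. u (r k) n) \<circ> s) \<longlonglongrightarrow> m"
    by (rule seq_compactE[of _ "\<lambda>k. u (r k) n"]) (use Suc.prems in auto)
  have "strict_mono (r \<circ> s)" using r s(1) by (rule strict_mono_o)
  moreover have "norm ((l(n := m)) i) = 1 \<and> (\<lambda>k. u ((r \<circ> s) k) i) \<longlonglongrightarrow> (l(n := m)) i" if "i < Suc n" for i
  proof (cases "i = n")
    case True
    then show ?thesis using m s(2) by (simp add: o_def)
  next
    case False
    then have "i < n" using that by simp
    then show ?thesis using l[of i] LIMSEQ_subseq_LIMSEQ[OF _ s(1), of "\<lambda>k. u (r k) i" "l i"] False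
      by (simp add: o_def)
  qed
  ultimately show ?case by blast
qed

text \<open>Fix \<open>x\<close> and \<open>y\<close> in a common open cell of the limit. By
  strictness they are in a common cell of all late tuples, and a limit of a subsequence of the
  centers for \<open>x\<close> serves all such \<open>y\<close>.\<close>

lemma coverable_limit:
  fixes u :: "nat \<Rightarrow> nat \<Rightarrow> real^3"
  assumes cov: "\<And>k. coverable (u k ` {..<n}) (h k)"
    and lim: "\<And>i. i < n \<Longrightarrow> (\<lambda>k. u k i) \<longlonglongrightarrow> l i" and h: "h \<longlonglongrightarrow> g"
  shows "coverable (l ` {..<n}) g"
  unfolding coverable_def
proof (intro allI impI)
  fix x assume x: "\<forall>a\<in>l ` {..<n}. a \<bullet> x \<noteq> 0"
  \<comment> \<open>For indices at which \<open>x\<close> lies on one of the planes, any unit vector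
    is accepted, so that a center exists for every \<open>k\<close>.\<close>
  define good where "good k c \<longleftrightarrow> norm c = 1 \<and>
    ((\<forall>i<n. u k i \<bullet> x \<noteq> 0) \<longrightarrow> (\<forall>y. (\<forall>i<n. 0 < (u k i \<bullet> x) * (u k i \<bullet> y)) \<longrightarrow> h k * norm y \<le> c \<bullet> y))" for k c
  have "\<exists>c. good k c" for k
  proof (cases "\<forall>i<n. u k i \<bullet> x \<noteq> 0")
    case True
    then have "\<forall>a\<in>u k ` {..<n}. a \<bullet> x \<noteq> 0" by auto
    then obtain c where "norm c = 1"
      "\<And>y. (\<forall>a\<in>u k ` {..<n}. 0 < (a \<bullet> x) * (a \<bullet> y)) \<Longrightarrow> h k * norm y \<le> c \<bullet> y"
      using cov unfolding coverable_def by blast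
    then show ?thesis unfolding good_def by (intro exI[of _ c]) auto
  next
    case False
    obtain c :: "real^3" where "norm c = 1" using common_perp by blast
    then show ?thesis using False unfolding good_def by blast
  qed
  then obtain c where c: "\<And>k. good k (c k)" by metis
  then have "\<forall>k. c k \<in> sphere 0 1" by (simp add: good_def)
  moreover have "seq_compact (sphere (0::real^3) 1)" using compact_sphere compact_imp_seq_compact by blast
  ultimately obtain d r where d: "d \<in> sphere 0 1" and r: "strict_mono (r :: nat \<Rightarrow> nat)" "(c \<circ> r) \<longlonglongrightarrow> d"
    by (metis seq_compactE)
  have "g * norm y \<le> d \<bullet> y" if y: "\<forall>a\<in>l ` {..<n}. 0 < (a \<bullet> x) * (a \<bullet> y)" for y
  proof -
    have ev: "eventually (\<lambda>k. \<forall>i\<in>{..<n}. u k i \<bullet> x \<noteq> 0 \<and> 0 < (u k i \<bullet> x) * (u k i \<bullet> y)) sequentially"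
    proof (rule eventually_ball_finite)
      show "\<forall>i\<in>{..<n}. eventually (\<lambda>k. u k i \<bullet> x \<noteq> 0 \<and> 0 < (u k i \<bullet> x) * (u k i \<bullet> y)) sequentially"
      proof
        fix i assume "i \<in> {..<n}"
        then have i: "i < n" by simp
        have "(\<lambda>k. (u k i \<bullet> x) * (u k i \<bullet> y)) \<longlonglongrightarrow> (l i \<bullet> x) * (l i \<bullet> y)"
          by (intro tendsto_intros lim i)
        moreover have "0 < (l i \<bullet> x) * (l i \<bullet> y)" using y i by blast
        ultimately have "eventually (\<lambda>k. 0 < (u k i \<bullet> x) * (u k i \<bullet> y)) sequentially"
          by (rule order_tendstoD(1))
        then show "eventually (\<lambda>k. u k i \<bullet> x \<noteq> 0 \<and> 0 < (u k i \<bullet> x) * (u k i \<bullet> y)) sequentially"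
          by (rule eventually_mono) auto
      qed
    qed simp
    have "eventually (\<lambda>k. h k * norm y \<le> c k \<bullet> y) sequentially"
      using ev by (rule eventually_mono) (use c in \<open>auto simp: good_def\<close>)
    then have "eventually (\<lambda>k. h (r k) * norm y \<le> c (r k) \<bullet> y) sequentially"
      by (rule eventually_subseq[OF r(1)])
    moreover have "(\<lambda>k. h (r k) * norm y) \<longlonglongrightarrow> g * norm y"
      using LIMSEQ_subseq_LIMSEQ[OF h r(1)] unfolding o_def by (intro tendsto_intros)
    moreover have "(\<lambda>k. c (r k) \<bullet> y) \<longlonglongrightarrow> d \<bullet> y"
      using r(2) unfolding o_def by (intro tendsto_intros)
    ultimately show ?thesis by (rule_tac tendsto_le[OF sequentially_bot])
  qed
  with d show "\<exists>c. norm c = 1 \<and> (\<forall>y. (\<forall>a\<in>l ` {..<n}. 0 < (a \<bullet> x) * (a \<bullet> y)) \<longrightarrow> g * norm y \<le> c \<bullet> y)"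
    by auto
qed

section \<open>Passing between arrangements and sets of normals\<close>

lemma arrangement_normals:
  assumes "arrangement n F"
  obtains A where "finite A" "card A = n" "\<And>a. a \<in> A \<Longrightarrow> norm a = 1" "F = perp_circle ` A" "inj_on perp_circle A"
    "\<And>a b. a \<in> A \<Longrightarrow> b \<in> A \<Longrightarrow> a \<noteq> b \<Longrightarrow> cross3 a b \<noteq> 0"
proof -
  have F: "finite F" "card F = n" "\<And>C. C \<in> F \<Longrightarrow> \<exists>a. norm a = 1 \<and> C = perp_circle a"
    using assms by (simp_all add: arrangement_def great_circle_iff)
  then obtain f where f: "\<And>C. C \<in> F \<Longrightarrow> norm (f C) = 1 \<and> C = perp_circle (f C)" by metis
  have inj: "inj_on f F" by (metis f inj_onI)
  have pf: "perp_circle (f C) = C" if "C \<in> F" for C using f[OF that] by simp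
  have injp: "inj_on perp_circle (f ` F)" by (rule inj_onI) (use pf in force)
  show ?thesis
  proof (rule that[of "f ` F"])
    show "F = perp_circle ` f ` F" unfolding image_image using pf by (auto intro: rev_image_eqI)
    fix a b assume ab: "a \<in> f ` F" "b \<in> f ` F" "a \<noteq> b"
    then have n1: "norm a = 1" "norm b = 1" using f by auto
    show "cross3 a b \<noteq> 0"
    proof
      assume "cross3 a b = 0"
      then have "(a \<bullet> b)\<^sup>2 = 1" using norm_cross[of a b] n1 by simp
      then have "a \<bullet> b = 1 \<or> a \<bullet> b = -1" by (simp add: power2_eq_1_iff)
      moreover have "a \<bullet> a = 1" "b \<bullet> b = 1" using n1 by (simp_all add: dot_square_norm)
      ultimately have "(a - b) \<bullet> (a - b) = 0 \<or> (a + b) \<bullet> (a + b) = 0"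
        by (auto simp: inner_diff_left inner_diff_right inner_add_left inner_add_right inner_commute)
      then have "a = b \<or> a = - b" by (auto simp: eq_neg_iff_add_eq_0)
      then have "perp_circle a = perp_circle b" by (auto simp: perp_circle_def)
      then show False using injp ab by (auto dest: inj_onD)
    qed
  qed (use F inj f injp card_image in auto)
qed

lemma infinite_great_circles: "infinite {C. great_circle C}"
proof -
  define f :: "real \<Rightarrow> real^3" where "f t = vector [1, t, 0]" for t
  have "f t \<noteq> 0" for t by (metis f_def vector_3(1) zero_index zero_neq_one)
  define g where "g t = perp_circle (f t /\<^sub>R norm (f t))" for t
  have "inj g"
  proof (rule injI)
    fix s t assume "g s = g t"
    then have "{y. (f s /\<^sub>R norm (f s)) \<bullet> y = 0} = {y. (f t /\<^sub>R norm (f t)) \<bullet> y = 0}"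
      unfolding g_def by (metis span_perp_circle)
    then have "f s \<bullet> y = 0 \<longleftrightarrow> f t \<bullet> y = 0" for y
      using \<open>f s \<noteq> 0\<close> \<open>f t \<noteq> 0\<close> by (auto simp: set_eq_iff)
    \<comment> \<open>This vector is orthogonal to \<open>f s\<close>, and its product with
      \<open>f t\<close> is \<open>t - s\<close>.\<close>
    from this[of "vector [- s, 1, 0]"] show "s = t"
      by (simp add: f_def inner_vec_def sum_3)
  qed
  then have "infinite (range g)" by (meson finite_imageD infinite_UNIV_char_0)
  moreover have "range g \<subseteq> {C. great_circle C}"
    using \<open>\<And>t. f t \<noteq> 0\<close> by (auto simp: g_def great_circle_iff intro!: exI[of _ "f _ /\<^sub>R norm (f _)"])
  ultimately show ?thesis using infinite_super by blast
qed

text \<open>Parallel or too few normals give fewer than \<open>n\<close> circles. The missing ones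
  are taken from the infinitely many great circles; they only refine the cells.\<close>

lemma arrangement_of_normals:
  assumes A: "finite A" "A \<noteq> {}" "0 \<notin> A" "card A \<le> n" and cov: "coverable A (cos R)" and R: "R \<in> {0<..pi/2}"
  shows "\<exists>F. arrangement n F \<and> cells_covered F R"
proof -
  define F0 where "F0 = (\<lambda>a. perp_circle (a /\<^sub>R norm a)) ` A"
  have F0: "finite F0" "card F0 \<le> n" using A(1) order_trans[OF card_image_le[OF A(1)] A(4)] unfolding F0_def by simp_all
  have g0: "F0 \<subseteq> {C. great_circle C}"
  proof
    fix C assume "C \<in> F0"
    then obtain a where a: "a \<in> A" "C = perp_circle (a /\<^sub>R norm a)" by (auto simp: F0_def)
    have "a \<noteq> 0" using a(1) A(3) by blast
    then have "norm (a /\<^sub>R norm a) = 1" by simp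
    then show "C \<in> {C. great_circle C}" using a(2) great_circle_iff by blast
  qed
  have "infinite ({C. great_circle C} - F0)" using infinite_great_circles F0(1) by simp
  then obtain G where G: "finite G" "card G = n - card F0" "G \<subseteq> {C. great_circle C} - F0"
    using infinite_arbitrarily_large by blast
  have "card (F0 \<union> G) = card F0 + card G" using F0 G by (intro card_Un_disjoint) auto
  then have arr: "arrangement n (F0 \<union> G)" using F0 G g0 by (auto simp: arrangement_def)
  obtain B where B: "finite B" "\<And>b. b \<in> B \<Longrightarrow> norm b = 1" "F0 \<union> G = perp_circle ` B"
    using arrangement_normals[OF arr] by metis
  have "coverable B (cos R)"
  proof (rule coverable_rescale[OF cov])
    fix a assume a: "a \<in> A"
    then have na: "a \<noteq> 0" using A(3) by blast
    have "perp_circle (a /\<^sub>R norm a) \<in> perp_circle ` B" using a B(3) by (auto simp: F0_def)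
    then obtain b where b: "b \<in> B" "perp_circle (a /\<^sub>R norm a) = perp_circle b" by blast
    then have "a /\<^sub>R norm a = b \<or> a /\<^sub>R norm a = - b" using B(2) na by (subst (asm) perp_circle_eq_iff) auto
    then have "inverse (norm a) *\<^sub>R a \<in> B \<or> (- inverse (norm a)) *\<^sub>R a \<in> B" using b(1) by auto
    then show "\<exists>r. r \<noteq> 0 \<and> r *\<^sub>R a \<in> B" using na by (metis inverse_nonzero_iff_nonzero neg_equal_0_iff_equal norm_eq_zero)
  qed
  moreover have "B \<noteq> {}" using A(2) B(3) by (auto simp: F0_def)
  ultimately have "cells_covered (F0 \<union> G) R" unfolding B(3) using B(1) R by (subst cells_covered_iff_coverable) auto
  with arr show ?thesis by blast
qed

section \<open>The least radius exists\<close>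

text \<open>Indexing by \<open>{..<n}\<close> admits repeated normals, which makes the set
  \<open>H\<close> of attainable cosines closed.\<close>

lemma maximal_cos_attained:
  fixes n :: nat
  assumes "0 < n"
  obtains g u where "0 \<le> g" "g \<le> 1" "\<And>i. i < n \<Longrightarrow> norm (u i) = 1" "coverable (u ` {..<n}) g"
    "\<And>h v. 0 \<le> h \<Longrightarrow> h \<le> 1 \<Longrightarrow> (\<And>i. i < n \<Longrightarrow> norm (v i) = 1) \<Longrightarrow> coverable (v ` {..<n}) h \<Longrightarrow> h \<le> g"
proof -
  define H where "H = {h. 0 \<le> h \<and> h \<le> 1 \<and> (\<exists>u. (\<forall>i<n. norm (u i) = 1) \<and> coverable (u ` {..<n}) h)}"
  obtain e :: "real^3" where e: "norm e = 1" using common_perp by blast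
  have "coverable ((\<lambda>i. e) ` {..<n}) 0" by (rule coverable_0[of e]) (use assms in auto)
  then have "0 \<in> H" using e unfolding H_def by (intro CollectI conjI exI[of _ "\<lambda>i. e"]) auto
  have "closed H" unfolding closed_sequential_limits
  proof (intro allI impI)
    fix h g assume "(\<forall>k. h k \<in> H) \<and> h \<longlonglongrightarrow> g"
    then have hH: "\<And>k. h k \<in> H" and hg: "h \<longlonglongrightarrow> g" by auto
    then have "\<forall>k. \<exists>u. (\<forall>i<n. norm (u i) = 1) \<and> coverable (u ` {..<n}) (h k)" by (simp add: H_def)
    then obtain u where u: "\<And>k i. i < n \<Longrightarrow> norm (u k i) = 1" "\<And>k. coverable (u k ` {..<n}) (h k)" by metis
    obtain r l where r: "strict_mono (r :: nat \<Rightarrow> nat)"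
      and l: "\<forall>i<n. norm (l i) = 1 \<and> (\<lambda>k. u (r k) i) \<longlonglongrightarrow> l i"
      using tuple_subsequence[of n u] u(1) by blast
    have "(\<lambda>k. h (r k)) \<longlonglongrightarrow> g" using LIMSEQ_subseq_LIMSEQ[OF hg r] by (simp add: o_def)
    moreover have "(\<lambda>k. u (r k) i) \<longlonglongrightarrow> l i" if "i < n" for i using l that by blast
    ultimately have "coverable (l ` {..<n}) g"
      by (rule_tac coverable_limit[of "\<lambda>k. u (r k)" n "\<lambda>k. h (r k)"]) (rule u(2))
    moreover have "0 \<le> g" "g \<le> 1"
      by (rule LIMSEQ_le_const[OF hg], use hH in \<open>force simp: H_def\<close>)
         (rule LIMSEQ_le_const2[OF hg], use hH in \<open>force simp: H_def\<close>)
    ultimately show "g \<in> H" using l unfolding H_def by blast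
  qed
  moreover have "bounded H" by (rule bounded_subset[OF bounded_closed_interval[of 0 1]]) (auto simp: H_def)
  ultimately have "compact H" by (simp add: compact_eq_bounded_closed)
  then obtain g where "g \<in> H" "\<And>h. h \<in> H \<Longrightarrow> h \<le> g"
    using compact_attains_sup[of H] \<open>0 \<in> H\<close> by blast
  then show ?thesis using that unfolding H_def by blast
qed

lemma R_gc_is_least:
  assumes n: "2 \<le> n"
  shows "\<exists>F. arrangement n F \<and> cells_covered F (R_gc n)"
    and "\<And>F R. arrangement n F \<Longrightarrow> cells_covered F R \<Longrightarrow> R_gc n \<le> R"
proof -
  obtain g u where g: "0 \<le> g" "g \<le> 1" and u: "\<And>i. i < n \<Longrightarrow> norm (u i) = 1" "coverable (u ` {..<n}) g"
    and max: "\<And>h v. 0 \<le> h \<Longrightarrow> h \<le> 1 \<Longrightarrow> (\<And>i. i < n \<Longrightarrow> norm (v i) = 1) \<Longrightarrow> coverable (v ` {..<n}) h \<Longrightarrow> h \<le> g"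
    using maximal_cos_attained[of n] n by (metis gr0I not_numeral_le_zero)
  have A: "finite (u ` {..<n})" "u ` {..<n} \<noteq> {}" "0 \<notin> u ` {..<n}" "card (u ` {..<n}) \<le> n"
    using n u(1) card_image_le[of "{..<n}" u] by (auto simp: lessThan_empty_iff) (metis norm_zero zero_neq_one)
  have cg: "cos (arccos g) = g" using g by (intro cos_arccos) auto
  have lower: "arccos g \<le> R" if F: "arrangement n F" "cells_covered F R" for F R
  proof -
    obtain B where B: "finite B" "card B = n" "\<And>b. b \<in> B \<Longrightarrow> norm b = 1" "F = perp_circle ` B"
      using arrangement_normals[OF F(1)] by metis
    then have "B \<noteq> {}" using n by auto
    then have RB: "0 < R" "R \<le> pi / 2" "coverable B (cos R)"
      using F(2) cells_covered_iff_coverable[OF B(1)] B(4) by auto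
    obtain v where v: "bij_betw v {..<n} B" using ex_bij_betw_nat_finite[OF B(1)] B(2) by (auto simp: atLeast0LessThan)
    then have vB: "v ` {..<n} = B" by (simp add: bij_betw_def)
    have "0 \<le> cos R" using RB by (intro cos_ge_zero) auto
    then have "cos R \<le> g" using RB(3) vB B(3) by (intro max[of _ v]) auto
    then have "arccos g \<le> arccos (cos R)" using g by (intro arccos_le_arccos) (auto intro: order_trans[of _ 0])
    also have "arccos (cos R) = R" using RB by (intro arccos_cos) auto
    finally show ?thesis .
  qed
  have "g \<noteq> 1"
  proof
    assume "g = 1"
    \<comment> \<open>Half of the volume bound: the corresponding \<open>h < 1\<close> has positive
      radius, so it belongs to a genuine arrangement of \<open>n\<close> circles after padding, yet
      it violates the bound.\<close>
    define s where "s = pi / (2 * (real n * (real n - 1)))"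
    define h where "h = 1 / (1 + s)"
    have "0 < real n * (real n - 1)" using n by simp
    then have s0: "0 < s" "s < pi / (real n * (real n - 1))" by (simp_all add: s_def field_simps)
    then have h: "0 < h" "h < 1" "(1 - h) / h = s" by (simp_all add: h_def field_simps)
    then have R: "arccos h \<in> {0<..pi/2}" "cos (arccos h) = h"
      using arccos_lt_bounded[of h] arccos_le_pi2[of h] by (auto intro: cos_arccos)
    have "coverable (u ` {..<n}) h" using u(2) \<open>g = 1\<close> h by (auto intro: coverable_antimono)
    then obtain F where F: "arrangement n F" "cells_covered F (arccos h)"
      using arrangement_of_normals[OF A _ R(1)] R(2) by auto
    obtain B where B: "finite B" "card B = n" "\<And>b. b \<in> B \<Longrightarrow> norm b = 1" "F = perp_circle ` B"
      "\<And>a b. a \<in> B \<Longrightarrow> b \<in> B \<Longrightarrow> a \<noteq> b \<Longrightarrow> cross3 a b \<noteq> 0"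
      using arrangement_normals[OF F(1)] by metis
    then have "B \<noteq> {}" using n by auto
    then have "coverable B h" using F(2) cells_covered_iff_coverable[OF B(1)] B(4) R(2) by auto
    then have "pi / (real n * (real n - 1)) \<le> (1 - h) / h"
      using B(3,5) h(1) by (intro coverable_volume_bound[OF B(1,2) n]) simp_all
    then show False using s0(2) h(3) by simp
  qed
  then have R0: "arccos g \<in> {0<..pi/2}"
    using g arccos_le_pi2[of g] arccos_lbound[of g] by (auto simp: less_le arccos_eq_0_iff)
  obtain F where F: "arrangement n F" "cells_covered F (arccos g)"
    using arrangement_of_normals[OF A _ R0] u(2) cg by auto
  have "R_gc n = arccos g" unfolding R_gc_def
    by (rule Least_equality) (use F lower in blast)+
  then show "\<exists>F. arrangement n F \<and> cells_covered F (R_gc n)"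
    and "\<And>F R. arrangement n F \<Longrightarrow> cells_covered F R \<Longrightarrow> R_gc n \<le> R"
    using F lower by auto
qed

section \<open>Optimal arrangements\<close>

lemma orthogonal_circles_perp_circle:
  assumes "norm a = 1" "norm b = 1"
  shows "orthogonal_circles (perp_circle a) (perp_circle b) \<longleftrightarrow> a \<bullet> b = 0"
  using assms by (simp add: orthogonal_circles_def unit_normals_perp_circle orthogonal_def)

lemma double_normals_perp_circle:
  assumes "\<And>a. a \<in> A \<Longrightarrow> norm a = 1"
  shows "double_normals (perp_circle ` A) = (\<Union>a\<in>A. {a, - a})"
  using assms by (simp add: double_normals_def unit_normals_perp_circle)

lemma axis3_orthonormal:
  "norm (axis 1 1 :: real^3) = 1" "norm (axis 2 1 :: real^3) = 1" "norm (axis 3 1 :: real^3) = 1"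
  "axis 1 1 \<bullet> (axis 2 1 :: real^3) = 0" "axis 1 1 \<bullet> (axis 3 1 :: real^3) = 0" "axis 2 1 \<bullet> (axis 3 1 :: real^3) = 0"
  by (simp_all add: inner_axis_axis)

lemma arccos_bounds:
  assumes "0 \<le> h" "h < 1"
  shows "arccos h \<in> {0<..pi/2}" "cos (arccos h) = h"
  using assms arccos_lt_bounded[of h] arccos_le_pi2[of h]
  by (auto intro: cos_arccos simp: less_le arccos_eq_0_iff)

lemma R_gc_eqI:
  assumes n: "2 \<le> n" and h: "0 \<le> h" "h < 1"
    and A: "finite A" "A \<noteq> {}" "0 \<notin> A" "card A \<le> n" "coverable A h"
    and upper: "\<And>B k. finite B \<Longrightarrow> card B = n \<Longrightarrow> 0 \<notin> B \<Longrightarrow> coverable B k \<Longrightarrow> k \<le> h"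
  shows "R_gc n = arccos h"
proof (rule antisym)
  have ch: "arccos h \<in> {0<..pi/2}" "cos (arccos h) = h" using arccos_bounds h by auto
  then obtain F where "arrangement n F" "cells_covered F (arccos h)"
    using arrangement_of_normals[OF A(1-4), of "arccos h"] A(5) by auto
  then show "R_gc n \<le> arccos h" by (rule R_gc_is_least(2)[OF n])
  obtain F where F: "arrangement n F" "cells_covered F (R_gc n)" using R_gc_is_least(1)[OF n] by blast
  obtain B where B: "finite B" "card B = n" "\<And>b. b \<in> B \<Longrightarrow> norm b = 1" "F = perp_circle ` B"
    using arrangement_normals[OF F(1)] by metis
  then have "B \<noteq> {}" using n by auto
  then have R: "R_gc n \<in> {0<..pi/2}" "coverable B (cos (R_gc n))"
    using F(2) cells_covered_iff_coverable[OF B(1)] B(4) by auto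
  have "0 \<notin> B" using B(3) by force
  then have "cos (R_gc n) \<le> h" using R(2) B(1,2) upper by blast
  then have "arccos h \<le> arccos (cos (R_gc n))" using h by (intro arccos_le_arccos) auto
  also have "\<dots> = R_gc n" using R(1) by (intro arccos_cos) auto
  finally show "arccos h \<le> R_gc n" .
qed

section \<open>Inscribed cubes and the optimal arrangements\<close>

text \<open>The eight vertices of a cube with center 0 and half-edge \<open>s\<close> are the
  vertices of a tetrahedron and their antipodes.\<close>

lemma cube_of_frame:
  fixes A B C :: "real^3" and s :: real
  shows "{- (s *\<^sub>R (A + B + C)) + i *\<^sub>R ((2 * s) *\<^sub>R A) + j *\<^sub>R ((2 * s) *\<^sub>R B) + k *\<^sub>R ((2 * s) *\<^sub>R C) | i j k.
      i \<in> {0, 1} \<and> j \<in> {0, 1} \<and> k \<in> {0, 1}}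
    = (\<Union>m\<in>{A + B + C, A - B - C, B - A - C, C - A - B}. {s *\<^sub>R m, - (s *\<^sub>R m)})" (is "?L = ?R")
proof -
  let ?f = "\<lambda>i j k. - (s *\<^sub>R (A + B + C)) + i *\<^sub>R ((2 * s) *\<^sub>R A) + j *\<^sub>R ((2 * s) *\<^sub>R B) + k *\<^sub>R ((2 * s) *\<^sub>R C)"
  have eqs: "?f 0 0 0 = - (s *\<^sub>R (A + B + C))" "?f 1 1 1 = s *\<^sub>R (A + B + C)"
    "?f 1 0 0 = s *\<^sub>R (A - B - C)" "?f 0 1 1 = - (s *\<^sub>R (A - B - C))"
    "?f 0 1 0 = s *\<^sub>R (B - A - C)" "?f 1 0 1 = - (s *\<^sub>R (B - A - C))"
    "?f 0 0 1 = s *\<^sub>R (C - A - B)" "?f 1 1 0 = - (s *\<^sub>R (C - A - B))"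
    by (simp_all add: vec_eq_iff algebra_simps)
  have "?L = (\<Union>i\<in>{0, 1}. \<Union>j\<in>{0, 1}. \<Union>k\<in>{0, 1}. {?f i j k})" by blast
  also have "\<dots> = ?R" unfolding UN_insert UN_empty Un_empty_right eqs by blast
  finally show ?thesis .
qed

text \<open>That \<open>p\<close>, \<open>p + a\<close>, \<open>p + b\<close>, \<open>p + c\<close>
  have norm 1 forces each coordinate of \<open>p\<close> in the frame to be
  \<open>- (N / 2)\<close>. So the cube is centered at the origin, and \<open>norm p = 1\<close>
  gives the half-edge \<open>1 / sqrt 3\<close>.\<close>

lemma inscribed_cube_iff_frame:
  "inscribed_cube_vertices V \<longleftrightarrow> (\<exists>A B C :: real^3. norm A = 1 \<and> norm B = 1 \<and> norm C = 1 \<and>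
     A \<bullet> B = 0 \<and> A \<bullet> C = 0 \<and> B \<bullet> C = 0 \<and>
     V = (\<Union>m\<in>{A + B + C, A - B - C, B - A - C, C - A - B}. {(1 / sqrt 3) *\<^sub>R m, - ((1 / sqrt 3) *\<^sub>R m)}))"
proof
  assume "inscribed_cube_vertices V"
  then obtain p a b c where abc: "a \<noteq> 0" "norm b = norm a" "norm c = norm a" "orthogonal a b" "orthogonal a c" "orthogonal b c"
    and V: "V = {p + i *\<^sub>R a + j *\<^sub>R b + k *\<^sub>R c | i j k. i \<in> {0, 1} \<and> j \<in> {0, 1} \<and> k \<in> {0, 1}}" and S: "V \<subseteq> S2"
    unfolding inscribed_cube_vertices_def cube_vertices_def by blast
  define N where "N = norm a"
  have N: "0 < N" "norm b = N" "norm c = N" "norm a = N" using abc by (simp_all add: N_def)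
  define A B C where "A = a /\<^sub>R N" "B = b /\<^sub>R N" "C = c /\<^sub>R N"
  note defs = this
  have on: "norm A = 1" "norm B = 1" "norm C = 1" "A \<bullet> B = 0" "A \<bullet> C = 0" "B \<bullet> C = 0"
    using N abc by (simp_all add: defs orthogonal_def)
  have abcN: "a = N *\<^sub>R A" "b = N *\<^sub>R B" "c = N *\<^sub>R C" using N by (simp_all add: defs)
  have "p + i *\<^sub>R a + j *\<^sub>R b + k *\<^sub>R c \<in> S2" if "i \<in> {0, 1}" "j \<in> {0, 1}" "k \<in> {0, 1}" for i j k
    using S that unfolding V by blast
  from this[of 0 0 0] this[of 1 0 0] this[of 0 1 0] this[of 0 0 1]
  have p: "norm p = 1" "norm (p + a) = 1" "norm (p + b) = 1" "norm (p + c) = 1" by simp_all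
  have half: "p \<bullet> E = - (N / 2)" if "norm (p + N *\<^sub>R E) = 1" "norm E = 1" for E
  proof -
    have "(norm (p + N *\<^sub>R E))\<^sup>2 = (norm p)\<^sup>2 + 2 * N * (p \<bullet> E) + N * N * (norm E)\<^sup>2"
      unfolding power2_norm_eq_inner by (simp add: inner_add_left inner_add_right inner_commute algebra_simps)
    then have "N * (2 * (p \<bullet> E) + N) = 0" using p(1) that by (simp add: algebra_simps)
    then show ?thesis using N(1) by simp
  qed
  have dots: "p \<bullet> A = - (N / 2)" "p \<bullet> B = - (N / 2)" "p \<bullet> C = - (N / 2)"
    using half p on unfolding abcN by blast+
  have "p \<bullet> p = 1" using p(1) by (simp add: dot_square_norm)
  then have "3 * (N / 2 * (N / 2)) = 1" using orthonormal_inner[OF on, of p p] dots by simp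
  then have "(N / 2)\<^sup>2 = (1 / sqrt 3)\<^sup>2" by (simp add: power_divide power2_eq_square)
  then have N2: "N / 2 = 1 / sqrt 3" using N(1) by (simp add: power2_eq_iff_nonneg)
  have p_eq: "p = - ((1 / sqrt 3) *\<^sub>R (A + B + C))"
    using orthonormal_expand[OF on, of p] unfolding dots N2 by (simp add: algebra_simps)
  have NN: "N = 2 * (1 / sqrt 3)" using N2 by simp
  show "\<exists>A B C :: real^3. norm A = 1 \<and> norm B = 1 \<and> norm C = 1 \<and>
     A \<bullet> B = 0 \<and> A \<bullet> C = 0 \<and> B \<bullet> C = 0 \<and>
     V = (\<Union>m\<in>{A + B + C, A - B - C, B - A - C, C - A - B}. {(1 / sqrt 3) *\<^sub>R m, - ((1 / sqrt 3) *\<^sub>R m)})"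
    using on cube_of_frame[of "1 / sqrt 3" A B C]
    unfolding V abcN p_eq NN by blast
next
  assume "\<exists>A B C :: real^3. norm A = 1 \<and> norm B = 1 \<and> norm C = 1 \<and>
     A \<bullet> B = 0 \<and> A \<bullet> C = 0 \<and> B \<bullet> C = 0 \<and>
     V = (\<Union>m\<in>{A + B + C, A - B - C, B - A - C, C - A - B}. {(1 / sqrt 3) *\<^sub>R m, - ((1 / sqrt 3) *\<^sub>R m)})"
  then obtain A B C :: "real^3" where on: "norm A = 1" "norm B = 1" "norm C = 1" "A \<bullet> B = 0" "A \<bullet> C = 0" "B \<bullet> C = 0"
    and V: "V = (\<Union>m\<in>{A + B + C, A - B - C, B - A - C, C - A - B}. {(1 / sqrt 3) *\<^sub>R m, - ((1 / sqrt 3) *\<^sub>R m)})" by blast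
  have "cube_vertices V" unfolding cube_vertices_def
    by (rule exI[of _ "- ((1 / sqrt 3) *\<^sub>R (A + B + C))"], rule exI[of _ "(2 * (1 / sqrt 3)) *\<^sub>R A"],
        rule exI[of _ "(2 * (1 / sqrt 3)) *\<^sub>R B"], rule exI[of _ "(2 * (1 / sqrt 3)) *\<^sub>R C"],
        subst cube_of_frame, intro conjI V)
       (use on in \<open>auto simp: orthogonal_def\<close>)
  moreover have "norm m = sqrt 3" if "m \<in> {A + B + C, A - B - C, B - A - C, C - A - B}" for m
    using that orthonormal_frame_norm[OF on] by blast
  then have "V \<subseteq> S2" unfolding V by auto
  ultimately show "inscribed_cube_vertices V" by (simp add: inscribed_cube_vertices_def)
qed

lemma sqrt_bounds: "1 / sqrt 3 < 1" "1 / sqrt 2 < (1::real)" "0 \<le> 1 / sqrt 3" "0 \<le> 1 / sqrt (2::real)"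
  by simp_all

lemma R_gc_3: "R_gc 3 = arccos (1 / sqrt 3)"
proof (rule R_gc_eqI)
  let ?A = "{axis 1 1, axis 2 1, axis 3 1} :: (real^3) set"
  show "coverable ?A (1 / sqrt 3)" by (rule coverable_orthonormal[OF axis3_orthonormal])
  show "card ?A \<le> 3" by (simp add: card_insert_if)
  show "0 \<notin> ?A" using axis3_orthonormal by auto
  fix B k assume B: "finite B" "card B = 3" "0 \<notin> B" "coverable B k"
  then obtain a b c where "B = {a, b, c}" by (auto simp: card_3_iff)
  then show "k \<le> 1 / sqrt 3" using coverable_3(1)[of a b c k] B by auto
qed (use sqrt_bounds in auto)

lemma card_4_obtain:
  assumes "card A = 4"
  obtains a b c d where "A = {a, b, c, d}"
  using assms by (auto simp: card_Suc_eq numeral_eq_Suc)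

lemma arccos_sqrt_2: "arccos (1 / sqrt 2) = pi / 4"
proof -
  have "1 / sqrt 2 = cos (pi / 4)" by (simp add: cos_45 field_simps)
  then show ?thesis by (simp add: arccos_cos)
qed

lemma R_gc_4: "R_gc 4 = pi / 4"
  unfolding arccos_sqrt_2[symmetric]
proof (rule R_gc_eqI)
  let ?a = "axis 1 1 :: real^3" and ?b = "axis 2 1 :: real^3" and ?c = "axis 3 1 :: real^3"
  let ?A = "{?a + ?b + ?c, ?a - ?b - ?c, ?b - ?a - ?c, ?c - ?a - ?b}"
  show "coverable ?A (1 / sqrt 2)" by (rule coverable_tetrahedral[OF axis3_orthonormal])
  show "card ?A \<le> 4" by (simp add: card_insert_if)
  show "0 \<notin> ?A" using orthonormal_frame_norm[OF axis3_orthonormal] by force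
  fix B k assume B: "finite B" "card B = 4" "0 \<notin> B" "coverable B k"
  then obtain a b c d where "B = {a, b, c, d}" using card_4_obtain by metis
  then show "k \<le> 1 / sqrt 2" using coverable_4[of a b c d k] B by force
qed (use sqrt_bounds in auto)

lemma extremal_iff_coverable:
  assumes "2 \<le> n" "finite A" "card A = n" "arrangement n (perp_circle ` A)" "R_gc n = arccos h" "0 \<le> h" "h < 1"
  shows "extremal n (perp_circle ` A) \<longleftrightarrow> coverable A h"
proof -
  have "A \<noteq> {}" using assms by auto
  then show ?thesis
    using assms cells_covered_iff_coverable[of A "arccos h"] arccos_bounds[of h] by (auto simp: extremal_def)
qed

lemma extremal_3_iff:
  assumes "arrangement 3 F"
  shows "extremal 3 F \<longleftrightarrow> pairwise orthogonal_circles F"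
proof -
  obtain A where A: "finite A" "card A = 3" "\<And>a. a \<in> A \<Longrightarrow> norm a = 1" "F = perp_circle ` A" "inj_on perp_circle A"
    using arrangement_normals[OF assms] by metis
  obtain a b c where abc: "A = {a, b, c}" "a \<noteq> b" "a \<noteq> c" "b \<noteq> c" using A(2) by (auto simp: card_3_iff)
  have unit: "norm a = 1" "norm b = 1" "norm c = 1" using A(3) abc by auto
  have ne: "perp_circle a \<noteq> perp_circle b" "perp_circle a \<noteq> perp_circle c" "perp_circle b \<noteq> perp_circle c"
    using A(5) abc by (auto dest: inj_onD)
  have "extremal 3 F \<longleftrightarrow> coverable {a, b, c} (1 / sqrt 3)"
    using extremal_iff_coverable[OF _ A(1,2) _ R_gc_3] assms sqrt_bounds abc(1) A(4) by simp
  also have "\<dots> \<longleftrightarrow> a \<bullet> b = 0 \<and> a \<bullet> c = 0 \<and> b \<bullet> c = 0"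
  proof
    assume "coverable {a, b, c} (1 / sqrt 3)"
    then show "a \<bullet> b = 0 \<and> a \<bullet> c = 0 \<and> b \<bullet> c = 0" by (rule coverable_3(2)) (use unit in auto)
  next
    assume "a \<bullet> b = 0 \<and> a \<bullet> c = 0 \<and> b \<bullet> c = 0"
    then show "coverable {a, b, c} (1 / sqrt 3)" by (intro coverable_orthonormal unit) auto
  qed
  also have "\<dots> \<longleftrightarrow> pairwise orthogonal_circles F"
  proof -
    have oc: "orthogonal_circles (perp_circle a) (perp_circle b) \<longleftrightarrow> a \<bullet> b = 0"
      "orthogonal_circles (perp_circle b) (perp_circle a) \<longleftrightarrow> a \<bullet> b = 0"
      "orthogonal_circles (perp_circle a) (perp_circle c) \<longleftrightarrow> a \<bullet> c = 0"
      "orthogonal_circles (perp_circle c) (perp_circle a) \<longleftrightarrow> a \<bullet> c = 0"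
      "orthogonal_circles (perp_circle b) (perp_circle c) \<longleftrightarrow> b \<bullet> c = 0"
      "orthogonal_circles (perp_circle c) (perp_circle b) \<longleftrightarrow> b \<bullet> c = 0"
      using unit by (simp_all add: orthogonal_circles_perp_circle inner_commute)
    have F: "F = {perp_circle a, perp_circle b, perp_circle c}" by (simp add: A(4) abc(1))
    show ?thesis unfolding F by (simp add: pairwise_def oc ne ne[symmetric]) blast
  qed
  finally show ?thesis .
qed

lemma extremal_4_iff:
  assumes "arrangement 4 F"
  shows "extremal 4 F \<longleftrightarrow> inscribed_cube_vertices (double_normals F)"
proof -
  obtain N where N: "finite N" "card N = 4" "\<And>a. a \<in> N \<Longrightarrow> norm a = 1" "F = perp_circle ` N"
    using arrangement_normals[OF assms] by metis
  have dn: "double_normals F = (\<Union>a\<in>N. {a, - a})" unfolding N(4) using N(3) by (rule double_normals_perp_circle)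
  have "extremal 4 F \<longleftrightarrow> coverable N (1 / sqrt 2)"
    using extremal_iff_coverable[of 4 N "1 / sqrt 2"] N(1,2) R_gc_4 assms sqrt_bounds N(4)
    by (simp add: arccos_sqrt_2)
  also have "\<dots> \<longleftrightarrow> inscribed_cube_vertices (double_normals F)"
  proof
    assume cov: "coverable N (1 / sqrt 2)"
    obtain a b c d where abcd: "N = {a, b, c, d}" using card_4_obtain[OF N(2)] .
    have unit: "norm a = 1" "norm b = 1" "norm c = 1" "norm d = 1" using N(3) abcd by auto
    then have "a \<noteq> 0" "b \<noteq> 0" "c \<noteq> 0" "d \<noteq> 0" by auto
    then obtain A B C r s t w where on: "norm A = 1" "norm B = 1" "norm C = 1" "A \<bullet> B = 0" "A \<bullet> C = 0" "B \<bullet> C = 0"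
      and eqs: "a = r *\<^sub>R (A + B + C)" "b = s *\<^sub>R (A - B - C)" "c = t *\<^sub>R (B - A - C)" "d = w *\<^sub>R (C - A - B)"
      using coverable_4[of a b c d "1 / sqrt 2"] cov abcd by auto
    have pm: "{x, - x} = {(1 / sqrt 3) *\<^sub>R m, - ((1 / sqrt 3) *\<^sub>R m)}"
      if "x = q *\<^sub>R m" "norm x = 1" "norm m = sqrt 3" for x m :: "real^3" and q
    proof -
      have "\<bar>q\<bar> = 1 / sqrt 3" using that by (simp add: field_simps)
      then have "q = 1 / sqrt 3 \<or> q = - (1 / sqrt 3)" by linarith
      then show ?thesis using that(1) by auto
    qed
    have "double_normals F = {a, - a} \<union> {b, - b} \<union> {c, - c} \<union> {d, - d}" unfolding dn abcd by blast
    also have "\<dots> = (\<Union>m\<in>{A + B + C, A - B - C, B - A - C, C - A - B}. {(1 / sqrt 3) *\<^sub>R m, - ((1 / sqrt 3) *\<^sub>R m)})"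
      unfolding pm[OF eqs(1) unit(1) orthonormal_frame_norm(1)[OF on]] pm[OF eqs(2) unit(2) orthonormal_frame_norm(2)[OF on]]
        pm[OF eqs(3) unit(3) orthonormal_frame_norm(3)[OF on]] pm[OF eqs(4) unit(4) orthonormal_frame_norm(4)[OF on]]
      by blast
    finally show "inscribed_cube_vertices (double_normals F)"
      unfolding inscribed_cube_iff_frame using on by blast
  next
    assume "inscribed_cube_vertices (double_normals F)"
    then obtain A B C :: "real^3" where on: "norm A = 1" "norm B = 1" "norm C = 1" "A \<bullet> B = 0" "A \<bullet> C = 0" "B \<bullet> C = 0"
      and V: "(\<Union>a\<in>N. {a, - a}) = (\<Union>m\<in>{A + B + C, A - B - C, B - A - C, C - A - B}. {(1 / sqrt 3) *\<^sub>R m, - ((1 / sqrt 3) *\<^sub>R m)})"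
      unfolding inscribed_cube_iff_frame dn by blast
    show "coverable N (1 / sqrt 2)"
    \<comment> \<open>The antipodal pairs of the cube fix the normals only up to sign, which the
      rescaling absorbs.\<close>
    proof (rule coverable_rescale[OF coverable_tetrahedral[OF on]])
      fix m assume "m \<in> {A + B + C, A - B - C, B - A - C, C - A - B}"
      then have "(1 / sqrt 3) *\<^sub>R m \<in> (\<Union>a\<in>N. {a, - a})" unfolding V by blast
      then obtain a where "a \<in> N" "(1 / sqrt 3) *\<^sub>R m = a \<or> (1 / sqrt 3) *\<^sub>R m = - a" by blast
      then have "(1 / sqrt 3) *\<^sub>R m \<in> N \<or> (- (1 / sqrt 3)) *\<^sub>R m \<in> N" by auto
      moreover have "1 / sqrt 3 \<noteq> 0" "- (1 / sqrt 3) \<noteq> 0" by simp_all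
      ultimately show "\<exists>r. r \<noteq> 0 \<and> r *\<^sub>R m \<in> N" by blast
    qed
  qed
  finally show ?thesis .
qed

section \<open>Bounds for general \<open>n\<close>\<close>

lemma R_gc_lower_bound:
  assumes n: "3 < n"
  shows "arccos (1 / tan ((1 + 2 / ((real n)\<^sup>2 - real n + 2)) * (pi / 4))) \<le> R_gc n"
proof -
  have n2: "2 \<le> n" and n4: "4 \<le> n" using n by simp_all
  obtain F where F: "arrangement n F" "cells_covered F (R_gc n)" using R_gc_is_least(1)[OF n2] by blast
  obtain B where B: "finite B" "card B = n" "\<And>b. b \<in> B \<Longrightarrow> norm b = 1" "F = perp_circle ` B"
    "\<And>a b. a \<in> B \<Longrightarrow> b \<in> B \<Longrightarrow> a \<noteq> b \<Longrightarrow> cross3 a b \<noteq> 0"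
    using arrangement_normals[OF F(1)] by metis
  then have "B \<noteq> {}" using n by auto
  then have R: "0 < R_gc n" "R_gc n \<le> pi / 2" "coverable B (cos (R_gc n))"
    using F(2) cells_covered_iff_coverable[OF B(1)] B(4) by auto
  have c0: "0 \<le> cos (R_gc n)" using R by (intro cos_ge_zero) auto
  have "pi / (real n * (real n - 1)) \<le> (1 - cos (R_gc n)) / cos (R_gc n)" if "0 < cos (R_gc n)"
    using B(3,5) that R(3) by (intro coverable_volume_bound[OF B(1,2) n2]) simp_all
  note bound = volume_bound_imp_tan_bound[OF n4 c0 this]
  have "arccos (1 / tan ((1 + 2 / ((real n)\<^sup>2 - real n + 2)) * (pi / 4))) \<le> arccos (cos (R_gc n))"
    using c0 bound by (intro arccos_le_arccos) auto
  also have "\<dots> = R_gc n" using R by (intro arccos_cos) auto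
  finally show ?thesis .
qed

text \<open>For small \<open>n\<close> the fraction exceeds 1. The \<open>min\<close> then makes the
  bound \<open>pi / 2\<close>, which hemispheres attain.\<close>

lemma R_gc_upper_bound:
  assumes n: "3 < n"
  shows "R_gc n \<le> arcsin (min 1 (8 / (sqrt 3 * root 3 (real n))))"
proof -
  define q where "q = root 3 (real n)"
  have q: "0 < q" "q ^ 3 = real n" using n by (simp_all add: q_def real_root_pow_pos2)
  define s where "s = 8 / (sqrt 3 * q)"
  have n2: "2 \<le> n" using n by simp
  have "\<exists>F. arrangement n F \<and> cells_covered F (arcsin (min 1 s))"
  proof (cases "1 \<le> s")
    case True
    have "coverable {axis 1 1} (cos (pi / 2))" using coverable_0[of "axis 1 1"] by simp
    then have "\<exists>F. arrangement n F \<and> cells_covered F (pi / 2)"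
      using n by (intro arrangement_of_normals[of "{axis 1 1}"]) auto
    then show ?thesis using True by (simp add: min_absorb1)
  next
    case False
    then have s: "0 < s" "s < 1" using q by (simp_all add: s_def)
    have "sqrt 3 \<le> sqrt 4" by (rule real_sqrt_le_mono) simp
    then have "sqrt 3 \<le> 2" by simp
    have "8 < sqrt 3 * q" using s q by (simp add: s_def)
    also have "\<dots> \<le> 2 * q" using \<open>sqrt 3 \<le> 2\<close> q(1) by (intro mult_right_mono) auto
    finally have q4: "4 < q" by simp
    then have "4 * 4 * q \<le> q * q * q" by (intro mult_mono) auto
    then have qn: "16 * q \<le> real n" using q(2) by (simp add: power3_eq_cube)
    \<comment> \<open>The largest \<open>k\<close> for which the crude count
      \<open>9 * (k + 1)\<close> of grid planes does not exceed \<open>n\<close>.\<close>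
    define k where "k = n div 9 - 1"
    have "64 < real n" using qn q4 by simp
    then have "64 < n" by simp
    then have nk: "9 * (k + 1) \<le> n" "n < 9 * (k + 2)" by (simp_all add: k_def)
    then have "real n < real (9 * (k + 2))" by (simp only: of_nat_less_iff)
    then have rk: "real n < 9 * real k + 18" by simp
    \<comment> \<open>The factor \<open>4 / 3\<close> is exactly what turns \<open>12 / k^2\<close>
      into at most \<open>64 / (3 * q^2) = s^2\<close>. It is available because \<open>q > 4\<close>
      gives \<open>16 * q \<le> q^3 = n\<close>.\<close>
    then have "q \<le> 4 / 3 * real k" "0 < real k" using qn q4 by linarith+
    then have k3: "q \<le> 4 / 3 * real k" "0 < k" by simp_all
    have "(3 * q)\<^sup>2 \<le> (4 * real k)\<^sup>2" using k3 q(1) by (intro power_mono) auto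
    then have "9 * q\<^sup>2 \<le> 16 * (real k)\<^sup>2" by (simp add: power_mult_distrib)
    then have "12 / (real k)\<^sup>2 \<le> 64 / (3 * q\<^sup>2)" using k3(2) q(1) by (simp add: field_simps)
    also have "\<dots> = s\<^sup>2" by (simp add: s_def power_divide power_mult_distrib)
    finally have ks: "12 / (real k)\<^sup>2 \<le> s\<^sup>2" .
    have "s\<^sup>2 \<le> 1" using s by (simp add: power_le_one)
    then have "coverable (grid_normals k) (sqrt (1 - 12 / (real k)\<^sup>2))"
      using ks by (intro coverable_grid k3(2)) auto
    then have "coverable (grid_normals k) (sqrt (1 - s\<^sup>2))" using ks by (rule_tac coverable_antimono) auto
    then have cov: "coverable (grid_normals k) (cos (arcsin s))" using s by (simp add: cos_arcsin)
    have "grid_normals k \<noteq> {}" using grid_normalsI[of 1 2 0 k] by auto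
    moreover have "card (grid_normals k) \<le> n" using grid_normals_finite_card(2)[of k] nk(1) by linarith
    moreover have "0 < arcsin s" "arcsin s \<le> pi / 2" using s arcsin_le_arcsin[of 0 s] arcsin_less_arcsin[of 0 s] arcsin_bounded[of s] by auto
    ultimately have "\<exists>F. arrangement n F \<and> cells_covered F (arcsin s)"
      using cov zero_notin_grid_normals by (intro arrangement_of_normals[of "grid_normals k"] grid_normals_finite_card(1)) auto
    then show ?thesis using s by (simp add: min_absorb2)
  qed
  then show ?thesis using R_gc_is_least(2)[OF n2] unfolding s_def q_def by blast
qed

theorem theorem5:
  shows "(R_gc 3 = arccos (1 / sqrt 3) \<and>
          (\<forall>F. arrangement 3 F \<longrightarrow> (extremal 3 F \<longleftrightarrow> pairwise orthogonal_circles F))) \<and>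
         (R_gc 4 = pi / 4 \<and>
          (\<forall>F. arrangement 4 F \<longrightarrow>
             (extremal 4 F \<longleftrightarrow> inscribed_cube_vertices (double_normals F)))) \<and>
         (\<forall>n::nat. n > 3 \<longrightarrow>
            arccos (1 / tan ((1 + 2 / ((real n)\<^sup>2 - real n + 2)) * (pi / 4))) \<le> R_gc n) \<and>
         (\<forall>n::nat. n > 3 \<longrightarrow>
            R_gc n \<le> arcsin (min 1 (8 / (sqrt 3 * root 3 (real n)))))"
  using R_gc_3 extremal_3_iff R_gc_4 extremal_4_iff R_gc_lower_bound R_gc_upper_bound by blast

end
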